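(* Let $\mathcal{H}$ be a Hilbert space, let $d\in\mathbb{N}$ (so $d\ge 1$), and let $S_0,\dots,S_d$ be bounded operators on $\mathcal{H}$; set $S_{-k}=S_k^*$ for $1\le k\le d$. Consider the truncated operator trigonometric moment problem with data $\{S_n\}_{n=0}^d$ and suppose that $$\sum_{k,l=0}^d (S_{l-k}h_l,h_k)_{\mathcal{H}}\ge 0\qquad\text{for all } h_0,\dots,h_d\in\mathcal{H}.$$ Let the Hilbert space $H$, the closed isometric operator $A$ in $H$ and the bounded operator $I:\mathcal{H}\to H$ be constructed from $\{S_n\}_{n=0}^d$ as described in the context. Then: (1) Every solution $F$ of the moment problem has the form $$F(t)=I^*\mathbf{E}_t I,\qquad t\in[0,2\pi],\qquad ( * )$$ where $\mathbf{E}_t$ is a strongly left-continuous spectral function of $A$. (2) Conversely, each strongly left-continuous spectral function $\mathbf{E}_t$ of $A$ generates by $( * )$ a solution of the moment problem. (3) The correspondence given by $( * )$ between all strongly left-continuous spectral functions of $A$ and all solutions of the moment problem is one-to-one.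
   Context: All Hilbert spaces are complex and not necessarily separable; operators are linear; $[\mathcal{H}]$ is the set of bounded operators on $\mathcal{H}$; scalar products are linear in the first argument. Moment problem. The truncated operator trigonometric moment problem with data $\{S_n\}_{n=0}^d\subset[\mathcal{H}]$ consists of finding a non-decreasing $[\mathcal{H}]$-valued function $F(t)$, $t\in[0,2\pi]$ (i.e. $F(t)-F(s)\ge 0$ for $s\le t$), with $F(0)=0$, strongly left-continuous in $(0,2\pi]$, such that $\int_0^{2\pi}e^{int}\,dF(t)=S_n$ for $n=0,1,\dots,d$. The integrals are limits of integral (Riemann–Stieltjes) sums in the strong operator topology. Such an $F$ is called a solution. Construction of $H$, $A$, $I$. Let $\mathfrak{B}$ be the complex vector space of formal sums $h=\sum_{j=0}^d h_j\varepsilon_j$ with $h_j\in\mathcal{H}$ ($\varepsilon_0,\dots,\varepsilon_d$ abstract symbols, operations coefficientwise). For $h=\sum_j h_j\varepsilon_j$, $g=\sum_k g_k\varepsilon_k$ put $\langle h,g\rangle=\sum_{j,k=0}^d(S_{j-k}h_j,g_k)_{\mathcal{H}}$, a non-negative Hermitian sesquilinear form under the positivity hypothesis. Identify $h$ and $g$ when $\langle h-g,h-g\rangle=0$, write $[h]$ for the class of $h$, and let $H$ be the Hilbert space obtained by completing the space of classes with the induced scalar product. Put $x_{h,j}=[h\varepsilon_j]$ for $h\in\mathcal{H}$, $0\le j\le d$; thus $(x_{h,j},x_{g,k})_H=(S_{j-k}h,g)_{\mathcal{H}}$. Let $A_0$ be the (well-defined, isometric) linear operator in $H$ with domain $D(A_0)=\{\sum_{j=0}^{d-1}x_{h_j,j}: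 h_0,\dots,h_{d-1}\in\mathcal{H}\}$ given by $A_0\sum_{j=0}^{d-1}x_{h_j,j}=\sum_{j=0}^{d-1}x_{h_j,j+1}$, and let $A=\overline{A_0}$ be its closure. Define $I:\mathcal{H}\to H$ by $Ih=x_{h,0}$; it is linear and bounded. Spectral functions. Let $\widetilde A\supseteq A$ be a unitary operator in a Hilbert space $\widetilde H\supseteq H$, with strongly left-continuous orthogonal resolution of the identity $\{\widetilde E_t\}_{t\in[0,2\pi]}$ (so $\widetilde A=\int_0^{2\pi}e^{it}d\widetilde E_t$, $\widetilde E_0=0$, $\widetilde E_{2\pi}=E_{\widetilde H}$ is the identity operator, with left-continuity in $(0,2\pi]$). The function $\mathbf{E}_t=P^{\widetilde H}_H\widetilde E_t|_H$, $t\in[0,2\pi]$, where $P^{\widetilde H}_H$ is the orthogonal projection of $\widetilde H$ onto $H$, is called a strongly left-continuous spectral function of $A$ (corresponding to $\widetilde A$). All strongly left-continuous spectral functions of $A$ are obtained in this way by letting $\widetilde H$ and $\widetilde A$ vary; two of them are the same if they coincide as $[H]$-valued functions of $t$. *)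

theory Defs
  imports "HOL-Analysis.Analysis" "HOL-Algebra.Module"
begin

section \<open>Complex Hilbert spaces with explicit carriers\<close>

text \<open>
  The Hilbert space \<open>H\<close> of the construction depends on the data of the moment problem, and the
  spectral functions of \<open>A\<close> involve variable Hilbert spaces.  Hilbert spaces are therefore records
  with a carrier set.  The underlying vector space is a module, in the sense of HOL-Algebra, over
  the field of complex numbers; the fields \<open>mult\<close> and \<open>one\<close> inherited from the module record
  have no meaning here.
\<close>

definition complex_ring :: "complex ring" where
  "complex_ring = \<lparr>carrier = UNIV, monoid.mult = (*), one = 1, zero = 0, add = (+)\<rparr>"

record 'v ipspace = "(complex, 'v) module" +
  sprod :: "'v \<Rightarrow> 'v \<Rightarrow> complex"  (\<open>\<langle>_,_\<rangle>\<index>\<close>)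

definition hnorm :: "'v ipspace \<Rightarrow> 'v \<Rightarrow> real" where
  "hnorm X x = sqrt (Re \<langle>x, x\<rangle>\<^bsub>X\<^esub>)"

definition hdist :: "'v ipspace \<Rightarrow> 'v \<Rightarrow> 'v \<Rightarrow> real" where
  "hdist X x y = hnorm X (x \<ominus>\<^bsub>X\<^esub> y)"

definition hlim :: "'v ipspace \<Rightarrow> (nat \<Rightarrow> 'v) \<Rightarrow> 'v \<Rightarrow> bool" where
  "hlim X s x \<longleftrightarrow> (\<lambda>n. hdist X (s n) x) \<longlonglongrightarrow> 0"

definition hCauchy :: "'v ipspace \<Rightarrow> (nat \<Rightarrow> 'v) \<Rightarrow> bool" where
  "hCauchy X s \<longleftrightarrow> (\<forall>\<epsilon>>0. \<exists>N. \<forall>m\<ge>N. \<forall>n\<ge>N. hdist X (s m) (s n) < \<epsilon>)"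

locale semi_inner_product_space = module complex_ring X for X :: "'v ipspace" (structure) +
  assumes sprod_add_left:
      "\<lbrakk>x \<in> carrier X; y \<in> carrier X; z \<in> carrier X\<rbrakk> \<Longrightarrow> \<langle>x \<oplus> y, z\<rangle> = \<langle>x, z\<rangle> + \<langle>y, z\<rangle>"
    and sprod_smult_left:
      "\<lbrakk>x \<in> carrier X; y \<in> carrier X\<rbrakk> \<Longrightarrow> \<langle>a \<odot>\<^bsub>X\<^esub> x, y\<rangle> = a * \<langle>x, y\<rangle>"
    and sprod_commute: "\<lbrakk>x \<in> carrier X; y \<in> carrier X\<rbrakk> \<Longrightarrow> \<langle>y, x\<rangle> = cnj \<langle>x, y\<rangle>"
    and sprod_nonneg: "x \<in> carrier X \<Longrightarrow> \<langle>x, x\<rangle> \<in> \<real>\<^sub>\<ge>\<^sub>0"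

locale hilbert_space = semi_inner_product_space +
  assumes sprod_definite: "\<lbrakk>x \<in> carrier X; \<langle>x, x\<rangle> = 0\<rbrakk> \<Longrightarrow> x = \<zero>"
    and complete: "\<lbrakk>range s \<subseteq> carrier X; hCauchy X s\<rbrakk> \<Longrightarrow> \<exists>x\<in>carrier X. hlim X s x"


section \<open>Bounded operators\<close>

text \<open>
  Operators are extensional functions on the carrier, so that equality of operators is equality
  of HOL functions.
\<close>

definition bounded_ops :: "'v ipspace \<Rightarrow> 'w ipspace \<Rightarrow> ('v \<Rightarrow> 'w) set" where
  "bounded_ops X Y = {T \<in> carrier X \<rightarrow>\<^sub>E carrier Y.
     (\<forall>x\<in>carrier X. \<forall>y\<in>carrier X. T (x \<oplus>\<^bsub>X\<^esub> y) = T x \<oplus>\<^bsub>Y\<^esub> T y) \<and>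
     (\<forall>a. \<forall>x\<in>carrier X. T (a \<odot>\<^bsub>X\<^esub> x) = a \<odot>\<^bsub>Y\<^esub> T x) \<and>
     (\<exists>M. \<forall>x\<in>carrier X. hnorm Y (T x) \<le> M * hnorm X x)}"

definition adjoint_op :: "'v ipspace \<Rightarrow> 'w ipspace \<Rightarrow> ('v \<Rightarrow> 'w) \<Rightarrow> 'w \<Rightarrow> 'v" where
  "adjoint_op X Y T = (\<lambda>y\<in>carrier Y.
     THE x. x \<in> carrier X \<and> (\<forall>z\<in>carrier X. \<langle>T z, y\<rangle>\<^bsub>Y\<^esub> = \<langle>z, x\<rangle>\<^bsub>X\<^esub>))"

definition isometries :: "'v ipspace \<Rightarrow> 'w ipspace \<Rightarrow> ('v \<Rightarrow> 'w) set" where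
  "isometries X Y = {T \<in> bounded_ops X Y. \<forall>x\<in>carrier X. \<forall>y\<in>carrier X. \<langle>T x, T y\<rangle>\<^bsub>Y\<^esub> = \<langle>x, y\<rangle>\<^bsub>X\<^esub>}"

definition unitary_ops :: "'v ipspace \<Rightarrow> ('v \<Rightarrow> 'v) set" where
  "unitary_ops X = {U \<in> isometries X X. U ` carrier X = carrier X}"

definition projection_ops :: "'v ipspace \<Rightarrow> ('v \<Rightarrow> 'v) set" where
  "projection_ops X = {P \<in> bounded_ops X X.
     (\<forall>x\<in>carrier X. P (P x) = P x) \<and>
     (\<forall>x\<in>carrier X. \<forall>y\<in>carrier X. \<langle>P x, y\<rangle>\<^bsub>X\<^esub> = \<langle>x, P y\<rangle>\<^bsub>X\<^esub>)}"

definition orth_proj :: "'v ipspace \<Rightarrow> 'v set \<Rightarrow> 'v \<Rightarrow> 'v" where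
  "orth_proj X M x = (THE p. p \<in> M \<and> (\<forall>m\<in>M. \<langle>x \<ominus>\<^bsub>X\<^esub> p, m\<rangle>\<^bsub>X\<^esub> = 0))"


section \<open>Operator functions on \<open>[0, 2\<pi>]\<close> and strong Riemann--Stieltjes integrals\<close>

definition operator_functions :: "'v ipspace \<Rightarrow> (real \<Rightarrow> 'v \<Rightarrow> 'v) set" where
  "operator_functions X = {0..2 * pi} \<rightarrow>\<^sub>E bounded_ops X X"

definition strongly_left_continuous :: "'v ipspace \<Rightarrow> (real \<Rightarrow> 'v \<Rightarrow> 'v) \<Rightarrow> bool" where
  "strongly_left_continuous X F \<longleftrightarrow>
     (\<forall>t\<in>{0<..2 * pi}. \<forall>x\<in>carrier X. ((\<lambda>s. hdist X (F s x) (F t x)) \<longlongrightarrow> 0) (at_left t))"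

definition tagged_partition :: "real \<Rightarrow> nat \<Rightarrow> (nat \<Rightarrow> real) \<Rightarrow> (nat \<Rightarrow> real) \<Rightarrow> bool" where
  "tagged_partition \<delta> m p \<tau> \<longleftrightarrow> p 0 = 0 \<and> p m = 2 * pi \<and>
     (\<forall>i<m. p i < p (Suc i) \<and> \<tau> i \<in> {p i..p (Suc i)} \<and> p (Suc i) - p i < \<delta>)"

definition rs_sum ::
  "'v ipspace \<Rightarrow> (real \<Rightarrow> complex) \<Rightarrow> (real \<Rightarrow> 'v \<Rightarrow> 'v) \<Rightarrow> nat \<Rightarrow> (nat \<Rightarrow> real) \<Rightarrow> (nat \<Rightarrow> real) \<Rightarrow> 'v \<Rightarrow> 'v"
  where "rs_sum X f F m p \<tau> x =
     (\<Oplus>\<^bsub>X\<^esub>i\<in>{..<m}. f (\<tau> i) \<odot>\<^bsub>X\<^esub> (F (p (Suc i)) x \<ominus>\<^bsub>X\<^esub> F (p i) x))"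

definition has_strong_integral ::
  "'v ipspace \<Rightarrow> (real \<Rightarrow> complex) \<Rightarrow> (real \<Rightarrow> 'v \<Rightarrow> 'v) \<Rightarrow> ('v \<Rightarrow> 'v) \<Rightarrow> bool"
  where "has_strong_integral X f F T \<longleftrightarrow>
     (\<forall>x\<in>carrier X. \<forall>\<epsilon>>0. \<exists>\<delta>>0. \<forall>m p \<tau>.
        tagged_partition \<delta> m p \<tau> \<longrightarrow> hdist X (rs_sum X f F m p \<tau> x) (T x) < \<epsilon>)"


section \<open>The truncated operator trigonometric moment problem\<close>

definition moment_solutions ::
  "'a ipspace \<Rightarrow> nat \<Rightarrow> (nat \<Rightarrow> 'a \<Rightarrow> 'a) \<Rightarrow> (real \<Rightarrow> 'a \<Rightarrow> 'a) set"
  where "moment_solutions \<H> d S = {F \<in> operator_functions \<H>.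
     (\<forall>s\<in>{0..2 * pi}. \<forall>t\<in>{0..2 * pi}. s \<le> t \<longrightarrow>
        (\<forall>x\<in>carrier \<H>. \<langle>F t x \<ominus>\<^bsub>\<H>\<^esub> F s x, x\<rangle>\<^bsub>\<H>\<^esub> \<in> \<real>\<^sub>\<ge>\<^sub>0)) \<and>
     (\<forall>x\<in>carrier \<H>. F 0 x = \<zero>\<^bsub>\<H>\<^esub>) \<and>
     strongly_left_continuous \<H> F \<and>
     (\<forall>n\<le>d. has_strong_integral \<H> (\<lambda>t. cis (real n * t)) F (S n))}"

definition ext_moment :: "'a ipspace \<Rightarrow> (nat \<Rightarrow> 'a \<Rightarrow> 'a) \<Rightarrow> int \<Rightarrow> 'a \<Rightarrow> 'a" where
  "ext_moment \<H> S k = (if k \<ge> 0 then S (nat k) else adjoint_op \<H> \<H> (S (nat (- k))))"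


section \<open>Separation and completion of semi-inner-product spaces\<close>

definition null_class :: "'v ipspace \<Rightarrow> 'v \<Rightarrow> 'v set" where
  "null_class X x = {y \<in> carrier X. \<langle>x \<ominus>\<^bsub>X\<^esub> y, x \<ominus>\<^bsub>X\<^esub> y\<rangle>\<^bsub>X\<^esub> = 0}"

definition null_quotient :: "'v ipspace \<Rightarrow> 'v set ipspace" where
  "null_quotient X =
     \<lparr>carrier = null_class X ` carrier X,
      monoid.mult = undefined, one = undefined,
      zero = null_class X \<zero>\<^bsub>X\<^esub>,
      add = (\<lambda>P Q. null_class X ((SOME x. x \<in> P) \<oplus>\<^bsub>X\<^esub> (SOME y. y \<in> Q))),
      smult = (\<lambda>a P. null_class X (a \<odot>\<^bsub>X\<^esub> (SOME x. x \<in> P))),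
      sprod = (\<lambda>P Q. \<langle>SOME x. x \<in> P, SOME y. y \<in> Q\<rangle>\<^bsub>X\<^esub>)\<rparr>"

definition cauchy_space :: "'v ipspace \<Rightarrow> (nat \<Rightarrow> 'v) ipspace" where
  "cauchy_space X =
     \<lparr>carrier = {s. range s \<subseteq> carrier X \<and> hCauchy X s},
      monoid.mult = undefined, one = undefined,
      zero = (\<lambda>n. \<zero>\<^bsub>X\<^esub>),
      add = (\<lambda>s t n. s n \<oplus>\<^bsub>X\<^esub> t n),
      smult = (\<lambda>a s n. a \<odot>\<^bsub>X\<^esub> s n),
      sprod = (\<lambda>s t. lim (\<lambda>n. \<langle>s n, t n\<rangle>\<^bsub>X\<^esub>))\<rparr>"

text \<open>
  The completion: Cauchy sequences modulo null sequences.  The points of the original space are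
  embedded as the classes of constant sequences.
\<close>

definition completion :: "'v ipspace \<Rightarrow> (nat \<Rightarrow> 'v) set ipspace" where
  "completion X = null_quotient (cauchy_space X)"

definition completion_embed :: "'v ipspace \<Rightarrow> 'v \<Rightarrow> (nat \<Rightarrow> 'v) set" where
  "completion_embed X x = null_class (cauchy_space X) (\<lambda>n. x)"


section \<open>The space \<open>H\<close> and the operators \<open>A\<close> and \<open>I\<close>\<close>

text \<open>A formal sum of \<open>h j \<epsilon>\<^sub>j\<close>, \<open>j \<le> d\<close>, is the family of its coefficients.\<close>

definition formal_sums :: "'a ipspace \<Rightarrow> nat \<Rightarrow> (nat \<Rightarrow> 'a \<Rightarrow> 'a) \<Rightarrow> (nat \<Rightarrow> 'a) ipspace" where
  "formal_sums \<H> d S =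
     \<lparr>carrier = {..d} \<rightarrow>\<^sub>E carrier \<H>,
      monoid.mult = undefined, one = undefined,
      zero = (\<lambda>j\<in>{..d}. \<zero>\<^bsub>\<H>\<^esub>),
      add = (\<lambda>h g. \<lambda>j\<in>{..d}. h j \<oplus>\<^bsub>\<H>\<^esub> g j),
      smult = (\<lambda>a h. \<lambda>j\<in>{..d}. a \<odot>\<^bsub>\<H>\<^esub> h j),
      sprod = (\<lambda>h g. \<Sum>j\<le>d. \<Sum>k\<le>d. \<langle>ext_moment \<H> S (int j - int k) (h j), g k\<rangle>\<^bsub>\<H>\<^esub>)\<rparr>"

definition formal_term :: "'a ipspace \<Rightarrow> nat \<Rightarrow> 'a \<Rightarrow> nat \<Rightarrow> nat \<Rightarrow> 'a" where
  "formal_term \<H> d h j = (\<lambda>i\<in>{..d}. if i = j then h else \<zero>\<^bsub>\<H>\<^esub>)"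

type_synonym 'a moment_vec = "(nat \<Rightarrow> (nat \<Rightarrow> 'a) set) set"

definition moment_space :: "'a ipspace \<Rightarrow> nat \<Rightarrow> (nat \<Rightarrow> 'a \<Rightarrow> 'a) \<Rightarrow> 'a moment_vec ipspace" where
  "moment_space \<H> d S = completion (null_quotient (formal_sums \<H> d S))"

definition moment_vec :: "'a ipspace \<Rightarrow> nat \<Rightarrow> (nat \<Rightarrow> 'a \<Rightarrow> 'a) \<Rightarrow> 'a \<Rightarrow> nat \<Rightarrow> 'a moment_vec" where
  "moment_vec \<H> d S h j =
     completion_embed (null_quotient (formal_sums \<H> d S))
       (null_class (formal_sums \<H> d S) (formal_term \<H> d h j))"

text \<open>Operators defined on a subspace are represented by their graphs.\<close>

definition graph_closure :: "'v ipspace \<Rightarrow> ('v \<times> 'v) set \<Rightarrow> ('v \<times> 'v) set" where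
  "graph_closure X G = {(x, y). x \<in> carrier X \<and> y \<in> carrier X \<and>
     (\<exists>u v. (\<forall>n. (u n, v n) \<in> G) \<and> hlim X u x \<and> hlim X v y)}"

definition shift_op0 ::
  "'a ipspace \<Rightarrow> nat \<Rightarrow> (nat \<Rightarrow> 'a \<Rightarrow> 'a) \<Rightarrow> ('a moment_vec \<times> 'a moment_vec) set"
  where "shift_op0 \<H> d S =
     {(\<Oplus>\<^bsub>moment_space \<H> d S\<^esub>j\<in>{..<d}. moment_vec \<H> d S (h j) j,
       \<Oplus>\<^bsub>moment_space \<H> d S\<^esub>j\<in>{..<d}. moment_vec \<H> d S (h j) (Suc j)) | h.
      \<forall>j<d. h j \<in> carrier \<H>}"

definition shift_op ::
  "'a ipspace \<Rightarrow> nat \<Rightarrow> (nat \<Rightarrow> 'a \<Rightarrow> 'a) \<Rightarrow> ('a moment_vec \<times> 'a moment_vec) set"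
  where "shift_op \<H> d S = graph_closure (moment_space \<H> d S) (shift_op0 \<H> d S)"

definition moment_embed :: "'a ipspace \<Rightarrow> nat \<Rightarrow> (nat \<Rightarrow> 'a \<Rightarrow> 'a) \<Rightarrow> 'a \<Rightarrow> 'a moment_vec" where
  "moment_embed \<H> d S = (\<lambda>h\<in>carrier \<H>. moment_vec \<H> d S h 0)"


section \<open>Spectral functions of an isometric operator\<close>

definition resolution_of_identity :: "'v ipspace \<Rightarrow> (real \<Rightarrow> 'v \<Rightarrow> 'v) \<Rightarrow> bool" where
  "resolution_of_identity X E \<longleftrightarrow>
     E \<in> {0..2 * pi} \<rightarrow>\<^sub>E projection_ops X \<and>
     (\<forall>s\<in>{0..2 * pi}. \<forall>t\<in>{0..2 * pi}. \<forall>x\<in>carrier X. E s (E t x) = E (min s t) x) \<and>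
     (\<forall>x\<in>carrier X. E 0 x = \<zero>\<^bsub>X\<^esub> \<and> E (2 * pi) x = x) \<and>
     strongly_left_continuous X E"

text \<open>
  The inclusion of \<open>H\<close> in the larger space \<open>K\<close> is an isometric embedding \<open>J\<close>; the compression
  projects onto \<open>J ` carrier H\<close> and identifies this subspace with \<open>H\<close> again.
\<close>

definition compression ::
  "'h ipspace \<Rightarrow> 'k ipspace \<Rightarrow> ('h \<Rightarrow> 'k) \<Rightarrow> ('k \<Rightarrow> 'k) \<Rightarrow> 'h \<Rightarrow> 'h"
  where "compression H K J T =
     (\<lambda>x\<in>carrier H. the_inv_into (carrier H) J (orth_proj K (J ` carrier H) (T (J x))))"

text \<open>
  A definition cannot quantify over all types.  The first argument is the type of the vectors of
  the spaces \<open>K\<close> in which the unitary extensions \<open>U\<close> of the operator with graph \<open>A\<close> act.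
\<close>

definition spectral_functions ::
  "'k itself \<Rightarrow> 'h ipspace \<Rightarrow> ('h \<times> 'h) set \<Rightarrow> (real \<Rightarrow> 'h \<Rightarrow> 'h) set"
  where "spectral_functions (_ :: 'k itself) H A =
     {(\<lambda>t\<in>{0..2 * pi}. compression H K J (Et t)) | (K :: 'k ipspace) J U Et.
        hilbert_space K \<and> J \<in> isometries H K \<and> U \<in> unitary_ops K \<and>
        (\<forall>(x, y)\<in>A. U (J x) = J y) \<and>
        resolution_of_identity K Et \<and> has_strong_integral K cis Et U}"

text \<open>
  A type large enough to carry a realization of every spectral function of \<open>A\<close>, whatever the
  type of the vectors of the larger space: the completion of a space of finitely supported
  functions from the reals to \<open>\<H>\<close>, as in Naimark's dilation theorem, has its vectors in this
  type.
\<close>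

type_synonym 'a dilation_vec = "(nat \<Rightarrow> real \<Rightarrow> 'a) set"

definition generated_solution ::
  "'a ipspace \<Rightarrow> nat \<Rightarrow> (nat \<Rightarrow> 'a \<Rightarrow> 'a) \<Rightarrow> (real \<Rightarrow> 'a moment_vec \<Rightarrow> 'a moment_vec) \<Rightarrow> real \<Rightarrow> 'a \<Rightarrow> 'a"
  where "generated_solution \<H> d S E =
     (\<lambda>t\<in>{0..2 * pi}. \<lambda>h\<in>carrier \<H>.
        adjoint_op \<H> (moment_space \<H> d S) (moment_embed \<H> d S) (E t (moment_embed \<H> d S h)))"

end

theory Submission
  imports Defs
begin

text \<open>
  Let \<open>F\<close> be a solution.  By Naimark's theorem \<open>F t = V\<^sup>* Et t V\<close> for an orthogonal resolution of
  the identity \<open>Et\<close> in a Hilbert space \<open>K\<close>.  Let \<open>U\<close> be the integral of \<open>cis\<close> with respect to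
  \<open>Et\<close>.  The inner products of the vectors \<open>U\<^sup>j V h\<close>, \<open>j \<le> d\<close>, are given by the moments of \<open>F\<close>,
  so \<open>x\<^sub>h\<^sub>,\<^sub>j \<mapsto> U\<^sup>j V h\<close> extends to an isometry \<open>J : H \<rightarrow> K\<close>; then \<open>U\<close> extends \<open>A\<close>, and the
  compression of \<open>Et\<close> to \<open>H\<close> is a spectral function that generates \<open>F\<close>.  Conversely, if
  \<open>U\<close> extends \<open>A\<close>, then \<open>U\<^sup>n J I h = J x\<^sub>h\<^sub>,\<^sub>n\<close>, which gives the moments of the generated function.

  Finally the inner product of \<open>E t x\<^sub>h\<^sub>,\<^sub>j\<close> and \<open>x\<^sub>g\<^sub>,\<^sub>k\<close> is the integral of \<open>cis ((j - k) s)\<close> over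
  \<open>[0, t)\<close> with respect to the distribution function \<open>\<langle>F s h, g\<rangle>\<close>, so \<open>F\<close> determines \<open>E\<close>,
  whatever the space of the dilation.  Hence every spectral function coincides with one that is
  obtained from Naimark's theorem, which bounds the type of the dilation space.
\<close>

section \<open>Semi-inner-product spaces\<close>

text \<open>The overview speaks of integrals, but no operator measure is built. All limits run
  through Riemann-Stieltjes sums, and two sums over unrelated partitions are compared directly. The
  integrals of \<open>cis (n * t)\<close>, for every integer n, are limits along uniform partitions;
  their scalar products show that they are the powers of one unitary operator.

  Naimark's space comes from the kernel \<open>F (min s t)\<close>: the scalar product of E s V x
  and E t V y has to be that of F (min s t) x and y, so positivity of this kernel is the substantial
  condition before completing.

  Uniqueness would classically pass to a minimal dilation and an intertwining unitary map; comparing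
  matrix entries on a total set avoids both.

  Spans are avoided as well. A closed span is a double orthogonal complement, equality of vectors is
  tested against total sets, and the isometry of H into the dilation space is not defined through
  linear combinations, where it would have to be shown independent of the representation.\<close>

lemma complex_ring_simps [simp]:
  "carrier complex_ring = UNIV" "a \<otimes>\<^bsub>complex_ring\<^esub> b = a * b" "\<one>\<^bsub>complex_ring\<^esub> = 1"
  "\<zero>\<^bsub>complex_ring\<^esub> = 0" "a \<oplus>\<^bsub>complex_ring\<^esub> b = a + b"
  by (simp_all add: complex_ring_def)

lemma cring_complex_ring: "cring complex_ring"
proof (rule cringI)
  show "abelian_group complex_ring"
    by (rule abelian_groupI) (auto intro: exI[of _ "- x" for x])
  show "comm_monoid complex_ring"
    by (rule comm_monoidI) auto
qed (auto simp: algebra_simps)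

lemma complex_ring_uminus [simp]: "\<ominus>\<^bsub>complex_ring\<^esub> a = - a"
proof -
  interpret cring complex_ring by (rule cring_complex_ring)
  show ?thesis
    by (rule minus_equality) auto
qed

text \<open>Flattens the group and module axioms into one list of obligations. Negation is demanded
  as \<open>(-1) \<odot> x\<close>, so the concrete records below, which have no field for it, need
  not supply an inverse. Applied to quotients, Cauchy sequences, finitely supported functions and
  formal sums.\<close>

lemma semi_inner_product_spaceI:
  fixes X :: "'v ipspace" (structure)
  assumes zero: "\<zero> \<in> carrier X"
    and add: "\<And>x y. \<lbrakk>x \<in> carrier X; y \<in> carrier X\<rbrakk> \<Longrightarrow> x \<oplus> y \<in> carrier X"
    and smult: "\<And>a x. x \<in> carrier X \<Longrightarrow> a \<odot> x \<in> carrier X"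
    and assoc: "\<And>x y z. \<lbrakk>x \<in> carrier X; y \<in> carrier X; z \<in> carrier X\<rbrakk> \<Longrightarrow> (x \<oplus> y) \<oplus> z = x \<oplus> (y \<oplus> z)"
    and comm: "\<And>x y. \<lbrakk>x \<in> carrier X; y \<in> carrier X\<rbrakk> \<Longrightarrow> x \<oplus> y = y \<oplus> x"
    and zero_add: "\<And>x. x \<in> carrier X \<Longrightarrow> \<zero> \<oplus> x = x"
    and neg: "\<And>x. x \<in> carrier X \<Longrightarrow> ((-1) \<odot> x) \<oplus> x = \<zero>"
    and l_distr: "\<And>a b x. x \<in> carrier X \<Longrightarrow> (a + b) \<odot> x = (a \<odot> x) \<oplus> (b \<odot> x)"
    and r_distr: "\<And>a x y. \<lbrakk>x \<in> carrier X; y \<in> carrier X\<rbrakk> \<Longrightarrow> a \<odot> (x \<oplus> y) = (a \<odot> x) \<oplus> (a \<odot> y)"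
    and smult_assoc: "\<And>a b x. x \<in> carrier X \<Longrightarrow> (a * b) \<odot> x = a \<odot> (b \<odot> x)"
    and one: "\<And>x. x \<in> carrier X \<Longrightarrow> 1 \<odot> x = x"
    and "\<And>x y z. \<lbrakk>x \<in> carrier X; y \<in> carrier X; z \<in> carrier X\<rbrakk> \<Longrightarrow> \<langle>x \<oplus> y, z\<rangle> = \<langle>x, z\<rangle> + \<langle>y, z\<rangle>"
    and "\<And>a x y. \<lbrakk>x \<in> carrier X; y \<in> carrier X\<rbrakk> \<Longrightarrow> \<langle>a \<odot> x, y\<rangle> = a * \<langle>x, y\<rangle>"
    and "\<And>x y. \<lbrakk>x \<in> carrier X; y \<in> carrier X\<rbrakk> \<Longrightarrow> \<langle>y, x\<rangle> = cnj \<langle>x, y\<rangle>"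
    and "\<And>x. x \<in> carrier X \<Longrightarrow> \<langle>x, x\<rangle> \<in> \<real>\<^sub>\<ge>\<^sub>0"
  shows "semi_inner_product_space X"
proof (rule semi_inner_product_space.intro)
  have "abelian_group X"
  proof (rule abelian_groupI)
    show "\<exists>y\<in>carrier X. y \<oplus> x = \<zero>" if "x \<in> carrier X" for x
      using bexI[of "\<lambda>y. y \<oplus> x = \<zero>", OF neg[OF that] smult[OF that]] .
  qed (fact zero add assoc comm zero_add)+
  then show "module complex_ring X"
    by (intro moduleI cring_complex_ring) (use smult l_distr r_distr smult_assoc one in auto)
qed (unfold_locales, (fact assms(12-15))+)


context semi_inner_product_space
begin

lemma smult_carrier [simp, intro]: "x \<in> carrier X \<Longrightarrow> a \<odot>\<^bsub>X\<^esub> x \<in> carrier X"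
  by simp

lemma smult_trivial [simp]:
  "x \<in> carrier X \<Longrightarrow> 0 \<odot>\<^bsub>X\<^esub> x = \<zero>\<^bsub>X\<^esub>" "x \<in> carrier X \<Longrightarrow> 1 \<odot>\<^bsub>X\<^esub> x = x"
  "a \<odot>\<^bsub>X\<^esub> \<zero>\<^bsub>X\<^esub> = \<zero>\<^bsub>X\<^esub>"
  using smult_l_null[of x] smult_one[of x] smult_r_null[of a] by simp_all

lemma smult_distrib:
  "x \<in> carrier X \<Longrightarrow> (a + b) \<odot>\<^bsub>X\<^esub> x = a \<odot>\<^bsub>X\<^esub> x \<oplus>\<^bsub>X\<^esub> b \<odot>\<^bsub>X\<^esub> x"
  "\<lbrakk>x \<in> carrier X; y \<in> carrier X\<rbrakk> \<Longrightarrow> a \<odot>\<^bsub>X\<^esub> (x \<oplus>\<^bsub>X\<^esub> y) = a \<odot>\<^bsub>X\<^esub> x \<oplus>\<^bsub>X\<^esub> a \<odot>\<^bsub>X\<^esub> y"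
  "x \<in> carrier X \<Longrightarrow> (a * b) \<odot>\<^bsub>X\<^esub> x = a \<odot>\<^bsub>X\<^esub> (b \<odot>\<^bsub>X\<^esub> x)"
  using smult_l_distr[of a b x] smult_r_distr[of a x y] smult_assoc1[of a b x] by simp_all

lemma neg_add_eq_zero: "x \<in> carrier X \<Longrightarrow> (-1) \<odot>\<^bsub>X\<^esub> x \<oplus>\<^bsub>X\<^esub> x = \<zero>\<^bsub>X\<^esub>"
  using smult_distrib(1)[of x "-1" 1] by simp

lemma uminus_eq_smult: "x \<in> carrier X \<Longrightarrow> \<ominus>\<^bsub>X\<^esub> x = (-1) \<odot>\<^bsub>X\<^esub> x"
  using smult_l_minus[of 1 x] smult_one[of x] by simp

lemma minus_eq_smult: "\<lbrakk>x \<in> carrier X; y \<in> carrier X\<rbrakk> \<Longrightarrow> x \<ominus>\<^bsub>X\<^esub> y = x \<oplus>\<^bsub>X\<^esub> (-1) \<odot>\<^bsub>X\<^esub> y"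
  by (simp add: a_minus_def uminus_eq_smult)

lemma minus_eq_zero_iff:
  assumes "x \<in> carrier X" "y \<in> carrier X"
  shows "x \<ominus>\<^bsub>X\<^esub> y = \<zero>\<^bsub>X\<^esub> \<longleftrightarrow> x = y"
proof
  assume "x \<ominus>\<^bsub>X\<^esub> y = \<zero>\<^bsub>X\<^esub>"
  then have "\<ominus>\<^bsub>X\<^esub> (\<ominus>\<^bsub>X\<^esub> y) = x"
    using assms by (intro M.minus_equality) (auto simp: a_minus_def)
  then show "x = y"
    using assms by simp
qed (use assms in \<open>simp add: a_minus_def M.r_neg\<close>)

lemma minus_carrier [simp, intro]: "\<lbrakk>x \<in> carrier X; y \<in> carrier X\<rbrakk> \<Longrightarrow> x \<ominus>\<^bsub>X\<^esub> y \<in> carrier X"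
  by (simp add: M.minus_closed)

lemma sprod_add_right:
  "\<lbrakk>x \<in> carrier X; y \<in> carrier X; z \<in> carrier X\<rbrakk> \<Longrightarrow> \<langle>z, x \<oplus>\<^bsub>X\<^esub> y\<rangle> = \<langle>z, x\<rangle> + \<langle>z, y\<rangle>"
  by (subst (1 2 3) sprod_commute) (auto simp: sprod_add_left)

lemma sprod_smult_right:
  "\<lbrakk>x \<in> carrier X; y \<in> carrier X\<rbrakk> \<Longrightarrow> \<langle>y, a \<odot>\<^bsub>X\<^esub> x\<rangle> = cnj a * \<langle>y, x\<rangle>"
  by (subst (1 2) sprod_commute) (auto simp: sprod_smult_left)

lemma sprod_zero_left [simp]: "x \<in> carrier X \<Longrightarrow> \<langle>\<zero>\<^bsub>X\<^esub>, x\<rangle> = 0"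
  using sprod_smult_left[of x x 0] by simp

lemma sprod_zero_right [simp]: "x \<in> carrier X \<Longrightarrow> \<langle>x, \<zero>\<^bsub>X\<^esub>\<rangle> = 0"
  by (subst sprod_commute) auto

lemma sprod_minus_left:
  "\<lbrakk>x \<in> carrier X; y \<in> carrier X; z \<in> carrier X\<rbrakk> \<Longrightarrow> \<langle>x \<ominus>\<^bsub>X\<^esub> y, z\<rangle> = \<langle>x, z\<rangle> - \<langle>y, z\<rangle>"
  by (simp add: minus_eq_smult sprod_add_left sprod_smult_left)

lemma sprod_minus_right:
  "\<lbrakk>x \<in> carrier X; y \<in> carrier X; z \<in> carrier X\<rbrakk> \<Longrightarrow> \<langle>z, x \<ominus>\<^bsub>X\<^esub> y\<rangle> = \<langle>z, x\<rangle> - \<langle>z, y\<rangle>"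
  by (simp add: minus_eq_smult sprod_add_right sprod_smult_right)

lemmas sprod_linear = sprod_add_left sprod_add_right sprod_smult_left sprod_smult_right
  sprod_minus_left sprod_minus_right

lemma sprod_finsum_left:
  assumes "y \<in> carrier X" "\<And>i. i \<in> I \<Longrightarrow> f i \<in> carrier X" "finite I"
  shows "\<langle>\<Oplus>\<^bsub>X\<^esub>i\<in>I. f i, y\<rangle> = (\<Sum>i\<in>I. \<langle>f i, y\<rangle>)"
  using assms(3,2) by induction (auto simp: assms(1) sprod_add_left M.finsum_insert Pi_def)

lemma sprod_finsum_right:
  assumes "y \<in> carrier X" "\<And>i. i \<in> I \<Longrightarrow> f i \<in> carrier X" "finite I"
  shows "\<langle>y, \<Oplus>\<^bsub>X\<^esub>i\<in>I. f i\<rangle> = (\<Sum>i\<in>I. \<langle>y, f i\<rangle>)"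
  using assms(3,2) by induction (auto simp: assms(1) sprod_add_right M.finsum_insert Pi_def)

section \<open>Seminorm, distance and limits\<close>

lemma sprod_self_Im [simp]: "x \<in> carrier X \<Longrightarrow> Im \<langle>x, x\<rangle> = 0"
  using sprod_nonneg[of x] by (simp add: complex_nonneg_Reals_iff)

lemma sprod_self_Re: "x \<in> carrier X \<Longrightarrow> 0 \<le> Re \<langle>x, x\<rangle>"
  using sprod_nonneg[of x] by (simp add: complex_nonneg_Reals_iff)

lemma hnorm_nonneg [simp]: "x \<in> carrier X \<Longrightarrow> 0 \<le> hnorm X x"
  by (simp add: hnorm_def sprod_self_Re)

lemma hnorm_power2: "x \<in> carrier X \<Longrightarrow> (hnorm X x)\<^sup>2 = Re \<langle>x, x\<rangle>"
  by (simp add: hnorm_def sprod_self_Re)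

lemma sprod_self: "x \<in> carrier X \<Longrightarrow> \<langle>x, x\<rangle> = of_real ((hnorm X x)\<^sup>2)"
  by (simp add: hnorm_power2 complex_eq_iff)

lemma hnorm_eq_0_iff: "x \<in> carrier X \<Longrightarrow> hnorm X x = 0 \<longleftrightarrow> \<langle>x, x\<rangle> = 0"
  by (simp add: sprod_self)

lemma hnorm_zero [simp]: "hnorm X \<zero>\<^bsub>X\<^esub> = 0"
  by (simp add: hnorm_def)

lemma Re_sprod_commute: "\<lbrakk>x \<in> carrier X; y \<in> carrier X\<rbrakk> \<Longrightarrow> Re \<langle>y, x\<rangle> = Re \<langle>x, y\<rangle>"
  by (subst sprod_commute) auto

lemma hnorm_add_power2:
  "\<lbrakk>x \<in> carrier X; y \<in> carrier X\<rbrakk> \<Longrightarrow>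
    (hnorm X (x \<oplus>\<^bsub>X\<^esub> y))\<^sup>2 = (hnorm X x)\<^sup>2 + 2 * Re \<langle>x, y\<rangle> + (hnorm X y)\<^sup>2"
  using Re_sprod_commute[of x y] by (simp add: hnorm_power2 sprod_linear)

lemma hnorm_minus_power2:
  "\<lbrakk>x \<in> carrier X; y \<in> carrier X\<rbrakk> \<Longrightarrow>
    (hnorm X (x \<ominus>\<^bsub>X\<^esub> y))\<^sup>2 = (hnorm X x)\<^sup>2 - 2 * Re \<langle>x, y\<rangle> + (hnorm X y)\<^sup>2"
  using Re_sprod_commute[of x y] by (simp add: hnorm_power2 sprod_linear)

lemma hnorm_smult: "x \<in> carrier X \<Longrightarrow> hnorm X (a \<odot>\<^bsub>X\<^esub> x) = cmod a * hnorm X x"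
proof -
  assume x: "x \<in> carrier X"
  have "\<langle>a \<odot>\<^bsub>X\<^esub> x, a \<odot>\<^bsub>X\<^esub> x\<rangle> = (a * cnj a) * \<langle>x, x\<rangle>"
    using x by (simp add: sprod_linear)
  also have "\<dots> = of_real ((cmod a)\<^sup>2 * (hnorm X x)\<^sup>2)"
    unfolding sprod_self[OF x] complex_norm_square[symmetric] of_real_mult ..
  finally have "(hnorm X (a \<odot>\<^bsub>X\<^esub> x))\<^sup>2 = (cmod a * hnorm X x)\<^sup>2"
    using x by (simp add: hnorm_power2 power_mult_distrib del: of_real_power of_real_mult)
  then show ?thesis
    using x by (simp add: power2_eq_iff_nonneg)
qed

text \<open>The form may be degenerate, so a vector of norm zero cannot be discarded as zero.
  Nonnegativity of the squared norm of \<open>x - r \<langle>x, y\<rangle> y\<close> for real r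
  covers both cases.\<close>

lemma Cauchy_Schwarz:
  assumes x: "x \<in> carrier X" and y: "y \<in> carrier X"
  shows "cmod \<langle>x, y\<rangle> \<le> hnorm X x * hnorm X y"
proof -
  define c where "c = (cmod \<langle>x, y\<rangle>)\<^sup>2"
  have quadratic: "0 \<le> (hnorm X x)\<^sup>2 - 2 * r * c + r\<^sup>2 * c * (hnorm X y)\<^sup>2" for r :: real
  proof -
    let ?t = "of_real r * \<langle>x, y\<rangle>"
    have "0 \<le> (hnorm X (x \<ominus>\<^bsub>X\<^esub> ?t \<odot>\<^bsub>X\<^esub> y))\<^sup>2"
      by simp
    also have "\<dots> = (hnorm X x)\<^sup>2 - 2 * Re \<langle>x, ?t \<odot>\<^bsub>X\<^esub> y\<rangle> + (cmod ?t * hnorm X y)\<^sup>2"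
      using x y by (subst hnorm_minus_power2) (auto simp: hnorm_smult)
    also have "\<langle>x, ?t \<odot>\<^bsub>X\<^esub> y\<rangle> = of_real (r * c)"
      using x y by (simp add: sprod_linear c_def complex_norm_square mult.commute del: of_real_power)
    finally show ?thesis
      by (simp add: c_def norm_mult power_mult_distrib mult.assoc)
  qed
  have "c \<le> (hnorm X x)\<^sup>2 * (hnorm X y)\<^sup>2"
  proof (cases "hnorm X y = 0")
    case True
    have "c = 0"
    proof (rule ccontr)
      assume "c \<noteq> 0"
      \<comment> \<open>Since y has norm zero the last term drops out, and for this \<open>r\<close>
        the rest equals -1.\<close>
      then show False
        using quadratic[of "((hnorm X x)\<^sup>2 + 1) / (2 * c)"] True by simp
    qed
    then show ?thesis by simp
  next
    case False
    define n where "n = (hnorm X y)\<^sup>2"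
    have "n > 0" using False by (simp add: n_def)
    \<comment> \<open>The value \<open>1 / n\<close> minimises the quadratic in
      \<open>r\<close>.\<close>
    then show ?thesis
      using quadratic[of "1 / n"]
      by (simp flip: n_def) (simp add: field_simps power2_eq_square)
  qed
  then have "(cmod \<langle>x, y\<rangle>)\<^sup>2 \<le> (hnorm X x * hnorm X y)\<^sup>2"
    by (simp add: c_def power_mult_distrib)
  then show ?thesis
    using x y by (simp add: power2_le_iff_abs_le)
qed

lemma hnorm_triangle:
  assumes x: "x \<in> carrier X" and y: "y \<in> carrier X"
  shows "hnorm X (x \<oplus>\<^bsub>X\<^esub> y) \<le> hnorm X x + hnorm X y"
proof -
  have "Re \<langle>x, y\<rangle> \<le> hnorm X x * hnorm X y"
    using Cauchy_Schwarz[OF x y] complex_Re_le_cmod[of "\<langle>x, y\<rangle>"] by linarith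
  then have "(hnorm X (x \<oplus>\<^bsub>X\<^esub> y))\<^sup>2 \<le> (hnorm X x + hnorm X y)\<^sup>2"
    using x y by (simp add: hnorm_add_power2 power2_sum)
  then show ?thesis
    using x y by (simp add: power2_le_iff_abs_le)
qed

lemma hdist_nonneg [simp]: "\<lbrakk>x \<in> carrier X; y \<in> carrier X\<rbrakk> \<Longrightarrow> 0 \<le> hdist X x y"
  by (simp add: hdist_def)

lemma hdist_power2:
  "\<lbrakk>x \<in> carrier X; y \<in> carrier X\<rbrakk> \<Longrightarrow>
    (hdist X x y)\<^sup>2 = (hnorm X x)\<^sup>2 - 2 * Re \<langle>x, y\<rangle> + (hnorm X y)\<^sup>2"
  by (simp add: hdist_def hnorm_minus_power2)

lemma hdist_commute: "\<lbrakk>x \<in> carrier X; y \<in> carrier X\<rbrakk> \<Longrightarrow> hdist X x y = hdist X y x"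
  using hdist_power2[of x y] hdist_power2[of y x] Re_sprod_commute[of x y] power2_eq_iff_nonneg
  by (smt (verit) hdist_nonneg)

lemma hdist_triangle:
  assumes "x \<in> carrier X" "y \<in> carrier X" "z \<in> carrier X"
  shows "hdist X x z \<le> hdist X x y + hdist X y z"
proof -
  \<comment> \<open>Comparing squared norms turns an identity of vectors into arithmetic with scalar
    products; \<open>hdist_add\<close> and \<open>hdist_smult\<close> use the same device.\<close>
  have "(hnorm X (x \<ominus>\<^bsub>X\<^esub> z))\<^sup>2 = (hnorm X ((x \<ominus>\<^bsub>X\<^esub> y) \<oplus>\<^bsub>X\<^esub> (y \<ominus>\<^bsub>X\<^esub> z)))\<^sup>2"
    using assms by (simp add: hnorm_power2 sprod_linear)
  then have "hnorm X (x \<ominus>\<^bsub>X\<^esub> z) = hnorm X ((x \<ominus>\<^bsub>X\<^esub> y) \<oplus>\<^bsub>X\<^esub> (y \<ominus>\<^bsub>X\<^esub> z))"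
    using assms power2_eq_iff_nonneg by (metis hnorm_nonneg minus_carrier M.a_closed)
  then show ?thesis
    using hnorm_triangle[of "x \<ominus>\<^bsub>X\<^esub> y" "y \<ominus>\<^bsub>X\<^esub> z"] assms by (simp add: hdist_def)
qed

lemma hdist_self [simp]: "x \<in> carrier X \<Longrightarrow> hdist X x x = 0"
  using hdist_power2[of x x] by (simp add: hnorm_power2)

lemma hdist_add:
  assumes "x \<in> carrier X" "y \<in> carrier X" "x' \<in> carrier X" "y' \<in> carrier X"
  shows "hdist X (x \<oplus>\<^bsub>X\<^esub> y) (x' \<oplus>\<^bsub>X\<^esub> y') \<le> hdist X x x' + hdist X y y'"
proof -
  have "(hdist X (x \<oplus>\<^bsub>X\<^esub> y) (x' \<oplus>\<^bsub>X\<^esub> y'))\<^sup>2 = (hnorm X ((x \<ominus>\<^bsub>X\<^esub> x') \<oplus>\<^bsub>X\<^esub> (y \<ominus>\<^bsub>X\<^esub> y')))\<^sup>2"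
    using assms by (simp add: hdist_def hnorm_power2 sprod_linear)
  then have "hdist X (x \<oplus>\<^bsub>X\<^esub> y) (x' \<oplus>\<^bsub>X\<^esub> y') = hnorm X ((x \<ominus>\<^bsub>X\<^esub> x') \<oplus>\<^bsub>X\<^esub> (y \<ominus>\<^bsub>X\<^esub> y'))"
    using assms power2_eq_iff_nonneg by (metis hnorm_nonneg hdist_nonneg minus_carrier M.a_closed)
  then show ?thesis
    using hnorm_triangle[of "x \<ominus>\<^bsub>X\<^esub> x'" "y \<ominus>\<^bsub>X\<^esub> y'"] assms by (simp add: hdist_def)
qed

lemma hdist_smult:
  assumes "x \<in> carrier X" "y \<in> carrier X"
  shows "hdist X (a \<odot>\<^bsub>X\<^esub> x) (a \<odot>\<^bsub>X\<^esub> y) = cmod a * hdist X x y"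
proof -
  have "(hdist X (a \<odot>\<^bsub>X\<^esub> x) (a \<odot>\<^bsub>X\<^esub> y))\<^sup>2 = (hnorm X (a \<odot>\<^bsub>X\<^esub> (x \<ominus>\<^bsub>X\<^esub> y)))\<^sup>2"
    using assms by (simp add: hdist_def hnorm_power2 sprod_linear algebra_simps)
  then have "hdist X (a \<odot>\<^bsub>X\<^esub> x) (a \<odot>\<^bsub>X\<^esub> y) = hnorm X (a \<odot>\<^bsub>X\<^esub> (x \<ominus>\<^bsub>X\<^esub> y))"
    using assms power2_eq_iff_nonneg by (metis hnorm_nonneg hdist_nonneg minus_carrier smult_carrier)
  then show ?thesis
    using assms by (simp add: hnorm_smult hdist_def)
qed

lemma hnorm_diff_le_hdist:
  assumes "x \<in> carrier X" "y \<in> carrier X"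
  shows "\<bar>hnorm X x - hnorm X y\<bar> \<le> hdist X x y"
proof -
  have zero: "hdist X z \<zero>\<^bsub>X\<^esub> = hnorm X z" if "z \<in> carrier X" for z
  proof -
    have "(hdist X z \<zero>\<^bsub>X\<^esub>)\<^sup>2 = (hnorm X z)\<^sup>2"
      using that by (simp add: hdist_power2)
    then show ?thesis
      using that power2_eq_iff_nonneg by (metis hnorm_nonneg hdist_nonneg M.zero_closed)
  qed
  show ?thesis
    using hdist_triangle[of x y "\<zero>\<^bsub>X\<^esub>"] hdist_triangle[of y x "\<zero>\<^bsub>X\<^esub>"] assms zero hdist_commute[of x y]
    by auto
qed

lemma tendsto_sprod:
  assumes s: "\<And>n. s n \<in> carrier X" and t: "\<And>n. t n \<in> carrier X"
    and x: "x \<in> carrier X" and y: "y \<in> carrier X"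
    and lim: "((\<lambda>n. hdist X (s n) x) \<longlongrightarrow> 0) F" "((\<lambda>n. hdist X (t n) y) \<longlongrightarrow> 0) F"
  shows "((\<lambda>n. \<langle>s n, t n\<rangle>) \<longlongrightarrow> \<langle>x, y\<rangle>) F"
proof -
  have bound: "cmod (\<langle>s n, t n\<rangle> - \<langle>x, y\<rangle>) \<le>
      hdist X (s n) x * hdist X (t n) y + hdist X (s n) x * hnorm X y + hnorm X x * hdist X (t n) y" for n
  proof -
    \<comment> \<open>Expanding around the limits leaves only distances and the fixed norms of x and
      y, so no bound on the two families has to be found.\<close>
    have "\<langle>s n, t n\<rangle> - \<langle>x, y\<rangle> = \<langle>s n \<ominus>\<^bsub>X\<^esub> x, t n \<ominus>\<^bsub>X\<^esub> y\<rangle> + \<langle>s n \<ominus>\<^bsub>X\<^esub> x, y\<rangle> + \<langle>x, t n \<ominus>\<^bsub>X\<^esub> y\<rangle>"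
      using s[of n] t[of n] x y by (simp add: sprod_linear)
    also have "cmod \<dots> \<le> cmod \<langle>s n \<ominus>\<^bsub>X\<^esub> x, t n \<ominus>\<^bsub>X\<^esub> y\<rangle> + cmod \<langle>s n \<ominus>\<^bsub>X\<^esub> x, y\<rangle> + cmod \<langle>x, t n \<ominus>\<^bsub>X\<^esub> y\<rangle>"
      by (meson norm_triangle_ineq order_trans add_right_mono)
    finally show ?thesis
      using Cauchy_Schwarz[of "s n \<ominus>\<^bsub>X\<^esub> x" "t n \<ominus>\<^bsub>X\<^esub> y"] Cauchy_Schwarz[of "s n \<ominus>\<^bsub>X\<^esub> x" y]
        Cauchy_Schwarz[of x "t n \<ominus>\<^bsub>X\<^esub> y"] s[of n] t[of n] x y by (simp add: hdist_def)
  qed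
  have "((\<lambda>n. hdist X (s n) x * hdist X (t n) y + hdist X (s n) x * hnorm X y + hnorm X x * hdist X (t n) y)
      \<longlongrightarrow> 0 * 0 + 0 * hnorm X y + hnorm X x * 0) F"
    by (intro tendsto_intros lim)
  then have "((\<lambda>n. \<langle>s n, t n\<rangle> - \<langle>x, y\<rangle>) \<longlongrightarrow> 0) F"
    by (intro Lim_null_comparison[OF eventuallyI[OF bound]]) simp
  then show ?thesis
    by (simp add: LIM_zero_iff)
qed

lemma hlim_sprod:
  assumes "range s \<subseteq> carrier X" "range t \<subseteq> carrier X" "x \<in> carrier X" "y \<in> carrier X"
    and "hlim X s x" "hlim X t y"
  shows "(\<lambda>n. \<langle>s n, t n\<rangle>) \<longlonglongrightarrow> \<langle>x, y\<rangle>"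
  using assms by (intro tendsto_sprod) (auto simp: hlim_def)

lemma hlim_const: "x \<in> carrier X \<Longrightarrow> hlim X (\<lambda>_. x) x"
  by (simp add: hlim_def)

lemma hlim_sprod_left:
  assumes "range s \<subseteq> carrier X" "x \<in> carrier X" "y \<in> carrier X" "hlim X s x"
  shows "(\<lambda>n. \<langle>s n, y\<rangle>) \<longlonglongrightarrow> \<langle>x, y\<rangle>"
  using assms hlim_sprod[of s "\<lambda>_. y" x y] hlim_const[of y] by auto

lemma hlim_imp_hCauchy:
  assumes s: "range s \<subseteq> carrier X" and x: "x \<in> carrier X" and lim: "hlim X s x"
  shows "hCauchy X s"
  unfolding hCauchy_def
proof (intro allI impI)
  fix e :: real assume "e > 0"
  then have "\<forall>\<^sub>F n in sequentially. hdist X (s n) x < e / 2"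
    using lim unfolding hlim_def by (intro order_tendstoD(2)[of _ 0]) auto
  then obtain N where N: "\<And>n. n \<ge> N \<Longrightarrow> hdist X (s n) x < e / 2"
    by (auto simp: eventually_sequentially)
  have "hdist X (s m) (s n) < e" if "m \<ge> N" "n \<ge> N" for m n
  proof -
    have "s m \<in> carrier X" "s n \<in> carrier X" using s by auto
    then show ?thesis
      using hdist_triangle[of "s m" x "s n"] hdist_commute[of x "s n"] N[OF that(1)] N[OF that(2)] x
      by simp
  qed
  then show "\<exists>N. \<forall>m\<ge>N. \<forall>n\<ge>N. hdist X (s m) (s n) < e"
    by blast
qed

end

section \<open>Hilbert spaces and bounded operators\<close>

definition closed_subspace :: "'v ipspace \<Rightarrow> 'v set \<Rightarrow> bool" where
  "closed_subspace X M \<longleftrightarrow> M \<subseteq> carrier X \<and> \<zero>\<^bsub>X\<^esub> \<in> M \<and>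
     (\<forall>x\<in>M. \<forall>y\<in>M. x \<oplus>\<^bsub>X\<^esub> y \<in> M) \<and> (\<forall>a. \<forall>x\<in>M. a \<odot>\<^bsub>X\<^esub> x \<in> M) \<and>
     (\<forall>s x. range s \<subseteq> M \<longrightarrow> x \<in> carrier X \<longrightarrow> hlim X s x \<longrightarrow> x \<in> M)"

text \<open>A is an arbitrary set. Its closed linear span is never formed from linear combinations:
  \<open>perp X (perp X A)\<close> stands for it, and \<open>perp X A \<subseteq> {\<zero>}\<close>
  expresses that A is total.\<close>

definition perp :: "'v ipspace \<Rightarrow> 'v set \<Rightarrow> 'v set" where
  "perp X A = {z \<in> carrier X. \<forall>a\<in>A. \<langle>a, z\<rangle>\<^bsub>X\<^esub> = 0}"

context hilbert_space
begin

lemma closed_subspace_carrier: "closed_subspace X (carrier X)"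
  by (auto simp: closed_subspace_def)

lemma vec_eqI:
  assumes x: "x \<in> carrier X" and y: "y \<in> carrier X"
    and eq: "\<And>z. z \<in> carrier X \<Longrightarrow> \<langle>x, z\<rangle> = \<langle>y, z\<rangle>"
  shows "x = y"
proof -
  have "x \<ominus>\<^bsub>X\<^esub> y = \<zero>\<^bsub>X\<^esub>"
    using x y eq by (intro sprod_definite) (auto simp: sprod_minus_left)
  then show ?thesis
    using x y by (simp add: minus_eq_zero_iff)
qed

lemma hdist_eq_0: "\<lbrakk>x \<in> carrier X; y \<in> carrier X; hdist X x y = 0\<rbrakk> \<Longrightarrow> x = y"
  using sprod_definite[of "x \<ominus>\<^bsub>X\<^esub> y"] hnorm_eq_0_iff[of "x \<ominus>\<^bsub>X\<^esub> y"]
  by (auto simp: hdist_def minus_eq_zero_iff)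

lemma hlim_unique:
  assumes "range s \<subseteq> carrier X" "x \<in> carrier X" "y \<in> carrier X" "hlim X s x" "hlim X s y"
  shows "x = y"
  using assms by (intro vec_eqI LIMSEQ_unique[OF hlim_sprod_left hlim_sprod_left])

text \<open>Stated on a closed subspace so that one argument serves twice: with M the whole space it
  yields adjoints, and with the functional induced by a fixed vector it yields orthogonal
  projections.\<close>

lemma riesz_subspace:
  assumes M: "closed_subspace X M"
    and add: "\<And>x y. \<lbrakk>x \<in> M; y \<in> M\<rbrakk> \<Longrightarrow> \<phi> (x \<oplus>\<^bsub>X\<^esub> y) = \<phi> x + \<phi> y"
    and smult: "\<And>a x. x \<in> M \<Longrightarrow> \<phi> (a \<odot>\<^bsub>X\<^esub> x) = a * \<phi> x"
    and bound: "\<And>x. x \<in> M \<Longrightarrow> cmod (\<phi> x) \<le> C * hnorm X x"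
  shows "\<exists>x\<in>M. \<forall>z\<in>M. \<phi> z = \<langle>z, x\<rangle>"
proof -
  have sub: "\<And>x. x \<in> M \<Longrightarrow> x \<in> carrier X" and zero: "\<zero>\<^bsub>X\<^esub> \<in> M"
    and Madd: "\<And>x y. \<lbrakk>x \<in> M; y \<in> M\<rbrakk> \<Longrightarrow> x \<oplus>\<^bsub>X\<^esub> y \<in> M"
    and Msmult: "\<And>a x. x \<in> M \<Longrightarrow> a \<odot>\<^bsub>X\<^esub> x \<in> M"
    using M by (auto simp: closed_subspace_def)
  \<comment> \<open>The minimizer of this functional is the representing vector (Dirichlet's principle).\<close>
  define q where "q x = (hnorm X x)\<^sup>2 - 2 * Re (\<phi> x)" for x
  have q_ge: "- C\<^sup>2 \<le> q x" if "x \<in> M" for x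
  proof -
    have "Re (\<phi> x) \<le> C * hnorm X x"
      using bound[OF that] complex_Re_le_cmod[of "\<phi> x"] by linarith
    moreover have "0 \<le> (hnorm X x - C)\<^sup>2"
      by simp
    ultimately show ?thesis
      by (simp add: q_def power2_diff mult_ac)
  qed
  define m where "m = Inf (q ` M)"
  have bdd: "bdd_below (q ` M)"
    using q_ge by (auto simp: bdd_below_def)
  have m_le: "m \<le> q x" if "x \<in> M" for x
    unfolding m_def using bdd that by (simp add: cINF_lower)
  have "\<exists>x\<in>M. q x < m + 1 / real (Suc n)" for n
  proof -
    have "Inf (q ` M) < m + 1 / real (Suc n)"
      by (simp add: m_def)
    then show ?thesis
      using cInf_lessD[of "q ` M"] zero by blast
  qed
  then obtain s where sM: "\<And>n. s n \<in> M" and s_le: "\<And>n. q (s n) < m + 1 / real (Suc n)"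
    by metis
  \<comment> \<open>The variation of \<open>q\<close> along z.\<close>
  have q_shift: "q (x \<oplus>\<^bsub>X\<^esub> of_real t \<odot>\<^bsub>X\<^esub> z) = q x + t\<^sup>2 * (hnorm X z)\<^sup>2 + 2 * t * (Re \<langle>x, z\<rangle> - Re (\<phi> z))"
    if "x \<in> M" "z \<in> M" for x z t
    using that sub
    by (simp add: q_def add smult Msmult hnorm_add_power2 sprod_linear hnorm_smult power_mult_distrib
        algebra_simps)
  \<comment> \<open>Turns near-minimality into closeness: at the midpoint \<open>q\<close> is at
    least \<open>m\<close>, so a minimising sequence is Cauchy.\<close>
  have parallelogram: "(hdist X x y)\<^sup>2 = 2 * q x + 2 * q y - 4 * q (of_real (1/2) \<odot>\<^bsub>X\<^esub> (x \<oplus>\<^bsub>X\<^esub> y))"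
    if "x \<in> M" "y \<in> M" for x y
  proof -
    have "(hnorm X (of_real (1/2) \<odot>\<^bsub>X\<^esub> (x \<oplus>\<^bsub>X\<^esub> y)))\<^sup>2 = 1/4 * (hnorm X (x \<oplus>\<^bsub>X\<^esub> y))\<^sup>2"
      using that sub by (subst hnorm_smult) (auto simp: power_divide norm_divide)
    moreover have "Re (\<phi> (of_real (1/2) \<odot>\<^bsub>X\<^esub> (x \<oplus>\<^bsub>X\<^esub> y))) = 1/2 * (Re (\<phi> x) + Re (\<phi> y))"
      using that Madd by (simp add: smult add)
    ultimately show ?thesis
      using that sub by (simp add: q_def hdist_power2 hnorm_add_power2)
  qed
  have "hCauchy X s"
    unfolding hCauchy_def
  proof (intro allI impI)
    fix e :: real assume "e > 0"
    \<comment> \<open>The parallelogram identity will bound the squared distance by 4 / (N +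
      1).\<close>
    obtain N :: nat where N: "N > 4 / e\<^sup>2"
      using reals_Archimedean2 by blast
    have "hdist X (s i) (s j) < e" if ij: "i \<ge> N" "j \<ge> N" for i j
    proof -
      have "1 / real (Suc k) \<le> 1 / real (Suc N)" if "k \<ge> N" for k
        using that by (intro divide_left_mono) auto
      then have "q (s i) < m + 1 / real (Suc N)" "q (s j) < m + 1 / real (Suc N)"
        using s_le[of i] s_le[of j] ij by (smt (verit))+
      moreover have "m \<le> q (of_real (1/2) \<odot>\<^bsub>X\<^esub> (s i \<oplus>\<^bsub>X\<^esub> s j))"
        using sM by (intro m_le Msmult Madd)
      ultimately have "(hdist X (s i) (s j))\<^sup>2 < 4 / real (Suc N)"
        using parallelogram[OF sM[of i] sM[of j]] by simp
      also have "\<dots> \<le> e\<^sup>2"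
      proof -
        have "4 < real (Suc N) * e\<^sup>2"
          using N \<open>e > 0\<close> by (simp add: field_simps) (smt (verit) zero_le_power2)
        then show ?thesis
          by (simp add: field_simps)
      qed
      finally show ?thesis
        using \<open>e > 0\<close> by (simp add: power2_less_imp_less)
    qed
    then show "\<exists>N. \<forall>m\<ge>N. \<forall>n\<ge>N. hdist X (s m) (s n) < e"
      by blast
  qed
  moreover have s_carrier: "range s \<subseteq> carrier X"
    using sM sub by auto
  ultimately obtain x where x: "x \<in> carrier X" and lim: "hlim X s x"
    using complete by blast
  have "range s \<subseteq> M"
    using sM by auto
  then have xM: "x \<in> M"
    using M x lim unfolding closed_subspace_def by blast
  have Re_eq: "Re \<langle>x, z\<rangle> = Re (\<phi> z)" if z: "z \<in> M" for z
  proof -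
    \<comment> \<open>The limit is taken in the variation inequality of the near-minimisers, so that
      only the scalar product with z has to converge.\<close>
    have nonneg: "0 \<le> t\<^sup>2 * (hnorm X z)\<^sup>2 + 2 * t * (Re \<langle>x, z\<rangle> - Re (\<phi> z))" for t
    proof (rule LIMSEQ_le)
      show "(\<lambda>n. - (1 / real (Suc n))) \<longlonglongrightarrow> 0"
        using tendsto_minus[OF LIMSEQ_inverse_real_of_nat] by (simp add: inverse_eq_divide)
      have "(\<lambda>n. \<langle>s n, z\<rangle>) \<longlonglongrightarrow> \<langle>x, z\<rangle>"
        using s_carrier x lim z sub by (intro hlim_sprod_left) auto
      then show "(\<lambda>n. t\<^sup>2 * (hnorm X z)\<^sup>2 + 2 * t * (Re \<langle>s n, z\<rangle> - Re (\<phi> z)))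
          \<longlonglongrightarrow> t\<^sup>2 * (hnorm X z)\<^sup>2 + 2 * t * (Re \<langle>x, z\<rangle> - Re (\<phi> z))"
        by (intro tendsto_intros)
      have "- (1 / real (Suc n)) \<le> t\<^sup>2 * (hnorm X z)\<^sup>2 + 2 * t * (Re \<langle>s n, z\<rangle> - Re (\<phi> z))" for n
        using m_le[of "s n \<oplus>\<^bsub>X\<^esub> of_real t \<odot>\<^bsub>X\<^esub> z"] q_shift[of "s n" z t] sM[of n] z Madd Msmult s_le[of n]
        by auto
      then show "\<exists>N. \<forall>n\<ge>N. - (1 / real (Suc n)) \<le> t\<^sup>2 * (hnorm X z)\<^sup>2 + 2 * t * (Re \<langle>s n, z\<rangle> - Re (\<phi> z))"
        by blast
    qed
    define b where "b = Re \<langle>x, z\<rangle> - Re (\<phi> z)"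
    \<comment> \<open>The summand 1 keeps the divisor positive, and \<open>t = - (b / a)\<close>
      makes the quadratic at most \<open>- (b\<^sup>2 / a)\<close>.\<close>
    define a where "a = (hnorm X z)\<^sup>2 + 1"
    have "a > 0" by (simp add: a_def add_nonneg_pos)
    have "0 \<le> (b / a)\<^sup>2 * (hnorm X z)\<^sup>2 - 2 * (b / a) * b"
      using nonneg[of "- (b / a)"] unfolding b_def[symmetric] by simp
    also have "(b / a)\<^sup>2 * (hnorm X z)\<^sup>2 \<le> (b / a)\<^sup>2 * a"
      by (intro mult_left_mono) (auto simp: a_def)
    also have "(b / a)\<^sup>2 * a - 2 * (b / a) * b = - (b\<^sup>2 / a)"
      using \<open>a > 0\<close> by (simp add: power2_eq_square field_simps)
    finally have "b\<^sup>2 / a \<le> 0" by simp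
    then have "b = 0"
      using \<open>a > 0\<close> by (simp add: divide_le_0_iff)
    then show ?thesis by (simp add: b_def)
  qed
  have "\<phi> z = \<langle>z, x\<rangle>" if z: "z \<in> M" for z
  proof (rule complex_eqI)
    show "Re (\<phi> z) = Re \<langle>z, x\<rangle>"
      using Re_eq[OF z] Re_sprod_commute[of x z] x z sub by simp
    \<comment> \<open>The real part at \<i> z is minus the imaginary part at z.\<close>
    show "Im (\<phi> z) = Im \<langle>z, x\<rangle>"
      using Re_eq[OF Msmult[OF z, of \<i>]] x z sub sprod_commute[of x z]
      by (simp add: smult sprod_smult_right)
  qed
  with xM show ?thesis by blast
qed

text \<open>The projection is the Riesz representative on M of the functional induced by x. Two
  candidates differ by a vector of M that is orthogonal to itself.\<close>

lemma projection_exists: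
  assumes M: "closed_subspace X M" and x: "x \<in> carrier X"
  shows "\<exists>!p. p \<in> M \<and> (\<forall>m\<in>M. \<langle>x \<ominus>\<^bsub>X\<^esub> p, m\<rangle> = 0)"
proof -
  have sub: "\<And>y. y \<in> M \<Longrightarrow> y \<in> carrier X"
    and minus: "\<And>y z. \<lbrakk>y \<in> M; z \<in> M\<rbrakk> \<Longrightarrow> y \<ominus>\<^bsub>X\<^esub> z \<in> M"
    using M by (auto simp: closed_subspace_def minus_eq_smult subset_iff)
  obtain p where p: "p \<in> M" "\<And>m. m \<in> M \<Longrightarrow> \<langle>m, x\<rangle> = \<langle>m, p\<rangle>"
    using riesz_subspace[OF M, of "\<lambda>m. \<langle>m, x\<rangle>" "hnorm X x"] x sub Cauchy_Schwarz[of _ x]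
    by (auto simp: sprod_linear mult.commute)
  show ?thesis
  proof (rule ex1I[of _ p], safe)
    fix m assume "m \<in> M"
    then show "\<langle>x \<ominus>\<^bsub>X\<^esub> p, m\<rangle> = 0"
      using p sub x sprod_commute[of m x] sprod_commute[of m p] by (simp add: sprod_minus_left)
  next
    fix r assume r: "r \<in> M" "\<forall>m\<in>M. \<langle>x \<ominus>\<^bsub>X\<^esub> r, m\<rangle> = 0"
    have "\<langle>x, m\<rangle> = \<langle>p, m\<rangle>" if "m \<in> M" for m
      using p sub x that sprod_commute[of m x] sprod_commute[of m p] by simp
    then have "\<langle>r \<ominus>\<^bsub>X\<^esub> p, r \<ominus>\<^bsub>X\<^esub> p\<rangle> = 0"
      using r p sub x minus[of r p] by (simp add: sprod_minus_left)
    then have "r \<ominus>\<^bsub>X\<^esub> p = \<zero>\<^bsub>X\<^esub>"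
      using sprod_definite r p sub by simp
    then show "r = p"
      using r p sub by (simp add: minus_eq_zero_iff)
  qed (fact p)
qed

section \<open>Orthogonal projections\<close>

lemma orth_proj_mem: "\<lbrakk>closed_subspace X M; x \<in> carrier X\<rbrakk> \<Longrightarrow> orth_proj X M x \<in> M"
  using theI'[OF projection_exists[of M x]] by (simp add: orth_proj_def)

lemma orth_proj_carrier: "\<lbrakk>closed_subspace X M; x \<in> carrier X\<rbrakk> \<Longrightarrow> orth_proj X M x \<in> carrier X"
  using orth_proj_mem by (auto simp: closed_subspace_def)

lemma sprod_orth_proj:
  assumes "closed_subspace X M" "x \<in> carrier X" "m \<in> M"
  shows "\<langle>orth_proj X M x, m\<rangle> = \<langle>x, m\<rangle>"
proof -
  have "\<langle>x \<ominus>\<^bsub>X\<^esub> orth_proj X M x, m\<rangle> = 0"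
    using theI'[OF projection_exists[OF assms(1,2)]] assms(3) by (simp add: orth_proj_def)
  moreover have "m \<in> carrier X"
    using assms by (auto simp: closed_subspace_def)
  ultimately show ?thesis
    using assms orth_proj_carrier[OF assms(1,2)] by (simp add: sprod_minus_left)
qed

lemma orth_proj_eqI:
  assumes M: "closed_subspace X M" and x: "x \<in> carrier X" and p: "p \<in> M"
    and eq: "\<And>m. m \<in> M \<Longrightarrow> \<langle>p, m\<rangle> = \<langle>x, m\<rangle>"
  shows "orth_proj X M x = p"
  unfolding orth_proj_def
proof (rule the1_equality[OF projection_exists[OF M x]])
  show "p \<in> M \<and> (\<forall>m\<in>M. \<langle>x \<ominus>\<^bsub>X\<^esub> p, m\<rangle> = 0)"
    using M x p eq by (auto simp: closed_subspace_def subset_iff sprod_minus_left)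
qed

lemma orth_proj_id: "\<lbrakk>closed_subspace X M; x \<in> M\<rbrakk> \<Longrightarrow> orth_proj X M x = x"
  by (rule orth_proj_eqI) (auto simp: closed_subspace_def)

lemma orth_proj_self_adjoint:
  assumes M: "closed_subspace X M" and x: "x \<in> carrier X" and y: "y \<in> carrier X"
  shows "\<langle>orth_proj X M x, y\<rangle> = \<langle>x, orth_proj X M y\<rangle>"
proof -
  have "\<langle>orth_proj X M x, y\<rangle> = cnj \<langle>orth_proj X M y, orth_proj X M x\<rangle>"
    using assms by (simp add: sprod_orth_proj orth_proj_mem orth_proj_carrier sprod_commute[of y])
  also have "\<dots> = \<langle>x, orth_proj X M y\<rangle>"
    using assms sprod_commute[of "orth_proj X M y" "orth_proj X M x"]
    by (simp add: sprod_orth_proj orth_proj_mem orth_proj_carrier)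
  finally show ?thesis .
qed

lemma hnorm_orth_proj_le:
  assumes M: "closed_subspace X M" and x: "x \<in> carrier X"
  shows "hnorm X (orth_proj X M x) \<le> hnorm X x"
proof -
  let ?p = "orth_proj X M x"
  have p: "?p \<in> carrier X" by (rule orth_proj_carrier[OF assms])
  have "\<langle>?p, ?p\<rangle> = \<langle>x, ?p\<rangle>"
    using sprod_orth_proj[OF M x orth_proj_mem[OF M x]] .
  then have "(hnorm X ?p)\<^sup>2 \<le> hnorm X x * hnorm X ?p"
    using Cauchy_Schwarz[OF x p] complex_Re_le_cmod[of "\<langle>x, ?p\<rangle>"] p by (simp add: hnorm_power2)
  moreover have "0 \<le> hnorm X ?p" "0 \<le> hnorm X x"
    using p x by auto
  ultimately show ?thesis
    by (cases "hnorm X ?p = 0") (auto simp: power2_eq_square)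
qed

lemma orth_proj_projection_ops:
  assumes M: "closed_subspace X M"
  shows "(\<lambda>x\<in>carrier X. orth_proj X M x) \<in> projection_ops X"
proof -
  note [simp] = orth_proj_carrier[OF M] orth_proj_self_adjoint[OF M]
  \<comment> \<open>Self-adjointness moves the projection onto the test vector, where linearity is
    that of the scalar product.\<close>
  have "orth_proj X M (x \<oplus>\<^bsub>X\<^esub> y) = orth_proj X M x \<oplus>\<^bsub>X\<^esub> orth_proj X M y"
    if "x \<in> carrier X" "y \<in> carrier X" for x y
    using that by (intro vec_eqI) (auto simp: sprod_linear)
  moreover have "orth_proj X M (a \<odot>\<^bsub>X\<^esub> x) = a \<odot>\<^bsub>X\<^esub> orth_proj X M x" if "x \<in> carrier X" for x a
    using that by (intro vec_eqI) (auto simp: sprod_linear)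
  moreover have "\<exists>C. \<forall>x\<in>carrier X. hnorm X (orth_proj X M x) \<le> C * hnorm X x"
    using hnorm_orth_proj_le[OF M] by (intro exI[of _ 1]) simp
  moreover have "orth_proj X M (orth_proj X M x) = orth_proj X M x" if "x \<in> carrier X" for x
    using that by (intro orth_proj_id M orth_proj_mem)
  ultimately show ?thesis
    by (auto simp: projection_ops_def bounded_ops_def)
qed

section \<open>Orthogonal complements and total sets\<close>

lemma perp_subset: "perp X A \<subseteq> carrier X"
  by (auto simp: perp_def)

lemma closed_subspace_perp:
  assumes A: "A \<subseteq> carrier X"
  shows "closed_subspace X (perp X A)"
  unfolding closed_subspace_def
proof (intro conjI allI impI ballI)
  fix s x assume s: "range s \<subseteq> perp X A" and x: "x \<in> carrier X" and lim: "hlim X s x"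
  have "\<langle>a, x\<rangle> = 0" if "a \<in> A" for a
  proof (rule LIMSEQ_unique)
    show "(\<lambda>n. \<langle>a, s n\<rangle>) \<longlonglongrightarrow> \<langle>a, x\<rangle>"
      using that A s x lim hlim_const[of a] by (intro hlim_sprod) (auto simp: perp_def)
    show "(\<lambda>n. \<langle>a, s n\<rangle>) \<longlonglongrightarrow> 0"
      using that s by (auto simp: perp_def image_subset_iff)
  qed
  then show "x \<in> perp X A"
    using x by (simp add: perp_def)
qed (use A in \<open>auto simp: perp_def sprod_linear subset_iff\<close>)

lemma perp_antimono: "A \<subseteq> B \<Longrightarrow> perp X B \<subseteq> perp X A"
  by (auto simp: perp_def)

lemma perp_perp_superset: "A \<subseteq> carrier X \<Longrightarrow> A \<subseteq> perp X (perp X A)"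
proof
  fix a assume "A \<subseteq> carrier X" "a \<in> A"
  then have "\<langle>z, a\<rangle> = 0" if "z \<in> perp X A" for z
    using that sprod_commute[of a z] by (auto simp: perp_def)
  then show "a \<in> perp X (perp X A)"
    using \<open>A \<subseteq> carrier X\<close> \<open>a \<in> A\<close> by (auto simp: perp_def)
qed

text \<open>The residual of a vector under the projection onto M is orthogonal to A, hence zero.
  This replaces induction over linear combinations followed by a passage to limits: a property that
  defines a closed subspace is checked on a total set only.\<close>

lemma closed_subspace_eq_carrier:
  assumes M: "closed_subspace X M" and A: "A \<subseteq> M" and total: "perp X A \<subseteq> {\<zero>\<^bsub>X\<^esub>}"
  shows "M = carrier X"
proof
  show "M \<subseteq> carrier X" using M by (simp add: closed_subspace_def)
  show "carrier X \<subseteq> M"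
  proof
    fix x assume x: "x \<in> carrier X"
    let ?p = "orth_proj X M x"
    have p: "?p \<in> M" "?p \<in> carrier X"
      using M x by (auto intro: orth_proj_mem orth_proj_carrier)
    have "\<langle>a, x \<ominus>\<^bsub>X\<^esub> ?p\<rangle> = 0" if "a \<in> A" for a
    proof -
      have a: "a \<in> M" "a \<in> carrier X"
        using that A M by (auto simp: closed_subspace_def)
      then show ?thesis
        using M x p sprod_orth_proj[OF M x a(1)] sprod_commute[of x a] sprod_commute[of ?p a]
        by (simp add: sprod_minus_right)
    qed
    then have "x \<ominus>\<^bsub>X\<^esub> ?p \<in> perp X A"
      using x p by (simp add: perp_def)
    then have "x \<ominus>\<^bsub>X\<^esub> ?p = \<zero>\<^bsub>X\<^esub>"
      using total by blast
    then show "x \<in> M"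
      using x p by (simp add: minus_eq_zero_iff)
  qed
qed

end

section \<open>Bounded operators and adjoints\<close>

lemma bounded_opsD:
  assumes "T \<in> bounded_ops X Y"
  shows "x \<in> carrier X \<Longrightarrow> T x \<in> carrier Y"
    and "\<lbrakk>x \<in> carrier X; y \<in> carrier X\<rbrakk> \<Longrightarrow> T (x \<oplus>\<^bsub>X\<^esub> y) = T x \<oplus>\<^bsub>Y\<^esub> T y"
    and "x \<in> carrier X \<Longrightarrow> T (a \<odot>\<^bsub>X\<^esub> x) = a \<odot>\<^bsub>Y\<^esub> T x"
    and "T \<in> extensional (carrier X)"
  using assms by (auto simp: bounded_ops_def PiE_def)

text \<open>The constant is made strictly positive, so that later estimates may divide by
  it.\<close>

lemma bounded_ops_bound:
  assumes "semi_inner_product_space X" "T \<in> bounded_ops X Y"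
  obtains C where "C > 0" "\<And>x. x \<in> carrier X \<Longrightarrow> hnorm Y (T x) \<le> C * hnorm X x"
proof -
  interpret X: semi_inner_product_space X by fact
  obtain C where C: "x \<in> carrier X \<Longrightarrow> hnorm Y (T x) \<le> C * hnorm X x" for x
    using assms(2) unfolding bounded_ops_def by blast
  have "hnorm Y (T x) \<le> max C 1 * hnorm X x" if "x \<in> carrier X" for x
    using C[OF that] mult_right_mono[of C "max C 1" "hnorm X x"] that by fastforce
  then show ?thesis
    using that[of "max C 1"] by simp
qed

lemma bounded_ops_minus:
  assumes "semi_inner_product_space X" "semi_inner_product_space Y" "T \<in> bounded_ops X Y"
    and "x \<in> carrier X" "y \<in> carrier X"
  shows "T (x \<ominus>\<^bsub>X\<^esub> y) = T x \<ominus>\<^bsub>Y\<^esub> T y"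
proof -
  interpret X: semi_inner_product_space X by fact
  interpret Y: semi_inner_product_space Y by fact
  show ?thesis
    using assms by (simp add: X.minus_eq_smult Y.minus_eq_smult bounded_opsD[OF assms(3)])
qed

lemma bounded_ops_zero:
  assumes "semi_inner_product_space X" "semi_inner_product_space Y" "T \<in> bounded_ops X Y"
  shows "T \<zero>\<^bsub>X\<^esub> = \<zero>\<^bsub>Y\<^esub>"
proof -
  interpret X: semi_inner_product_space X by fact
  interpret Y: semi_inner_product_space Y by fact
  show ?thesis
    using bounded_opsD(3)[OF assms(3), of "\<zero>\<^bsub>X\<^esub>" 0] bounded_opsD(1)[OF assms(3), of "\<zero>\<^bsub>X\<^esub>"] by simp
qed

lemma tendsto_bounded_op:
  assumes X: "semi_inner_product_space X" and Y: "semi_inner_product_space Y" and T: "T \<in> bounded_ops X Y"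
    and s: "\<And>n. s n \<in> carrier X" and x: "x \<in> carrier X"
    and lim: "((\<lambda>n. hdist X (s n) x) \<longlongrightarrow> 0) F"
  shows "((\<lambda>n. hdist Y (T (s n)) (T x)) \<longlongrightarrow> 0) F"
proof -
  interpret X: semi_inner_product_space X by fact
  interpret Y: semi_inner_product_space Y by fact
  obtain C where C: "\<And>x. x \<in> carrier X \<Longrightarrow> hnorm Y (T x) \<le> C * hnorm X x"
    using bounded_ops_bound[OF X T] by blast
  have le: "hdist Y (T (s n)) (T x) \<le> C * hdist X (s n) x" for n
    using C[of "s n \<ominus>\<^bsub>X\<^esub> x"] s[of n] x bounded_ops_minus[OF X Y T, of "s n" x] by (simp add: hdist_def)
  have nonneg: "0 \<le> hdist Y (T (s n)) (T x)" for n
    using s[of n] x by (simp add: bounded_opsD(1)[OF T])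
  show ?thesis
    using tendsto_mult_right_zero[OF lim, of C]
    by (rule tendsto_sandwich[OF always_eventually[rule_format] always_eventually[rule_format] tendsto_const, OF nonneg le])
qed

lemma hlim_bounded_op:
  assumes "semi_inner_product_space X" "semi_inner_product_space Y" "T \<in> bounded_ops X Y"
    and "range s \<subseteq> carrier X" "x \<in> carrier X" "hlim X s x"
  shows "hlim Y (\<lambda>n. T (s n)) (T x)"
  using tendsto_bounded_op[OF assms(1-3) _ assms(5), of s] assms(4,6) unfolding hlim_def by blast

text \<open>Riesz representation of the functional that sends z to the scalar product of T z and y,
  which Cauchy-Schwarz bounds.\<close>

lemma adjoint_op_exists:
  assumes X: "hilbert_space X" and Y: "hilbert_space Y" and T: "T \<in> bounded_ops X Y" and y: "y \<in> carrier Y"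
  shows "\<exists>!x. x \<in> carrier X \<and> (\<forall>z\<in>carrier X. \<langle>T z, y\<rangle>\<^bsub>Y\<^esub> = \<langle>z, x\<rangle>\<^bsub>X\<^esub>)"
proof -
  interpret X: hilbert_space X by fact
  interpret Y: hilbert_space Y by fact
  obtain C where C: "\<And>x. x \<in> carrier X \<Longrightarrow> hnorm Y (T x) \<le> C * hnorm X x"
    using bounded_ops_bound[OF _ T] X.semi_inner_product_space_axioms by blast
  have "cmod \<langle>T z, y\<rangle>\<^bsub>Y\<^esub> \<le> (C * hnorm Y y) * hnorm X z" if "z \<in> carrier X" for z
  proof -
    have "cmod \<langle>T z, y\<rangle>\<^bsub>Y\<^esub> \<le> hnorm Y (T z) * hnorm Y y"
      using that y by (intro Y.Cauchy_Schwarz bounded_opsD(1)[OF T])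
    also have "\<dots> \<le> (C * hnorm X z) * hnorm Y y"
      using that y by (intro mult_right_mono C) auto
    finally show ?thesis by (simp add: mult_ac)
  qed
  then have "\<exists>x\<in>carrier X. \<forall>z\<in>carrier X. \<langle>T z, y\<rangle>\<^bsub>Y\<^esub> = \<langle>z, x\<rangle>\<^bsub>X\<^esub>"
    using y by (intro X.riesz_subspace[OF X.closed_subspace_carrier, of "\<lambda>z. \<langle>T z, y\<rangle>\<^bsub>Y\<^esub>"])
      (auto simp: bounded_opsD[OF T] Y.sprod_linear)
  then obtain x where x: "x \<in> carrier X" "\<forall>z\<in>carrier X. \<langle>T z, y\<rangle>\<^bsub>Y\<^esub> = \<langle>z, x\<rangle>\<^bsub>X\<^esub>"
    by blast
  moreover have "x' = x" if "x' \<in> carrier X" "\<forall>z\<in>carrier X. \<langle>T z, y\<rangle>\<^bsub>Y\<^esub> = \<langle>z, x'\<rangle>\<^bsub>X\<^esub>" for x'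
  proof (rule X.vec_eqI)
    fix z assume z: "z \<in> carrier X"
    then have "\<langle>z, x'\<rangle>\<^bsub>X\<^esub> = \<langle>z, x\<rangle>\<^bsub>X\<^esub>"
      using that(2) x(2) by force
    then show "\<langle>x', z\<rangle>\<^bsub>X\<^esub> = \<langle>x, z\<rangle>\<^bsub>X\<^esub>"
      unfolding X.sprod_commute[OF z that(1)] X.sprod_commute[OF z x(1)] by simp
  qed (use that x in auto)
  ultimately show ?thesis by blast
qed

lemma
  assumes X: "hilbert_space X" and Y: "hilbert_space Y" and T: "T \<in> bounded_ops X Y" and y: "y \<in> carrier Y"
  shows adjoint_op_carrier: "adjoint_op X Y T y \<in> carrier X"
    and sprod_adjoint_op_right: "z \<in> carrier X \<Longrightarrow> \<langle>z, adjoint_op X Y T y\<rangle>\<^bsub>X\<^esub> = \<langle>T z, y\<rangle>\<^bsub>Y\<^esub>"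
proof -
  have eq: "adjoint_op X Y T y = (THE x. x \<in> carrier X \<and> (\<forall>z\<in>carrier X. \<langle>T z, y\<rangle>\<^bsub>Y\<^esub> = \<langle>z, x\<rangle>\<^bsub>X\<^esub>))"
    unfolding adjoint_op_def using y by (rule restrict_apply')
  note adj = theI'[OF adjoint_op_exists[OF assms], folded eq]
  show "adjoint_op X Y T y \<in> carrier X"
    using adj by (rule conjunct1)
  show "\<langle>z, adjoint_op X Y T y\<rangle>\<^bsub>X\<^esub> = \<langle>T z, y\<rangle>\<^bsub>Y\<^esub>" if "z \<in> carrier X"
    using adj[THEN conjunct2, rule_format, OF that] by (rule sym)
qed

lemma sprod_adjoint_op_left:
  assumes X: "hilbert_space X" and Y: "hilbert_space Y" and T: "T \<in> bounded_ops X Y" and y: "y \<in> carrier Y"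
    and z: "z \<in> carrier X"
  shows "\<langle>adjoint_op X Y T y, z\<rangle>\<^bsub>X\<^esub> = \<langle>y, T z\<rangle>\<^bsub>Y\<^esub>"
proof -
  interpret X: hilbert_space X by fact
  interpret Y: hilbert_space Y by fact
  show ?thesis
    using sprod_adjoint_op_right[OF X Y T y z] X.sprod_commute[OF z adjoint_op_carrier[OF X Y T y]]
      Y.sprod_commute[OF bounded_opsD(1)[OF T z] y] by simp
qed

lemma adjoint_op_bounded_ops:
  assumes X: "hilbert_space X" and Y: "hilbert_space Y" and T: "T \<in> bounded_ops X Y"
  shows "adjoint_op X Y T \<in> bounded_ops Y X"
proof -
  interpret X: hilbert_space X by fact
  interpret Y: hilbert_space Y by fact
  obtain C where "C > 0" and C: "\<And>x. x \<in> carrier X \<Longrightarrow> hnorm Y (T x) \<le> C * hnorm X x"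
    using bounded_ops_bound[OF _ T] X.semi_inner_product_space_axioms by blast
  let ?A = "adjoint_op X Y T"
  note [simp] = adjoint_op_carrier[OF X Y T] sprod_adjoint_op_left[OF X Y T] bounded_opsD(1)[OF T]
  have "?A (x \<oplus>\<^bsub>Y\<^esub> y) = ?A x \<oplus>\<^bsub>X\<^esub> ?A y" if "x \<in> carrier Y" "y \<in> carrier Y" for x y
    using that by (intro X.vec_eqI) (auto simp: X.sprod_linear Y.sprod_linear)
  moreover have "?A (a \<odot>\<^bsub>Y\<^esub> x) = a \<odot>\<^bsub>X\<^esub> ?A x" if "x \<in> carrier Y" for x a
    using that by (intro X.vec_eqI) (auto simp: X.sprod_linear Y.sprod_linear)
  moreover have "hnorm X (?A y) \<le> C * hnorm Y y" if y: "y \<in> carrier Y" for y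
  proof -
    have "(hnorm X (?A y))\<^sup>2 = Re \<langle>y, T (?A y)\<rangle>\<^bsub>Y\<^esub>"
      using y by (simp add: X.hnorm_power2)
    also have "\<dots> \<le> hnorm Y y * hnorm Y (T (?A y))"
      using y Y.Cauchy_Schwarz[of y "T (?A y)"] complex_Re_le_cmod order_trans by fastforce
    also have "\<dots> \<le> hnorm Y y * (C * hnorm X (?A y))"
      using y by (intro mult_left_mono C) auto
    finally have "hnorm X (?A y) * hnorm X (?A y) \<le> (C * hnorm Y y) * hnorm X (?A y)"
      by (simp add: power2_eq_square mult_ac)
    moreover have "0 \<le> hnorm X (?A y)" "0 \<le> C * hnorm Y y"
      using y \<open>C > 0\<close> by auto
    ultimately show ?thesis
      by (cases "hnorm X (?A y) = 0") auto
  qed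
  moreover have "?A \<in> extensional (carrier Y)"
    by (simp add: adjoint_op_def)
  ultimately show ?thesis
    unfolding bounded_ops_def PiE_def by (auto intro!: exI[of _ C])
qed

lemma bounded_ops_compose:
  assumes X: "semi_inner_product_space X" and "T \<in> bounded_ops X Y" "R \<in> bounded_ops Y Z"
    and Y: "semi_inner_product_space Y"
  shows "(\<lambda>x\<in>carrier X. R (T x)) \<in> bounded_ops X Z"
proof -
  interpret X: semi_inner_product_space X by fact
  note T = bounded_opsD[OF assms(2)] and R = bounded_opsD[OF assms(3)]
  obtain C where C: "C > 0" "\<And>x. x \<in> carrier X \<Longrightarrow> hnorm Y (T x) \<le> C * hnorm X x"
    using bounded_ops_bound[OF X assms(2)] by blast
  obtain D where D: "D > 0" "\<And>x. x \<in> carrier Y \<Longrightarrow> hnorm Z (R x) \<le> D * hnorm Y x"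
    using bounded_ops_bound[OF Y assms(3)] by blast
  have "hnorm Z (R (T x)) \<le> (D * C) * hnorm X x" if "x \<in> carrier X" for x
  proof -
    have "hnorm Z (R (T x)) \<le> D * hnorm Y (T x)"
      using that by (intro D T)
    also have "\<dots> \<le> D * (C * hnorm X x)"
      using that C D by (intro mult_left_mono) auto
    finally show ?thesis by simp
  qed
  then show ?thesis
    by (auto simp: bounded_ops_def T R)
qed

text \<open>Extending \<open>a i \<mapsto> b i\<close> to linear combinations would need an argument
  that it is well defined, and then a passage to the closure. For a graph given as a bi-orthogonal
  complement linearity is immediate, and equality of the Gram matrices makes it single-valued and
  isometric.\<close>

lemma isometric_extension:
  assumes X: "hilbert_space X" and Y: "hilbert_space Y"
    and a: "\<And>i. i \<in> I \<Longrightarrow> a i \<in> carrier X" and b: "\<And>i. i \<in> I \<Longrightarrow> b i \<in> carrier Y"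
    and ab: "\<And>i j. \<lbrakk>i \<in> I; j \<in> I\<rbrakk> \<Longrightarrow> \<langle>a i, a j\<rangle>\<^bsub>X\<^esub> = \<langle>b i, b j\<rangle>\<^bsub>Y\<^esub>"
    and total: "perp X (a ` I) \<subseteq> {\<zero>\<^bsub>X\<^esub>}"
  obtains J where "J \<in> isometries X Y" "\<And>i. i \<in> I \<Longrightarrow> J (a i) = b i"
proof -
  interpret X: hilbert_space X by fact
  interpret Y: hilbert_space Y by fact
  \<comment> \<open>The closed span of the pairs \<open>(a i, b i)\<close>, as a bi-orthogonal complement, is the graph of \<open>J\<close>.\<close>
  define G where "G x y \<longleftrightarrow> x \<in> carrier X \<and> y \<in> carrier Y \<and>
    (\<forall>u\<in>carrier X. \<forall>v\<in>carrier Y. (\<forall>i\<in>I. \<langle>a i, u\<rangle>\<^bsub>X\<^esub> = \<langle>b i, v\<rangle>\<^bsub>Y\<^esub>) \<longrightarrow> \<langle>x, u\<rangle>\<^bsub>X\<^esub> = \<langle>y, v\<rangle>\<^bsub>Y\<^esub>)"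
    for x y
  have G_carrier: "x \<in> carrier X" "y \<in> carrier Y" if "G x y" for x y
    using that by (auto simp: G_def)
  have G_gen: "G (a i) (b i)" if "i \<in> I" for i
    using that a b by (simp add: G_def)
  \<comment> \<open>The defining condition is used twice. Each pair \<open>(a i, b i)\<close> is an
    admissible test pair by \<open>ab\<close>; after conjugation this says that (x, y) is itself an
    admissible test pair for (x', y').\<close>
  have G_sprod: "\<langle>x, x'\<rangle>\<^bsub>X\<^esub> = \<langle>y, y'\<rangle>\<^bsub>Y\<^esub>" if G: "G x y" "G x' y'" for x y x' y'
  proof -
    have "\<langle>a i, x\<rangle>\<^bsub>X\<^esub> = \<langle>b i, y\<rangle>\<^bsub>Y\<^esub>" if i: "i \<in> I" for i
    proof -
      have "\<langle>x, a i\<rangle>\<^bsub>X\<^esub> = \<langle>y, b i\<rangle>\<^bsub>Y\<^esub>"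
        using G(1) i a b ab by (auto simp: G_def)
      then show ?thesis
        using G_carrier[OF G(1)] i a b X.sprod_commute[of x "a i"] Y.sprod_commute[of y "b i"] by simp
    qed
    then have "\<langle>x', x\<rangle>\<^bsub>X\<^esub> = \<langle>y', y\<rangle>\<^bsub>Y\<^esub>"
      using G by (auto simp: G_def)
    then show ?thesis
      using G_carrier[OF G(1)] G_carrier[OF G(2)] X.sprod_commute[of x' x] Y.sprod_commute[of y' y] by simp
  qed
  have G_add: "G (x \<oplus>\<^bsub>X\<^esub> x') (y \<oplus>\<^bsub>Y\<^esub> y')" if "G x y" "G x' y'" for x y x' y'
    using that by (auto simp: G_def X.sprod_linear Y.sprod_linear)
  have G_smult: "G (c \<odot>\<^bsub>X\<^esub> x) (c \<odot>\<^bsub>Y\<^esub> y)" if "G x y" for x y c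
    using that by (auto simp: G_def X.sprod_linear Y.sprod_linear)
  have G_dist: "hdist X x x' = hdist Y y y'" if G: "G x y" "G x' y'" for x y x' y'
    using G_sprod[OF G(1) G(1)] G_sprod[OF G] G_sprod[OF G(2) G(1)] G_sprod[OF G(2) G(2)]
      G_carrier[OF G(1)] G_carrier[OF G(2)]
    by (simp add: hdist_def hnorm_def X.sprod_linear Y.sprod_linear)
  have G_unique: "y = y'" if "G x y" "G x y'" for x y y'
    using that G_dist[OF that] G_carrier[OF that(1)] G_carrier[OF that(2)] by (auto intro: Y.hdist_eq_0)
  have "closed_subspace X {x. \<exists>y. G x y}"
    unfolding closed_subspace_def
  proof (intro conjI allI impI ballI)
    show "{x. \<exists>y. G x y} \<subseteq> carrier X"
      using G_carrier by blast
    have "G \<zero>\<^bsub>X\<^esub> \<zero>\<^bsub>Y\<^esub>"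
      by (auto simp: G_def)
    then show "\<zero>\<^bsub>X\<^esub> \<in> {x. \<exists>y. G x y}" by blast
  next
    fix x x' assume "x \<in> {x. \<exists>y. G x y}" "x' \<in> {x. \<exists>y. G x y}"
    then show "x \<oplus>\<^bsub>X\<^esub> x' \<in> {x. \<exists>y. G x y}"
      using G_add by blast
  next
    fix c x assume "x \<in> {x. \<exists>y. G x y}"
    then show "c \<odot>\<^bsub>X\<^esub> x \<in> {x. \<exists>y. G x y}"
      using G_smult by blast
  next
    fix s x assume "range s \<subseteq> {x. \<exists>y. G x y}" and x: "x \<in> carrier X" and lim: "hlim X s x"
    then have "\<forall>n. \<exists>y. G (s n) y" by auto
    then obtain t where t: "\<And>n. G (s n) (t n)" by metis
    have s_carrier: "range s \<subseteq> carrier X" and t_carrier: "range t \<subseteq> carrier Y"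
      using G_carrier[OF t] by auto
    \<comment> \<open>Distances agree along the graph, so the images form a Cauchy sequence, and
      completeness of Y supplies the image of the limit.\<close>
    have "hCauchy Y t"
      using X.hlim_imp_hCauchy[OF s_carrier x lim] G_dist[OF t t] by (simp add: hCauchy_def)
    then obtain y where y: "y \<in> carrier Y" and lim': "hlim Y t y"
      using Y.complete t_carrier by blast
    have "G x y"
      unfolding G_def
    proof (intro conjI ballI impI x y)
      fix u v assume uv: "u \<in> carrier X" "v \<in> carrier Y" "\<forall>i\<in>I. \<langle>a i, u\<rangle>\<^bsub>X\<^esub> = \<langle>b i, v\<rangle>\<^bsub>Y\<^esub>"
      have "\<langle>s n, u\<rangle>\<^bsub>X\<^esub> = \<langle>t n, v\<rangle>\<^bsub>Y\<^esub>" for n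
        using t[of n] uv by (simp add: G_def)
      then show "\<langle>x, u\<rangle>\<^bsub>X\<^esub> = \<langle>y, v\<rangle>\<^bsub>Y\<^esub>"
        using X.hlim_sprod_left[OF s_carrier x uv(1) lim] Y.hlim_sprod_left[OF t_carrier y uv(2) lim']
        by (auto intro: LIMSEQ_unique)
    qed
    then show "x \<in> {x. \<exists>y. G x y}" by blast
  qed
  then have dom: "{x. \<exists>y. G x y} = carrier X"
    by (rule X.closed_subspace_eq_carrier[OF _ _ total]) (auto dest: G_gen)
  define J where "J = (\<lambda>x\<in>carrier X. THE y. G x y)"
  have J_eq: "J x = y" if "G x y" for x y
    using that G_unique G_carrier[OF that] by (auto simp: J_def)
  have J: "G x (J x)" if "x \<in> carrier X" for x
  proof -
    have "x \<in> {x. \<exists>y. G x y}"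
      using that unfolding dom .
    then obtain y where "G x y"
      by (elim CollectE exE)
    then show ?thesis
      using J_eq by simp
  qed
  have "J \<in> bounded_ops X Y"
    unfolding bounded_ops_def
  proof (intro CollectI conjI ballI allI)
    show "J \<in> carrier X \<rightarrow>\<^sub>E carrier Y"
      using J G_carrier(2) by (auto simp: PiE_def) (auto simp: J_def)
    show "J (x \<oplus>\<^bsub>X\<^esub> x') = J x \<oplus>\<^bsub>Y\<^esub> J x'" if "x \<in> carrier X" "x' \<in> carrier X" for x x'
      using that by (intro J_eq G_add J)
    show "J (c \<odot>\<^bsub>X\<^esub> x) = c \<odot>\<^bsub>Y\<^esub> J x" if "x \<in> carrier X" for x c
      using that by (intro J_eq G_smult J)
    show "\<exists>C. \<forall>x\<in>carrier X. hnorm Y (J x) \<le> C * hnorm X x"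
      using G_sprod[OF J J] by (intro exI[of _ 1]) (simp add: hnorm_def)
  qed
  then have "J \<in> isometries X Y"
    using G_sprod[OF J J] by (auto simp: isometries_def)
  then show ?thesis
    using that[of J] J_eq G_gen by blast
qed

text \<open>The difference lies in the complement of a total set. Below, the projections of the
  dilation and the uniqueness of spectral functions are handled by testing against generators in
  this way.\<close>

lemma (in hilbert_space) total_eqI:
  assumes total: "perp X A \<subseteq> {\<zero>\<^bsub>X\<^esub>}" and A: "A \<subseteq> carrier X"
    and x: "x \<in> carrier X" and y: "y \<in> carrier X"
    and eq: "\<And>a. a \<in> A \<Longrightarrow> \<langle>x, a\<rangle> = \<langle>y, a\<rangle>"
  shows "x = y"
proof -
  have "\<langle>a, x \<ominus>\<^bsub>X\<^esub> y\<rangle> = 0" if "a \<in> A" for a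
  proof -
    have "\<langle>x \<ominus>\<^bsub>X\<^esub> y, a\<rangle> = 0" "a \<in> carrier X"
      using A x y eq that by (auto simp: sprod_minus_left)
    then show ?thesis
      using x y sprod_commute[of "x \<ominus>\<^bsub>X\<^esub> y" a] by simp
  qed
  then have "x \<ominus>\<^bsub>X\<^esub> y \<in> perp X A"
    using x y by (simp add: perp_def)
  then show ?thesis
    using total x y minus_eq_zero_iff by blast
qed

lemma sprod_bounded_op_finsum:
  assumes X: "semi_inner_product_space X" and Y: "semi_inner_product_space Y" and T: "T \<in> bounded_ops X Y"
    and I: "finite I" and f: "\<And>i. i \<in> I \<Longrightarrow> f i \<in> carrier X" and y: "y \<in> carrier Y"
  shows "\<langle>T (\<Oplus>\<^bsub>X\<^esub>i\<in>I. f i), y\<rangle>\<^bsub>Y\<^esub> = (\<Sum>i\<in>I. \<langle>T (f i), y\<rangle>\<^bsub>Y\<^esub>)"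
proof -
  interpret X: semi_inner_product_space X by fact
  interpret Y: semi_inner_product_space Y by fact
  show ?thesis
    using I f
  proof induction
    case empty
    then show ?case
      using y by (simp add: bounded_ops_zero[OF X Y T])
  next
    case (insert i I)
    have "(\<Oplus>\<^bsub>X\<^esub>i\<in>I. f i) \<in> carrier X"
      using insert.prems by (intro X.M.finsum_closed) auto
    then show ?case
      using insert y by (simp add: X.M.finsum_insert Pi_def bounded_opsD[OF T] Y.sprod_add_left)
  qed
qed

text \<open>Polarisation: the form at x + y gives the imaginary parts, at x + \<i> y the real
  parts.\<close>

lemma (in semi_inner_product_space) real_form_imp_hermitian:
  assumes T: "T \<in> bounded_ops X X" and real: "\<And>x. x \<in> carrier X \<Longrightarrow> \<langle>T x, x\<rangle> \<in> \<real>"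
    and x: "x \<in> carrier X" and y: "y \<in> carrier X"
  shows "\<langle>T x, y\<rangle> = cnj \<langle>T y, x\<rangle>"
proof (rule complex_eqI)
  note [simp] = bounded_opsD[OF T]
  have Im: "Im \<langle>T z, z\<rangle> = 0" if "z \<in> carrier X" for z
    using real[OF that] by (simp add: complex_is_Real_iff)
  show "Im \<langle>T x, y\<rangle> = Im (cnj \<langle>T y, x\<rangle>)"
    using Im[of "x \<oplus>\<^bsub>X\<^esub> y"] Im[OF x] Im[OF y] x y by (simp add: sprod_linear)
  show "Re \<langle>T x, y\<rangle> = Re (cnj \<langle>T y, x\<rangle>)"
    using Im[of "x \<oplus>\<^bsub>X\<^esub> \<i> \<odot>\<^bsub>X\<^esub> y"] Im[OF x] Im[OF y] x y by (simp add: sprod_linear)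
qed

section \<open>Completion\<close>

context semi_inner_product_space
begin

section \<open>Separation: the quotient by the null vectors\<close>

lemma sprod_null_left:
  assumes "\<langle>x, x\<rangle> = 0" "x \<in> carrier X" "y \<in> carrier X"
  shows "\<langle>x, y\<rangle> = 0"
  using Cauchy_Schwarz[OF assms(2,3)] hnorm_eq_0_iff[OF assms(2)] assms(1) by simp

text \<open>By Cauchy-Schwarz a null vector is orthogonal to everything. Membership in a class thus
  becomes equality of all scalar products, and identities in the quotient are closed by linearity of
  the form.\<close>

lemma mem_null_class_iff:
  assumes "x \<in> carrier X" "y \<in> carrier X"
  shows "y \<in> null_class X x \<longleftrightarrow> (\<forall>z\<in>carrier X. \<langle>y, z\<rangle> = \<langle>x, z\<rangle>)"
proof
  assume "y \<in> null_class X x"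
  then have null: "\<langle>x \<ominus>\<^bsub>X\<^esub> y, x \<ominus>\<^bsub>X\<^esub> y\<rangle> = 0"
    by (simp add: null_class_def)
  show "\<forall>z\<in>carrier X. \<langle>y, z\<rangle> = \<langle>x, z\<rangle>"
  proof
    fix z assume "z \<in> carrier X"
    then show "\<langle>y, z\<rangle> = \<langle>x, z\<rangle>"
      using sprod_null_left[OF null, of z] assms by (simp add: sprod_minus_left)
  qed
next
  assume "\<forall>z\<in>carrier X. \<langle>y, z\<rangle> = \<langle>x, z\<rangle>"
  then show "y \<in> null_class X x"
    using assms by (simp add: null_class_def sprod_minus_left)
qed

lemma null_class_subset: "null_class X x \<subseteq> carrier X"
  by (auto simp: null_class_def)

lemma null_class_eq_iff:
  assumes "x \<in> carrier X" "y \<in> carrier X"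
  shows "null_class X x = null_class X y \<longleftrightarrow> (\<forall>z\<in>carrier X. \<langle>x, z\<rangle> = \<langle>y, z\<rangle>)"
proof
  assume "null_class X x = null_class X y"
  moreover have "x \<in> null_class X x"
    using assms by (simp add: mem_null_class_iff)
  ultimately show "\<forall>z\<in>carrier X. \<langle>x, z\<rangle> = \<langle>y, z\<rangle>"
    using assms mem_null_class_iff[of y x] by simp
next
  assume "\<forall>z\<in>carrier X. \<langle>x, z\<rangle> = \<langle>y, z\<rangle>"
  then have "v \<in> null_class X x \<longleftrightarrow> v \<in> null_class X y" if "v \<in> carrier X" for v
    using that assms by (simp add: mem_null_class_iff)
  then show "null_class X x = null_class X y"
    using null_class_subset by blast
qed

text \<open>The quotient operations are defined on chosen representatives. Scalar products do not
  see the choice, and through \<open>null_class_eq_iff\<close> this is well-definedness of the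
  operations.\<close>

lemma
  assumes x: "x \<in> carrier X"
  shows some_null_class_carrier: "(SOME y. y \<in> null_class X x) \<in> carrier X"
    and sprod_some_null_class_left:
      "z \<in> carrier X \<Longrightarrow> \<langle>SOME y. y \<in> null_class X x, z\<rangle> = \<langle>x, z\<rangle>"
    and sprod_some_null_class_right:
      "z \<in> carrier X \<Longrightarrow> \<langle>z, SOME y. y \<in> null_class X x\<rangle> = \<langle>z, x\<rangle>"
proof -
  let ?y = "SOME y. y \<in> null_class X x"
  have "x \<in> null_class X x"
    using x by (simp add: mem_null_class_iff)
  then have y: "?y \<in> null_class X x"
    by (rule someI)
  then show carrier: "?y \<in> carrier X"
    using null_class_subset by blast
  show left: "\<langle>?y, z\<rangle> = \<langle>x, z\<rangle>" if "z \<in> carrier X" for z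
    using y that by (simp add: mem_null_class_iff[OF x carrier])
  then show "\<langle>z, ?y\<rangle> = \<langle>z, x\<rangle>" if "z \<in> carrier X"
    unfolding sprod_commute[OF carrier that] sprod_commute[OF x that] using that by simp
qed

lemma null_quotient_carrier: "carrier (null_quotient X) = null_class X ` carrier X"
  by (simp add: null_quotient_def)

lemma null_class_carrier [simp, intro]: "x \<in> carrier X \<Longrightarrow> null_class X x \<in> carrier (null_quotient X)"
  by (simp add: null_quotient_carrier)

lemma null_class_zero: "null_class X \<zero>\<^bsub>X\<^esub> = \<zero>\<^bsub>null_quotient X\<^esub>"
  by (simp add: null_quotient_def)

lemma null_class_add:
  assumes "x \<in> carrier X" "y \<in> carrier X"
  shows "null_class X x \<oplus>\<^bsub>null_quotient X\<^esub> null_class X y = null_class X (x \<oplus>\<^bsub>X\<^esub> y)"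
  using assms
  by (simp add: null_quotient_def null_class_eq_iff some_null_class_carrier sprod_add_left
      sprod_some_null_class_left)

lemma null_class_smult:
  assumes "x \<in> carrier X"
  shows "a \<odot>\<^bsub>null_quotient X\<^esub> null_class X x = null_class X (a \<odot>\<^bsub>X\<^esub> x)"
  using assms
  by (simp add: null_quotient_def null_class_eq_iff some_null_class_carrier sprod_smult_left
      sprod_some_null_class_left)

lemma null_class_sprod:
  assumes "x \<in> carrier X" "y \<in> carrier X"
  shows "\<langle>null_class X x, null_class X y\<rangle>\<^bsub>null_quotient X\<^esub> = \<langle>x, y\<rangle>"
  using assms
  by (simp add: null_quotient_def some_null_class_carrier sprod_some_null_class_left
      sprod_some_null_class_right)

lemma null_quotient_semi_inner_product_space: "semi_inner_product_space (null_quotient X)"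
proof -
  note [simp] = null_quotient_carrier null_class_add null_class_smult null_class_sprod
  have zero: "\<zero>\<^bsub>null_quotient X\<^esub> = null_class X \<zero>\<^bsub>X\<^esub>"
    by (simp add: null_class_zero)
  show ?thesis
  proof (rule semi_inner_product_spaceI)
    fix P Q assume "P \<in> carrier (null_quotient X)" "Q \<in> carrier (null_quotient X)"
    then show "P \<oplus>\<^bsub>null_quotient X\<^esub> Q = Q \<oplus>\<^bsub>null_quotient X\<^esub> P"
      by (auto simp: M.a_comm)
    show "\<langle>Q, P\<rangle>\<^bsub>null_quotient X\<^esub> = cnj \<langle>P, Q\<rangle>\<^bsub>null_quotient X\<^esub>"
      using \<open>P \<in> _\<close> \<open>Q \<in> _\<close> by (auto intro: sprod_commute)
  qed (auto simp: zero M.a_assoc smult_distrib neg_add_eq_zero sprod_linear sprod_nonneg)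
qed

lemma null_quotient_definite:
  assumes "P \<in> carrier (null_quotient X)" "\<langle>P, P\<rangle>\<^bsub>null_quotient X\<^esub> = 0"
  shows "P = \<zero>\<^bsub>null_quotient X\<^esub>"
proof -
  obtain x where x: "x \<in> carrier X" "P = null_class X x"
    using assms(1) by (auto simp: null_quotient_carrier)
  then have "null_class X x = null_class X \<zero>\<^bsub>X\<^esub>"
    using assms(2) by (subst null_class_eq_iff) (auto simp: null_class_sprod sprod_null_left)
  then show ?thesis
    using x by (simp add: null_class_zero)
qed

section \<open>The space of Cauchy sequences\<close>

lemma hCauchy_sprod_convergent:
  assumes s: "range s \<subseteq> carrier X" "hCauchy X s" and t: "range t \<subseteq> carrier X" "hCauchy X t"
  shows "convergent (\<lambda>n. \<langle>s n, t n\<rangle>)"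
proof -
  have mem: "s n \<in> carrier X" "t n \<in> carrier X" for n
    using s t by auto
  have bounded: "\<exists>B>0. \<forall>n. hnorm X (r n) \<le> B" if r: "\<And>n. r n \<in> carrier X" and C: "hCauchy X r" for r
  proof -
    obtain N where N: "\<And>m n. \<lbrakk>m \<ge> N; n \<ge> N\<rbrakk> \<Longrightarrow> hdist X (r m) (r n) < 1"
      using C unfolding hCauchy_def by (meson zero_less_one)
    \<comment> \<open>The sum of the initial norms dominates each of them and stands in for a
      maximum; the summand 1 covers the tail, which stays within distance 1 of
      \<open>r N\<close>.\<close>
    define B where "B = (\<Sum>n\<le>N. hnorm X (r n)) + 1"
    have le: "hnorm X (r n) \<le> (\<Sum>n\<le>N. hnorm X (r n))" if "n \<le> N" for n
      using that r by (intro member_le_sum) auto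
    have "hnorm X (r n) \<le> B" for n
    proof (cases "n \<le> N")
      case True
      then show ?thesis using le[of n] by (simp add: B_def)
    next
      case False
      then show ?thesis
        using N[of n N] hnorm_diff_le_hdist[of "r n" "r N"] r le[of N] by (simp add: B_def abs_le_iff)
    qed
    moreover have "B > 0"
      unfolding B_def using r by (intro add_nonneg_pos sum_nonneg) auto
    ultimately show ?thesis by blast
  qed
  obtain B where B: "B > 0" "\<And>n. hnorm X (s n) \<le> B"
    using bounded[of s] mem s by blast
  obtain C where C: "C > 0" "\<And>n. hnorm X (t n) \<le> C"
    using bounded[of t] mem t by blast
  have diff: "cmod (\<langle>s m, t m\<rangle> - \<langle>s n, t n\<rangle>) \<le> hdist X (s m) (s n) * C + B * hdist X (t m) (t n)" for m n
  proof -
    have "\<langle>s m, t m\<rangle> - \<langle>s n, t n\<rangle> = \<langle>s m \<ominus>\<^bsub>X\<^esub> s n, t m\<rangle> + \<langle>s n, t m \<ominus>\<^bsub>X\<^esub> t n\<rangle>"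
      using mem by (simp add: sprod_linear)
    also have "cmod \<dots> \<le> cmod \<langle>s m \<ominus>\<^bsub>X\<^esub> s n, t m\<rangle> + cmod \<langle>s n, t m \<ominus>\<^bsub>X\<^esub> t n\<rangle>"
      by (rule norm_triangle_ineq)
    also have "\<dots> \<le> hdist X (s m) (s n) * hnorm X (t m) + hnorm X (s n) * hdist X (t m) (t n)"
      unfolding hdist_def using mem by (intro add_mono Cauchy_Schwarz) auto
    also have "\<dots> \<le> hdist X (s m) (s n) * C + B * hdist X (t m) (t n)"
      using mem B C by (intro add_mono mult_left_mono mult_right_mono) auto
    finally show ?thesis .
  qed
  have "Cauchy (\<lambda>n. \<langle>s n, t n\<rangle>)"
  proof (rule metric_CauchyI)
    fix e :: real assume "e > 0"
    then obtain M N where M: "\<And>m n. \<lbrakk>m \<ge> M; n \<ge> M\<rbrakk> \<Longrightarrow> hdist X (s m) (s n) < e / (2 * C)"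
      and N: "\<And>m n. \<lbrakk>m \<ge> N; n \<ge> N\<rbrakk> \<Longrightarrow> hdist X (t m) (t n) < e / (2 * B)"
      using s(2) t(2) B(1) C(1) unfolding hCauchy_def
      by (meson divide_pos_pos mult_pos_pos zero_less_numeral)
    have "dist \<langle>s m, t m\<rangle> \<langle>s n, t n\<rangle> < e" if "m \<ge> max M N" "n \<ge> max M N" for m n
    proof -
      have "hdist X (s m) (s n) * C < e / 2" "B * hdist X (t m) (t n) < e / 2"
        using M[of m n] N[of m n] that B(1) C(1) by (auto simp: field_simps)
      then show ?thesis
        using diff[of m n] by (simp add: dist_norm)
    qed
    then show "\<exists>M. \<forall>m\<ge>M. \<forall>n\<ge>M. dist \<langle>s m, t m\<rangle> \<langle>s n, t n\<rangle> < e"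
      by blast
  qed
  then show ?thesis
    by (simp add: Cauchy_convergent_iff)
qed

lemma hCauchy_add:
  assumes s: "range s \<subseteq> carrier X" "hCauchy X s" and t: "range t \<subseteq> carrier X" "hCauchy X t"
  shows "hCauchy X (\<lambda>n. s n \<oplus>\<^bsub>X\<^esub> t n)"
  unfolding hCauchy_def
proof (intro allI impI)
  fix e :: real assume "e > 0"
  then obtain M N where M: "\<And>m n. \<lbrakk>m \<ge> M; n \<ge> M\<rbrakk> \<Longrightarrow> hdist X (s m) (s n) < e / 2"
      and N: "\<And>m n. \<lbrakk>m \<ge> N; n \<ge> N\<rbrakk> \<Longrightarrow> hdist X (t m) (t n) < e / 2"
    using s(2) t(2) unfolding hCauchy_def by (meson half_gt_zero)
  have "hdist X (s m \<oplus>\<^bsub>X\<^esub> t m) (s n \<oplus>\<^bsub>X\<^esub> t n) < e" if "m \<ge> max M N" "n \<ge> max M N" for m n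
  proof -
    have "hdist X (s m \<oplus>\<^bsub>X\<^esub> t m) (s n \<oplus>\<^bsub>X\<^esub> t n) \<le> hdist X (s m) (s n) + hdist X (t m) (t n)"
      using s(1) t(1) by (intro hdist_add) auto
    then show ?thesis
      using M[of m n] N[of m n] that by simp
  qed
  then show "\<exists>M. \<forall>m\<ge>M. \<forall>n\<ge>M. hdist X (s m \<oplus>\<^bsub>X\<^esub> t m) (s n \<oplus>\<^bsub>X\<^esub> t n) < e"
    by blast
qed

lemma hCauchy_smult:
  assumes s: "range s \<subseteq> carrier X" "hCauchy X s"
  shows "hCauchy X (\<lambda>n. a \<odot>\<^bsub>X\<^esub> s n)"
  unfolding hCauchy_def
proof (intro allI impI)
  fix e :: real assume "e > 0"
  then have "e / (cmod a + 1) > 0"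
    by (simp add: add_nonneg_pos)
  then obtain N where N: "\<And>m n. \<lbrakk>m \<ge> N; n \<ge> N\<rbrakk> \<Longrightarrow> hdist X (s m) (s n) < e / (cmod a + 1)"
    using s(2) unfolding hCauchy_def by meson
  have "hdist X (a \<odot>\<^bsub>X\<^esub> s m) (a \<odot>\<^bsub>X\<^esub> s n) < e" if "m \<ge> N" "n \<ge> N" for m n
  proof -
    have mem: "s m \<in> carrier X" "s n \<in> carrier X" using s by auto
    have "cmod a * hdist X (s m) (s n) \<le> (cmod a + 1) * hdist X (s m) (s n)"
      using mem by (intro mult_right_mono) auto
    also have "\<dots> < e"
      using N[OF that] \<open>e / (cmod a + 1) > 0\<close> \<open>e > 0\<close>
      by (simp add: pos_less_divide_eq mult.commute zero_less_divide_iff)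
    finally show ?thesis
      using mem by (simp add: hdist_smult)
  qed
  then show "\<exists>N. \<forall>m\<ge>N. \<forall>n\<ge>N. hdist X (a \<odot>\<^bsub>X\<^esub> s m) (a \<odot>\<^bsub>X\<^esub> s n) < e"
    by blast
qed

lemma hCauchy_const: "x \<in> carrier X \<Longrightarrow> hCauchy X (\<lambda>_. x)"
  by (simp add: hCauchy_def)

lemma cauchy_space_carrier:
  "s \<in> carrier (cauchy_space X) \<longleftrightarrow> range s \<subseteq> carrier X \<and> hCauchy X s"
  by (simp add: cauchy_space_def)

lemma cauchy_space_sprod_tendsto:
  assumes "s \<in> carrier (cauchy_space X)" "t \<in> carrier (cauchy_space X)"
  shows "(\<lambda>n. \<langle>s n, t n\<rangle>) \<longlonglongrightarrow> \<langle>s, t\<rangle>\<^bsub>cauchy_space X\<^esub>"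
  using hCauchy_sprod_convergent[of s t] assms
  by (simp add: cauchy_space_def convergent_LIMSEQ_iff)

text \<open>The vector axioms hold termwise. The scalar product is a limit, so its axioms pass to
  the limit from those of X.\<close>

lemma cauchy_space_semi_inner_product_space: "semi_inner_product_space (cauchy_space X)"
proof (rule semi_inner_product_spaceI)
  let ?C = "cauchy_space X"
  have ops: "\<zero>\<^bsub>?C\<^esub> = (\<lambda>n. \<zero>\<^bsub>X\<^esub>)" "s \<oplus>\<^bsub>?C\<^esub> t = (\<lambda>n. s n \<oplus>\<^bsub>X\<^esub> t n)" "a \<odot>\<^bsub>?C\<^esub> s = (\<lambda>n. a \<odot>\<^bsub>X\<^esub> s n)" for s t a
    by (simp_all add: cauchy_space_def)
  have mem: "s n \<in> carrier X" if "s \<in> carrier ?C" for s n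
    using that by (auto simp: cauchy_space_carrier)
  note lim = cauchy_space_sprod_tendsto
  show "\<zero>\<^bsub>?C\<^esub> \<in> carrier ?C"
    by (auto simp: ops cauchy_space_carrier hCauchy_const)
  show add: "s \<oplus>\<^bsub>?C\<^esub> t \<in> carrier ?C" if "s \<in> carrier ?C" "t \<in> carrier ?C" for s t
    using that mem by (auto simp: ops cauchy_space_carrier intro: hCauchy_add)
  show smult: "a \<odot>\<^bsub>?C\<^esub> s \<in> carrier ?C" if "s \<in> carrier ?C" for a s
    using that mem by (auto simp: ops cauchy_space_carrier intro: hCauchy_smult)
  show "\<langle>s \<oplus>\<^bsub>?C\<^esub> t, r\<rangle>\<^bsub>?C\<^esub> = \<langle>s, r\<rangle>\<^bsub>?C\<^esub> + \<langle>t, r\<rangle>\<^bsub>?C\<^esub>"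
    if "s \<in> carrier ?C" "t \<in> carrier ?C" "r \<in> carrier ?C" for s t r
  proof (rule LIMSEQ_unique)
    show "(\<lambda>n. \<langle>s n, r n\<rangle> + \<langle>t n, r n\<rangle>) \<longlonglongrightarrow> \<langle>s \<oplus>\<^bsub>?C\<^esub> t, r\<rangle>\<^bsub>?C\<^esub>"
      using lim[OF add[OF that(1,2)] that(3)] that mem by (simp add: ops sprod_add_left)
    show "(\<lambda>n. \<langle>s n, r n\<rangle> + \<langle>t n, r n\<rangle>) \<longlonglongrightarrow> \<langle>s, r\<rangle>\<^bsub>?C\<^esub> + \<langle>t, r\<rangle>\<^bsub>?C\<^esub>"
      using that by (intro tendsto_intros lim)
  qed
  show "\<langle>a \<odot>\<^bsub>?C\<^esub> s, r\<rangle>\<^bsub>?C\<^esub> = a * \<langle>s, r\<rangle>\<^bsub>?C\<^esub>" if "s \<in> carrier ?C" "r \<in> carrier ?C" for a s r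
  proof (rule LIMSEQ_unique)
    show "(\<lambda>n. a * \<langle>s n, r n\<rangle>) \<longlonglongrightarrow> \<langle>a \<odot>\<^bsub>?C\<^esub> s, r\<rangle>\<^bsub>?C\<^esub>"
      using lim[OF smult[OF that(1)] that(2)] that mem by (simp add: ops sprod_smult_left)
    show "(\<lambda>n. a * \<langle>s n, r n\<rangle>) \<longlonglongrightarrow> a * \<langle>s, r\<rangle>\<^bsub>?C\<^esub>"
      using that by (intro tendsto_intros lim)
  qed
  show "\<langle>t, s\<rangle>\<^bsub>?C\<^esub> = cnj \<langle>s, t\<rangle>\<^bsub>?C\<^esub>" if "s \<in> carrier ?C" "t \<in> carrier ?C" for s t
  proof (rule LIMSEQ_unique)
    show "(\<lambda>n. \<langle>t n, s n\<rangle>) \<longlonglongrightarrow> \<langle>t, s\<rangle>\<^bsub>?C\<^esub>"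
      using that by (intro lim)
    have "\<langle>t n, s n\<rangle> = cnj \<langle>s n, t n\<rangle>" for n
      using that mem by (intro sprod_commute)
    then show "(\<lambda>n. \<langle>t n, s n\<rangle>) \<longlonglongrightarrow> cnj \<langle>s, t\<rangle>\<^bsub>?C\<^esub>"
      using that by (simp only:) (intro tendsto_intros lim)
  qed
  show "\<langle>s, s\<rangle>\<^bsub>?C\<^esub> \<in> \<real>\<^sub>\<ge>\<^sub>0" if "s \<in> carrier ?C" for s
    by (rule closed_sequentially[OF closed_nonneg_Reals_complex sprod_nonneg[OF mem[OF that]] lim[OF that that]])
  show "s \<oplus>\<^bsub>?C\<^esub> t = t \<oplus>\<^bsub>?C\<^esub> s" if "s \<in> carrier ?C" "t \<in> carrier ?C" for s t
    using that mem by (auto simp: ops M.a_comm)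
qed (auto simp: cauchy_space_def image_subset_iff M.a_assoc smult_distrib neg_add_eq_zero)

section \<open>The completion and its dense embedding\<close>

lemma completion_embed_carrier [simp, intro]: "x \<in> carrier X \<Longrightarrow> completion_embed X x \<in> carrier (completion X)"
  using semi_inner_product_space.null_class_carrier[OF cauchy_space_semi_inner_product_space, of "\<lambda>_. x"]
  by (auto simp: completion_def completion_embed_def cauchy_space_carrier hCauchy_const)

lemma const_cauchy_space: "x \<in> carrier X \<Longrightarrow> (\<lambda>_. x) \<in> carrier (cauchy_space X)"
  by (auto simp: cauchy_space_carrier hCauchy_const)

lemma completion_embed_add:
  assumes "x \<in> carrier X" "y \<in> carrier X"
  shows "completion_embed X (x \<oplus>\<^bsub>X\<^esub> y) = completion_embed X x \<oplus>\<^bsub>completion X\<^esub> completion_embed X y"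
  using semi_inner_product_space.null_class_add[OF cauchy_space_semi_inner_product_space
      const_cauchy_space[OF assms(1)] const_cauchy_space[OF assms(2)]]
  by (simp add: completion_def completion_embed_def cauchy_space_def)

lemma completion_embed_smult:
  assumes "x \<in> carrier X"
  shows "completion_embed X (a \<odot>\<^bsub>X\<^esub> x) = a \<odot>\<^bsub>completion X\<^esub> completion_embed X x"
  using semi_inner_product_space.null_class_smult[OF cauchy_space_semi_inner_product_space
      const_cauchy_space[OF assms(1)], of a]
  by (simp add: completion_def completion_embed_def cauchy_space_def)

lemma completion_embed_zero: "completion_embed X \<zero>\<^bsub>X\<^esub> = \<zero>\<^bsub>completion X\<^esub>"
  using semi_inner_product_space.null_class_zero[OF cauchy_space_semi_inner_product_space]
  by (simp add: completion_def completion_embed_def cauchy_space_def)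

lemma completion_embed_sprod:
  assumes "x \<in> carrier X" "y \<in> carrier X"
  shows "\<langle>completion_embed X x, completion_embed X y\<rangle>\<^bsub>completion X\<^esub> = \<langle>x, y\<rangle>"
  using semi_inner_product_space.null_class_sprod[OF cauchy_space_semi_inner_product_space
      const_cauchy_space[OF assms(1)] const_cauchy_space[OF assms(2)]]
  by (simp add: completion_def completion_embed_def cauchy_space_def)

lemma completion_semi_inner_product_space: "semi_inner_product_space (completion X)"
  unfolding completion_def
  using semi_inner_product_space.null_quotient_semi_inner_product_space[OF cauchy_space_semi_inner_product_space] .

text \<open>The squared distance between the constant sequence \<open>s k\<close> and s is the limit
  over n of the squared distances of \<open>s k\<close> and \<open>s n\<close>, which the Cauchy
  condition makes small for large k.\<close>

lemma completion_embed_hlim: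
  assumes s: "s \<in> carrier (cauchy_space X)"
  shows "hlim (completion X) (\<lambda>n. completion_embed X (s n)) (null_class (cauchy_space X) s)"
proof -
  interpret C: semi_inner_product_space "cauchy_space X"
    by (rule cauchy_space_semi_inner_product_space)
  interpret Q: semi_inner_product_space "completion X"
    by (rule completion_semi_inner_product_space)
  have mem: "s n \<in> carrier X" for n
    using s by (auto simp: cauchy_space_carrier)
  have const: "(\<lambda>_. s k) \<in> carrier (cauchy_space X)" for k
    by (rule const_cauchy_space[OF mem])
  have dist: "(\<lambda>n. (hdist X (s k) (s n))\<^sup>2)
      \<longlonglongrightarrow> (hdist (completion X) (completion_embed X (s k)) (null_class (cauchy_space X) s))\<^sup>2" for k
  proof -
    have "(\<lambda>n. Re \<langle>s k, s k\<rangle> - 2 * Re \<langle>s k, s n\<rangle> + Re \<langle>s n, s n\<rangle>)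
       \<longlonglongrightarrow> Re \<langle>\<lambda>_. s k, \<lambda>_. s k\<rangle>\<^bsub>cauchy_space X\<^esub> - 2 * Re \<langle>\<lambda>_. s k, s\<rangle>\<^bsub>cauchy_space X\<^esub> + Re \<langle>s, s\<rangle>\<^bsub>cauchy_space X\<^esub>"
      using cauchy_space_sprod_tendsto[OF const const] cauchy_space_sprod_tendsto[OF const s]
        cauchy_space_sprod_tendsto[OF s s]
      by (intro tendsto_intros)
    moreover have "null_class (cauchy_space X) t \<in> carrier (completion X)"
      if "t \<in> carrier (cauchy_space X)" for t
      using that by (simp add: completion_def)
    ultimately show ?thesis
      using mem s const
      by (simp add: hdist_power2 Q.hdist_power2 hnorm_power2 Q.hnorm_power2 completion_embed_def)
        (simp add: completion_def C.null_class_sprod)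
  qed
  show ?thesis
    unfolding hlim_def
  proof (rule LIMSEQ_I)
    fix e :: real assume "e > 0"
    then obtain N where N: "\<And>m n. \<lbrakk>m \<ge> N; n \<ge> N\<rbrakk> \<Longrightarrow> hdist X (s m) (s n) < e / 2"
      using s unfolding cauchy_space_carrier hCauchy_def by (meson half_gt_zero)
    have "norm (hdist (completion X) (completion_embed X (s k)) (null_class (cauchy_space X) s) - 0) < e"
      if "k \<ge> N" for k
    proof -
      let ?d = "hdist (completion X) (completion_embed X (s k)) (null_class (cauchy_space X) s)"
      have "(hdist X (s k) (s n))\<^sup>2 \<le> (e / 2)\<^sup>2" if "n \<ge> N" for n
        using N[OF \<open>k \<ge> N\<close> that] mem by (intro power_mono) auto
      then have "?d\<^sup>2 \<le> (e / 2)\<^sup>2"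
        by (intro LIMSEQ_le_const2[OF dist]) blast
      then have "\<bar>?d\<bar> \<le> e / 2"
        using \<open>e > 0\<close> by (simp add: abs_le_square_iff[symmetric])
      then show ?thesis
        using \<open>e > 0\<close> by simp
    qed
    then show "\<exists>N. \<forall>k\<ge>N. norm (hdist (completion X) (completion_embed X (s k)) (null_class (cauchy_space X) s) - 0) < e"
      by blast
  qed
qed

lemma completion_cases:
  assumes "P \<in> carrier (completion X)"
  obtains s where "s \<in> carrier (cauchy_space X)" "P = null_class (cauchy_space X) s"
  using assms semi_inner_product_space.null_quotient_carrier[OF cauchy_space_semi_inner_product_space]
  by (auto simp: completion_def)

text \<open>Completeness by a diagonal choice: the k-th class is replaced by an embedded vector
  \<open>x k\<close> within 1 / (k + 1). The embedding preserves distances, so the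
  \<open>x k\<close> form a Cauchy sequence in X, and its class is the limit.\<close>

lemma completion_hilbert_space: "hilbert_space (completion X)"
proof (intro hilbert_space.intro hilbert_space_axioms.intro completion_semi_inner_product_space)
  show "P = \<zero>\<^bsub>completion X\<^esub>" if "P \<in> carrier (completion X)" "\<langle>P, P\<rangle>\<^bsub>completion X\<^esub> = 0" for P
    using semi_inner_product_space.null_quotient_definite[OF cauchy_space_semi_inner_product_space] that
    by (simp add: completion_def)
next
  fix S assume S: "range S \<subseteq> carrier (completion X)" "hCauchy (completion X) S"
  interpret Q: semi_inner_product_space "completion X"
    by (rule completion_semi_inner_product_space)
  have mem: "S k \<in> carrier (completion X)" for k
    using S by auto
  have "\<exists>x\<in>carrier X. hdist (completion X) (completion_embed X x) (S k) < 1 / real (Suc k)" for k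
  proof -
    obtain s where s: "s \<in> carrier (cauchy_space X)" "S k = null_class (cauchy_space X) s"
      using completion_cases mem by blast
    have "\<forall>\<^sub>F n in sequentially. hdist (completion X) (completion_embed X (s n)) (S k) < 1 / real (Suc k)"
      using completion_embed_hlim[OF s(1)] unfolding hlim_def s(2) by (rule order_tendstoD) simp
    then obtain n where "hdist (completion X) (completion_embed X (s n)) (S k) < 1 / real (Suc k)"
      by (meson eventually_sequentially order_refl)
    moreover have "s n \<in> carrier X"
      using s by (auto simp: cauchy_space_carrier)
    ultimately show ?thesis by blast
  qed
  then obtain x where x: "\<And>k. x k \<in> carrier X"
    and near: "\<And>k. hdist (completion X) (completion_embed X (x k)) (S k) < 1 / real (Suc k)"
    by metis
  have embed_dist: "hdist X (x m) (x n) = hdist (completion X) (completion_embed X (x m)) (completion_embed X (x n))" for m n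
  proof -
    have "(hdist X (x m) (x n))\<^sup>2 = (hdist (completion X) (completion_embed X (x m)) (completion_embed X (x n)))\<^sup>2"
      using x by (simp add: hdist_power2 Q.hdist_power2 hnorm_power2 Q.hnorm_power2 completion_embed_sprod)
    then show ?thesis
      using x by (simp add: power2_eq_iff_nonneg)
  qed
  have small: "\<exists>N. \<forall>k\<ge>N. 1 / real (Suc k) < e" if "e > 0" for e :: real
    using LIMSEQ_D[OF LIMSEQ_inverse_real_of_nat that] by (simp add: inverse_eq_divide)
  have "hCauchy X x"
    unfolding hCauchy_def
  proof (intro allI impI)
    fix e :: real assume "e > 0"
    then obtain M where M: "\<And>k. k \<ge> M \<Longrightarrow> 1 / real (Suc k) < e / 3"
      using small[of "e / 3"] by auto
    obtain N where N: "\<And>m n. \<lbrakk>m \<ge> N; n \<ge> N\<rbrakk> \<Longrightarrow> hdist (completion X) (S m) (S n) < e / 3"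
      using S(2) \<open>e > 0\<close> unfolding hCauchy_def by (meson divide_pos_pos zero_less_numeral)
    have "hdist X (x m) (x n) < e" if "m \<ge> max M N" "n \<ge> max M N" for m n
    proof -
      let ?e = "\<lambda>k. completion_embed X (x k)"
      have "hdist (completion X) (?e m) (?e n) \<le> hdist (completion X) (?e m) (S m) + hdist (completion X) (S m) (?e n)"
        using x mem by (intro Q.hdist_triangle) auto
      also have "hdist (completion X) (S m) (?e n) \<le> hdist (completion X) (S m) (S n) + hdist (completion X) (S n) (?e n)"
        using x mem by (intro Q.hdist_triangle) auto
      also have "hdist (completion X) (S n) (?e n) = hdist (completion X) (?e n) (S n)"
        using x mem by (intro Q.hdist_commute) auto
      finally show ?thesis
        using near[of m] near[of n] M[of m] M[of n] N[of m n] that by (simp add: embed_dist)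
    qed
    then show "\<exists>N. \<forall>m\<ge>N. \<forall>n\<ge>N. hdist X (x m) (x n) < e"
      by blast
  qed
  then have xC: "x \<in> carrier (cauchy_space X)"
    using x by (auto simp: cauchy_space_carrier)
  let ?P = "null_class (cauchy_space X) x"
  have P: "?P \<in> carrier (completion X)"
    using semi_inner_product_space.null_class_carrier[OF cauchy_space_semi_inner_product_space xC]
    by (simp add: completion_def)
  have le: "hdist (completion X) (S k) ?P \<le> 1 / real (Suc k) + hdist (completion X) (completion_embed X (x k)) ?P" for k
    using Q.hdist_triangle[of "S k" "completion_embed X (x k)" ?P] near[of k]
      Q.hdist_commute[of "S k" "completion_embed X (x k)"] x mem P by fastforce
  have "(\<lambda>k. 1 / real (Suc k) + hdist (completion X) (completion_embed X (x k)) ?P) \<longlonglongrightarrow> 0 + 0"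
    using completion_embed_hlim[OF xC] LIMSEQ_inverse_real_of_nat
    unfolding hlim_def inverse_eq_divide by (intro tendsto_add)
  then have lim: "(\<lambda>k. 1 / real (Suc k) + hdist (completion X) (completion_embed X (x k)) ?P) \<longlonglongrightarrow> 0"
    by simp
  have nonneg: "0 \<le> hdist (completion X) (S k) ?P" for k
    using mem P by simp
  have "hlim (completion X) S ?P"
    unfolding hlim_def
    by (rule tendsto_sandwich[OF always_eventually[rule_format] always_eventually[rule_format]
          tendsto_const lim, OF nonneg le])
  with P show "\<exists>P\<in>carrier (completion X). hlim (completion X) S P"
    by blast
qed

text \<open>Density of the embedded vectors, phrased through orthogonality as totality arguments
  require. Since z is a limit of embedded vectors, its scalar product with itself vanishes.\<close>

lemma completion_total:
  assumes z: "z \<in> carrier (completion X)"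
    and orth: "\<And>x. x \<in> carrier X \<Longrightarrow> \<langle>completion_embed X x, z\<rangle>\<^bsub>completion X\<^esub> = 0"
  shows "z = \<zero>\<^bsub>completion X\<^esub>"
proof -
  interpret Q: hilbert_space "completion X"
    by (rule completion_hilbert_space)
  obtain s where s: "s \<in> carrier (cauchy_space X)" "z = null_class (cauchy_space X) s"
    using completion_cases[OF z] .
  have mem: "s n \<in> carrier X" for n
    using s by (auto simp: cauchy_space_carrier)
  have "(\<lambda>n. \<langle>completion_embed X (s n), z\<rangle>\<^bsub>completion X\<^esub>) \<longlonglongrightarrow> \<langle>z, z\<rangle>\<^bsub>completion X\<^esub>"
    using completion_embed_hlim[OF s(1)] mem z s(2) by (intro Q.hlim_sprod_left) auto
  then have "\<langle>z, z\<rangle>\<^bsub>completion X\<^esub> = 0"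
    using orth[OF mem] LIMSEQ_unique[OF _ tendsto_const] by simp
  then show ?thesis
    using z by (rule Q.sprod_definite[rotated])
qed

end

section \<open>Naimark dilation\<close>

text \<open>The pre-Hilbert space of the Kolmogorov decomposition of an operator-valued positive
  kernel: a function stands for the formal sum of its values placed at the points of its support.
  Functions live on the whole index type and are zero outside T, which keeps the operations
  pointwise.\<close>

definition kernel_space :: "'a ipspace \<Rightarrow> 'i set \<Rightarrow> ('i \<Rightarrow> 'i \<Rightarrow> 'a \<Rightarrow> 'a) \<Rightarrow> ('i \<Rightarrow> 'a) ipspace" where
  "kernel_space X T k =
     \<lparr>carrier = {f. range f \<subseteq> carrier X \<and> finite {t. f t \<noteq> \<zero>\<^bsub>X\<^esub>} \<and> {t. f t \<noteq> \<zero>\<^bsub>X\<^esub>} \<subseteq> T},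
      monoid.mult = undefined, one = undefined,
      zero = (\<lambda>t. \<zero>\<^bsub>X\<^esub>),
      add = (\<lambda>f g t. f t \<oplus>\<^bsub>X\<^esub> g t),
      smult = (\<lambda>a f t. a \<odot>\<^bsub>X\<^esub> f t),
      sprod = (\<lambda>f g. \<Sum>s\<in>{s. f s \<noteq> \<zero>\<^bsub>X\<^esub>}. \<Sum>t\<in>{t. g t \<noteq> \<zero>\<^bsub>X\<^esub>}. \<langle>k s t (f s), g t\<rangle>\<^bsub>X\<^esub>)\<rparr>"

locale positive_kernel = X: semi_inner_product_space X for X :: "'a ipspace" +
  fixes T :: "'i set" and k :: "'i \<Rightarrow> 'i \<Rightarrow> 'a \<Rightarrow> 'a"
  assumes kernel_bounded: "\<lbrakk>s \<in> T; t \<in> T\<rbrakk> \<Longrightarrow> k s t \<in> bounded_ops X X"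
    and kernel_hermitian:
      "\<lbrakk>s \<in> T; t \<in> T; x \<in> carrier X; y \<in> carrier X\<rbrakk> \<Longrightarrow> \<langle>k s t x, y\<rangle>\<^bsub>X\<^esub> = cnj \<langle>k t s y, x\<rangle>\<^bsub>X\<^esub>"
    and kernel_positive:
      "\<lbrakk>finite A; A \<subseteq> T; \<And>t. t \<in> A \<Longrightarrow> f t \<in> carrier X\<rbrakk>
        \<Longrightarrow> (\<Sum>s\<in>A. \<Sum>t\<in>A. \<langle>k s t (f s), f t\<rangle>\<^bsub>X\<^esub>) \<in> \<real>\<^sub>\<ge>\<^sub>0"
begin

abbreviation "K \<equiv> kernel_space X T k"

definition single :: "'i \<Rightarrow> 'a \<Rightarrow> 'i \<Rightarrow> 'a" where
  "single s x = (\<lambda>t. if t = s then x else \<zero>\<^bsub>X\<^esub>)"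

lemma kernel_space_ops:
  "\<zero>\<^bsub>K\<^esub> = (\<lambda>t. \<zero>\<^bsub>X\<^esub>)" "f \<oplus>\<^bsub>K\<^esub> g = (\<lambda>t. f t \<oplus>\<^bsub>X\<^esub> g t)" "a \<odot>\<^bsub>K\<^esub> f = (\<lambda>t. a \<odot>\<^bsub>X\<^esub> f t)"
  by (simp_all add: kernel_space_def)

lemma kernel_space_carrier:
  "f \<in> carrier K \<longleftrightarrow> range f \<subseteq> carrier X \<and> finite {t. f t \<noteq> \<zero>\<^bsub>X\<^esub>} \<and> {t. f t \<noteq> \<zero>\<^bsub>X\<^esub>} \<subseteq> T"
  by (simp add: kernel_space_def)

text \<open>The defining sums run over exact supports, which may shrink under addition. Any finite
  supersets inside T may be used instead, so that f, g and their sum can share one index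
  set.\<close>

lemma kernel_space_sprod:
  assumes f: "f \<in> carrier K" and g: "g \<in> carrier K"
    and A: "finite A" "A \<subseteq> T" "{t. f t \<noteq> \<zero>\<^bsub>X\<^esub>} \<subseteq> A" and B: "finite B" "B \<subseteq> T" "{t. g t \<noteq> \<zero>\<^bsub>X\<^esub>} \<subseteq> B"
  shows "\<langle>f, g\<rangle>\<^bsub>K\<^esub> = (\<Sum>s\<in>A. \<Sum>t\<in>B. \<langle>k s t (f s), g t\<rangle>\<^bsub>X\<^esub>)"
proof -
  have mem: "f t \<in> carrier X" "g t \<in> carrier X" for t
    using f g by (auto simp: kernel_space_carrier)
  have zero: "k s t \<zero>\<^bsub>X\<^esub> = \<zero>\<^bsub>X\<^esub>" if "s \<in> A" "t \<in> B" for s t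
    using that A B by (intro bounded_ops_zero kernel_bounded X.semi_inner_product_space_axioms) auto
  have carr: "k s t x \<in> carrier X" if "s \<in> A" "t \<in> B" "x \<in> carrier X" for s t x
    using that A B by (intro bounded_opsD(1)[OF kernel_bounded]) auto
  have "\<langle>f, g\<rangle>\<^bsub>K\<^esub> = (\<Sum>s\<in>{t. f t \<noteq> \<zero>\<^bsub>X\<^esub>}. \<Sum>t\<in>{t. g t \<noteq> \<zero>\<^bsub>X\<^esub>}. \<langle>k s t (f s), g t\<rangle>\<^bsub>X\<^esub>)"
    by (simp add: kernel_space_def)
  also have "\<dots> = (\<Sum>s\<in>{t. f t \<noteq> \<zero>\<^bsub>X\<^esub>}. \<Sum>t\<in>B. \<langle>k s t (f s), g t\<rangle>\<^bsub>X\<^esub>)"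
    using A B mem carr by (intro sum.cong refl sum.mono_neutral_left) auto
  also have "\<dots> = (\<Sum>s\<in>A. \<Sum>t\<in>B. \<langle>k s t (f s), g t\<rangle>\<^bsub>X\<^esub>)"
    using A B mem zero by (intro sum.mono_neutral_left) (auto intro!: sum.neutral)
  finally show ?thesis .
qed

lemma kernel_space_semi_inner_product_space: "semi_inner_product_space K"
proof (rule semi_inner_product_spaceI)
  have mem: "f t \<in> carrier X" if "f \<in> carrier K" for f t
    using that by (auto simp: kernel_space_carrier)
  have supp: "finite {t. f t \<noteq> \<zero>\<^bsub>X\<^esub>}" "{t. f t \<noteq> \<zero>\<^bsub>X\<^esub>} \<subseteq> T" if "f \<in> carrier K" for f
    using that by (auto simp: kernel_space_carrier)
  show "\<zero>\<^bsub>K\<^esub> \<in> carrier K"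
    by (auto simp: kernel_space_carrier kernel_space_ops)
  show add: "f \<oplus>\<^bsub>K\<^esub> g \<in> carrier K" if "f \<in> carrier K" "g \<in> carrier K" for f g
  proof -
    have sub: "{t. f t \<oplus>\<^bsub>X\<^esub> g t \<noteq> \<zero>\<^bsub>X\<^esub>} \<subseteq> {t. f t \<noteq> \<zero>\<^bsub>X\<^esub>} \<union> {t. g t \<noteq> \<zero>\<^bsub>X\<^esub>}"
      by auto
    have "finite {t. f t \<oplus>\<^bsub>X\<^esub> g t \<noteq> \<zero>\<^bsub>X\<^esub>}"
      by (rule finite_subset[OF sub]) (simp add: supp that)
    moreover have "{t. f t \<oplus>\<^bsub>X\<^esub> g t \<noteq> \<zero>\<^bsub>X\<^esub>} \<subseteq> T"
      by (rule subset_trans[OF sub]) (simp add: supp that)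
    ultimately show ?thesis
      using that mem by (auto simp: kernel_space_carrier kernel_space_ops)
  qed
  show smult: "a \<odot>\<^bsub>K\<^esub> f \<in> carrier K" if "f \<in> carrier K" for a f
  proof -
    have sub: "{t. a \<odot>\<^bsub>X\<^esub> f t \<noteq> \<zero>\<^bsub>X\<^esub>} \<subseteq> {t. f t \<noteq> \<zero>\<^bsub>X\<^esub>}"
      by auto
    have "finite {t. a \<odot>\<^bsub>X\<^esub> f t \<noteq> \<zero>\<^bsub>X\<^esub>}"
      by (rule finite_subset[OF sub]) (simp add: supp that)
    moreover have "{t. a \<odot>\<^bsub>X\<^esub> f t \<noteq> \<zero>\<^bsub>X\<^esub>} \<subseteq> T"
      by (rule subset_trans[OF sub]) (simp add: supp that)
    ultimately show ?thesis
      using that mem by (auto simp: kernel_space_carrier kernel_space_ops)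
  qed
  show "\<langle>f \<oplus>\<^bsub>K\<^esub> g, h\<rangle>\<^bsub>K\<^esub> = \<langle>f, h\<rangle>\<^bsub>K\<^esub> + \<langle>g, h\<rangle>\<^bsub>K\<^esub>"
    if f: "f \<in> carrier K" and g: "g \<in> carrier K" and h: "h \<in> carrier K" for f g h
  proof -
    let ?A = "{t. f t \<noteq> \<zero>\<^bsub>X\<^esub>} \<union> {t. g t \<noteq> \<zero>\<^bsub>X\<^esub>}" and ?B = "{t. h t \<noteq> \<zero>\<^bsub>X\<^esub>}"
    have fin: "finite ?A" "?A \<subseteq> T" "finite ?B" "?B \<subseteq> T"
      using supp[OF f] supp[OF g] supp[OF h] by auto
    have *: "\<langle>u, h\<rangle>\<^bsub>K\<^esub> = (\<Sum>s\<in>?A. \<Sum>t\<in>?B. \<langle>k s t (u s), h t\<rangle>\<^bsub>X\<^esub>)"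
      if "u \<in> carrier K" "{t. u t \<noteq> \<zero>\<^bsub>X\<^esub>} \<subseteq> ?A" for u
      using fin h that by (intro kernel_space_sprod) auto
    have "\<langle>k s t ((f \<oplus>\<^bsub>K\<^esub> g) s), h t\<rangle>\<^bsub>X\<^esub> = \<langle>k s t (f s), h t\<rangle>\<^bsub>X\<^esub> + \<langle>k s t (g s), h t\<rangle>\<^bsub>X\<^esub>"
      if "s \<in> ?A" "t \<in> ?B" for s t
    proof -
      have st: "s \<in> T" "t \<in> T" using that fin by auto
      show ?thesis
        using mem[OF f] mem[OF g] mem[OF h] bounded_opsD[OF kernel_bounded[OF st]]
        by (simp add: kernel_space_ops X.sprod_add_left)
    qed
    then have "(\<Sum>s\<in>?A. \<Sum>t\<in>?B. \<langle>k s t ((f \<oplus>\<^bsub>K\<^esub> g) s), h t\<rangle>\<^bsub>X\<^esub>) =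
        (\<Sum>s\<in>?A. \<Sum>t\<in>?B. \<langle>k s t (f s), h t\<rangle>\<^bsub>X\<^esub>) + (\<Sum>s\<in>?A. \<Sum>t\<in>?B. \<langle>k s t (g s), h t\<rangle>\<^bsub>X\<^esub>)"
      by (simp add: sum.distrib)
    moreover have "{t. (f \<oplus>\<^bsub>K\<^esub> g) t \<noteq> \<zero>\<^bsub>X\<^esub>} \<subseteq> ?A"
      by (auto simp: kernel_space_ops)
    ultimately show ?thesis
      using *[OF add[OF f g]] *[OF f] *[OF g] by simp
  qed
  show "\<langle>a \<odot>\<^bsub>K\<^esub> f, h\<rangle>\<^bsub>K\<^esub> = a * \<langle>f, h\<rangle>\<^bsub>K\<^esub>" if f: "f \<in> carrier K" and h: "h \<in> carrier K" for a f h
  proof -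
    let ?A = "{t. f t \<noteq> \<zero>\<^bsub>X\<^esub>}" and ?B = "{t. h t \<noteq> \<zero>\<^bsub>X\<^esub>}"
    have *: "\<langle>u, h\<rangle>\<^bsub>K\<^esub> = (\<Sum>s\<in>?A. \<Sum>t\<in>?B. \<langle>k s t (u s), h t\<rangle>\<^bsub>X\<^esub>)"
      if "u \<in> carrier K" "{t. u t \<noteq> \<zero>\<^bsub>X\<^esub>} \<subseteq> ?A" for u
      using supp[OF f] supp[OF h] h that by (intro kernel_space_sprod) auto
    have "\<langle>k s t ((a \<odot>\<^bsub>K\<^esub> f) s), h t\<rangle>\<^bsub>X\<^esub> = a * \<langle>k s t (f s), h t\<rangle>\<^bsub>X\<^esub>" if "s \<in> ?A" "t \<in> ?B" for s t
    proof -
      have st: "s \<in> T" "t \<in> T" using that supp[OF f] supp[OF h] by auto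
      show ?thesis
        using mem[OF f] mem[OF h] bounded_opsD[OF kernel_bounded[OF st]]
        by (simp add: kernel_space_ops X.sprod_smult_left)
    qed
    then have "(\<Sum>s\<in>?A. \<Sum>t\<in>?B. \<langle>k s t ((a \<odot>\<^bsub>K\<^esub> f) s), h t\<rangle>\<^bsub>X\<^esub>) =
        a * (\<Sum>s\<in>?A. \<Sum>t\<in>?B. \<langle>k s t (f s), h t\<rangle>\<^bsub>X\<^esub>)"
      by (simp add: sum_distrib_left)
    moreover have "{t. (a \<odot>\<^bsub>K\<^esub> f) t \<noteq> \<zero>\<^bsub>X\<^esub>} \<subseteq> ?A"
      by (auto simp: kernel_space_ops)
    ultimately show ?thesis
      using *[OF smult[OF f, of a]] *[OF f] by simp
  qed
  show "\<langle>g, f\<rangle>\<^bsub>K\<^esub> = cnj \<langle>f, g\<rangle>\<^bsub>K\<^esub>" if f: "f \<in> carrier K" and g: "g \<in> carrier K" for f g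
  proof -
    let ?A = "{t. f t \<noteq> \<zero>\<^bsub>X\<^esub>}" and ?B = "{t. g t \<noteq> \<zero>\<^bsub>X\<^esub>}"
    have "\<langle>k s t (f s), g t\<rangle>\<^bsub>X\<^esub> = cnj \<langle>k t s (g t), f s\<rangle>\<^bsub>X\<^esub>" if "s \<in> ?A" "t \<in> ?B" for s t
      using that supp[OF f] supp[OF g] mem[OF f] mem[OF g] by (intro kernel_hermitian) auto
    then have "(\<Sum>s\<in>?A. \<Sum>t\<in>?B. \<langle>k s t (f s), g t\<rangle>\<^bsub>X\<^esub>) = (\<Sum>s\<in>?A. \<Sum>t\<in>?B. cnj \<langle>k t s (g t), f s\<rangle>\<^bsub>X\<^esub>)"
      by (intro sum.cong) auto
    then show ?thesis
      by (subst (asm) sum.swap) (simp add: kernel_space_def)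
  qed
  show "\<langle>f, f\<rangle>\<^bsub>K\<^esub> \<in> \<real>\<^sub>\<ge>\<^sub>0" if f: "f \<in> carrier K" for f
  proof -
    have "(\<Sum>s\<in>{t. f t \<noteq> \<zero>\<^bsub>X\<^esub>}. \<Sum>t\<in>{t. f t \<noteq> \<zero>\<^bsub>X\<^esub>}. \<langle>k s t (f s), f t\<rangle>\<^bsub>X\<^esub>) \<in> \<real>\<^sub>\<ge>\<^sub>0"
      using supp[OF f] mem[OF f] by (intro kernel_positive) auto
    then show ?thesis
      by (simp add: kernel_space_def)
  qed
  show "f \<oplus>\<^bsub>K\<^esub> g = g \<oplus>\<^bsub>K\<^esub> f" if "f \<in> carrier K" "g \<in> carrier K" for f g
    using mem[OF that(1)] mem[OF that(2)] by (auto simp: kernel_space_ops X.M.a_comm)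
qed (auto simp: kernel_space_def image_subset_iff X.M.a_assoc X.smult_distrib X.neg_add_eq_zero)

lemma single_carrier: "\<lbrakk>s \<in> T; x \<in> carrier X\<rbrakk> \<Longrightarrow> single s x \<in> carrier K"
proof -
  assume "s \<in> T" "x \<in> carrier X"
  moreover have "{t. single s x t \<noteq> \<zero>\<^bsub>X\<^esub>} \<subseteq> {s}"
    by (auto simp: single_def)
  moreover from this have "finite {t. single s x t \<noteq> \<zero>\<^bsub>X\<^esub>}"
    by (rule finite_subset) simp
  ultimately show ?thesis
    by (auto simp: kernel_space_carrier) (auto simp: single_def)
qed

lemma sprod_single:
  assumes "s \<in> T" "t \<in> T" "x \<in> carrier X" "y \<in> carrier X"
  shows "\<langle>single s x, single t y\<rangle>\<^bsub>K\<^esub> = \<langle>k s t x, y\<rangle>\<^bsub>X\<^esub>"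
proof -
  have "\<langle>single s x, single t y\<rangle>\<^bsub>K\<^esub> = (\<Sum>s'\<in>{s}. \<Sum>t'\<in>{t}. \<langle>k s' t' (single s x s'), single t y t'\<rangle>\<^bsub>X\<^esub>)"
    using assms by (intro kernel_space_sprod single_carrier) (auto simp: single_def)
  then show ?thesis
    by (simp add: single_def)
qed

text \<open>Induction over a finite set that contains the support, one point at a time. Clearing the
  value at a point does not shrink the support if the value there was zero already, hence the
  superset.\<close>

lemma single_induct:
  assumes f: "f \<in> carrier K" and zero: "P \<zero>\<^bsub>K\<^esub>"
    and step: "\<And>f s x. \<lbrakk>f \<in> carrier K; s \<in> T; x \<in> carrier X; P f\<rbrakk> \<Longrightarrow> P (f \<oplus>\<^bsub>K\<^esub> single s x)"
  shows "P f"
proof -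
  have "P f" if "finite A" "A \<subseteq> T" "f \<in> carrier K" "{t. f t \<noteq> \<zero>\<^bsub>X\<^esub>} \<subseteq> A" for A f
    using that
  proof (induction A arbitrary: f)
    case empty
    then have "f = \<zero>\<^bsub>K\<^esub>"
      by (auto simp: kernel_space_ops)
    then show ?case using zero by simp
  next
    case (insert s A)
    let ?g = "f(s := \<zero>\<^bsub>X\<^esub>)"
    have mem: "f t \<in> carrier X" for t
      using insert.prems by (auto simp: kernel_space_carrier)
    have "{t. ?g t \<noteq> \<zero>\<^bsub>X\<^esub>} \<subseteq> A"
      using insert.prems by auto
    moreover from this have "finite {t. ?g t \<noteq> \<zero>\<^bsub>X\<^esub>}"
      using insert.hyps(1) by (rule finite_subset)
    ultimately have g: "?g \<in> carrier K" "{t. ?g t \<noteq> \<zero>\<^bsub>X\<^esub>} \<subseteq> A"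
      using insert.prems mem by (auto simp: kernel_space_carrier)
    have "P ?g"
      using insert.prems g by (intro insert.IH) blast+
    then have "P (?g \<oplus>\<^bsub>K\<^esub> single s (f s))"
      using insert.prems(1) mem g(1) by (intro step) blast+
    moreover have "?g \<oplus>\<^bsub>K\<^esub> single s (f s) = f"
      using mem by (auto simp: kernel_space_ops single_def)
    ultimately show ?case by simp
  qed
  then show ?thesis
    using f by (auto simp: kernel_space_carrier)
qed

text \<open>One-point functions generate all finitely supported ones by addition, and the embedded
  functions are dense.\<close>

lemma kernel_dilation_total:
  "perp (completion K) {completion_embed K (single s x) | s x. s \<in> T \<and> x \<in> carrier X} \<subseteq> {\<zero>\<^bsub>completion K\<^esub>}"
proof
  interpret K: semi_inner_product_space K
    by (rule kernel_space_semi_inner_product_space)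
  interpret C: hilbert_space "completion K"
    by (rule K.completion_hilbert_space)
  fix z assume z: "z \<in> perp (completion K) {completion_embed K (single s x) | s x. s \<in> T \<and> x \<in> carrier X}"
  then have carr: "z \<in> carrier (completion K)"
    and orth: "\<And>s x. \<lbrakk>s \<in> T; x \<in> carrier X\<rbrakk> \<Longrightarrow> \<langle>completion_embed K (single s x), z\<rangle>\<^bsub>completion K\<^esub> = 0"
    by (auto simp: perp_def)
  have "\<langle>completion_embed K f, z\<rangle>\<^bsub>completion K\<^esub> = 0" if "f \<in> carrier K" for f
    using that
  proof (rule single_induct)
    show "\<langle>completion_embed K \<zero>\<^bsub>K\<^esub>, z\<rangle>\<^bsub>completion K\<^esub> = 0"
      using carr by (simp add: K.completion_embed_zero)
  next
    fix f s x
    assume "f \<in> carrier K" "s \<in> T" "x \<in> carrier X" "\<langle>completion_embed K f, z\<rangle>\<^bsub>completion K\<^esub> = 0"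
    then show "\<langle>completion_embed K (f \<oplus>\<^bsub>K\<^esub> single s x), z\<rangle>\<^bsub>completion K\<^esub> = 0"
      using carr orth single_carrier by (simp add: K.completion_embed_add C.sprod_add_left K.completion_embed_carrier)
  qed
  then show "z \<in> {\<zero>\<^bsub>completion K\<^esub>}"
    using K.completion_total[OF carr] by simp
qed

end

text \<open>Let b be a new least point. Then \<open>F (min s t) - F a\<close> splits into
  \<open>F (min s t) - F b\<close> and \<open>F b - F a\<close>. The first part vanishes as soon as
  s or t equals b, and what remains is the induction hypothesis on A; the second part sums to the
  quadratic form of the increment at the sum of all \<open>f t\<close>. The base level a is
  arbitrary because it rises to b in the induction hypothesis.\<close>

lemma resolution_kernel_positive:
  assumes X: "hilbert_space X"
    and F: "\<And>t. t \<in> {0..2 * pi} \<Longrightarrow> F t \<in> bounded_ops X X"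
    and mono: "\<And>s t x. \<lbrakk>s \<in> {0..2 * pi}; t \<in> {0..2 * pi}; s \<le> t; x \<in> carrier X\<rbrakk>
      \<Longrightarrow> \<langle>F t x \<ominus>\<^bsub>X\<^esub> F s x, x\<rangle>\<^bsub>X\<^esub> \<in> \<real>\<^sub>\<ge>\<^sub>0"
    and A: "finite A" "A \<subseteq> {0..2 * pi}" and f: "\<And>t. t \<in> A \<Longrightarrow> f t \<in> carrier X"
    and a: "a \<in> {0..2 * pi}" "\<And>t. t \<in> A \<Longrightarrow> a \<le> t"
  shows "(\<Sum>s\<in>A. \<Sum>t\<in>A. \<langle>F (min s t) (f s), f t\<rangle>\<^bsub>X\<^esub> - \<langle>F a (f s), f t\<rangle>\<^bsub>X\<^esub>) \<in> \<real>\<^sub>\<ge>\<^sub>0"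
  using A f a
proof (induction arbitrary: a rule: finite_linorder_min_induct)
  case empty
  then show ?case by simp
next
  case (insert b A)
  interpret X: hilbert_space X by fact
  let ?D = "\<lambda>a s t. \<langle>F (min s t) (f s), f t\<rangle>\<^bsub>X\<^esub> - \<langle>F a (f s), f t\<rangle>\<^bsub>X\<^esub>"
  have b: "b \<in> {0..2 * pi}" "a \<le> b" and b_le: "\<And>t. t \<in> A \<Longrightarrow> b < t"
    using insert by auto
  have IH: "(\<Sum>s\<in>A. \<Sum>t\<in>A. ?D b s t) \<in> \<real>\<^sub>\<ge>\<^sub>0"
    using insert by (intro insert.IH) (auto simp: less_imp_le)
  define \<Sigma> where "\<Sigma> = (\<Oplus>\<^bsub>X\<^esub>t\<in>insert b A. f t)"
  have fin: "finite (insert b A)" using insert by simp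
  have f: "\<And>t. t \<in> insert b A \<Longrightarrow> f t \<in> carrier X"
    using insert by auto
  have \<Sigma>: "\<Sigma> \<in> carrier X"
    unfolding \<Sigma>_def using f by (intro X.M.finsum_closed) auto
  have form: "\<langle>F t \<Sigma>, \<Sigma>\<rangle>\<^bsub>X\<^esub> = (\<Sum>s\<in>insert b A. \<Sum>r\<in>insert b A. \<langle>F t (f s), f r\<rangle>\<^bsub>X\<^esub>)"
    if t: "t \<in> {0..2 * pi}" for t
  proof -
    have "\<langle>F t \<Sigma>, \<Sigma>\<rangle>\<^bsub>X\<^esub> = (\<Sum>s\<in>insert b A. \<langle>F t (f s), \<Sigma>\<rangle>\<^bsub>X\<^esub>)"
      unfolding \<Sigma>_def[of] using \<Sigma> f fin
      by (subst (1) sprod_bounded_op_finsum[OF X.semi_inner_product_space_axioms X.semi_inner_product_space_axioms F[OF t]])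
        (auto simp: \<Sigma>_def)
    also have "\<dots> = (\<Sum>s\<in>insert b A. \<Sum>r\<in>insert b A. \<langle>F t (f s), f r\<rangle>\<^bsub>X\<^esub>)"
      unfolding \<Sigma>_def using f fin bounded_opsD(1)[OF F[OF t]]
      by (intro sum.cong refl X.sprod_finsum_right) auto
    finally show ?thesis .
  qed
  have "(\<Sum>s\<in>insert b A. \<Sum>t\<in>insert b A. ?D a s t) =
      (\<Sum>s\<in>insert b A. \<Sum>t\<in>insert b A. ?D b s t + (\<langle>F b (f s), f t\<rangle>\<^bsub>X\<^esub> - \<langle>F a (f s), f t\<rangle>\<^bsub>X\<^esub>))"
    by simp
  also have "\<dots> = (\<Sum>s\<in>insert b A. \<Sum>t\<in>insert b A. ?D b s t) + (\<langle>F b \<Sigma>, \<Sigma>\<rangle>\<^bsub>X\<^esub> - \<langle>F a \<Sigma>, \<Sigma>\<rangle>\<^bsub>X\<^esub>)"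
    using b insert.prems by (simp only: form sum.distrib sum_subtractf)
  also have "(\<Sum>s\<in>insert b A. \<Sum>t\<in>insert b A. ?D b s t) = (\<Sum>s\<in>A. \<Sum>t\<in>A. ?D b s t)"
  proof -
    have "?D b s t = 0" if "s \<in> insert b A" "t \<in> insert b A" "s = b \<or> t = b" for s t
    proof -
      have "min s t = b"
        using that b_le[of s] b_le[of t] by (auto simp: min_def)
      then show ?thesis by simp
    qed
    moreover have "b \<notin> A"
      using b_le by blast
    ultimately show ?thesis
      using insert.hyps by simp
  qed
  also have "\<langle>F b \<Sigma>, \<Sigma>\<rangle>\<^bsub>X\<^esub> - \<langle>F a \<Sigma>, \<Sigma>\<rangle>\<^bsub>X\<^esub> = \<langle>F b \<Sigma> \<ominus>\<^bsub>X\<^esub> F a \<Sigma>, \<Sigma>\<rangle>\<^bsub>X\<^esub>"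
    using b \<Sigma> insert.prems by (simp add: X.sprod_minus_left bounded_opsD(1)[OF F])
  finally show ?case
    using IH mono[of a b \<Sigma>] b \<Sigma> insert.prems by (auto intro: nonneg_Reals_add_I)
qed

lemma tendsto_zero_le:
  fixes f g :: "real \<Rightarrow> real"
  assumes "(g \<longlongrightarrow> 0) F" "\<forall>\<^sub>F s in F. 0 \<le> f s" "\<forall>\<^sub>F s in F. f s \<le> g s"
  shows "(f \<longlongrightarrow> 0) F"
  by (rule tendsto_sandwich[OF assms(2,3) tendsto_const assms(1)])

text \<open>In any dilation the vectors v s x = E s V x have scalar products given by
  \<open>F (min s t)\<close>, so they are constructed from that kernel. \<open>E t\<close> is then
  the projection onto the closed span of the v s x with s \<le> t, and v (2 pi) serves as V. Its
  Gram operator is F (2 pi), so V is in general not isometric.\<close>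

theorem naimark_dilation:
  fixes X :: "'a ipspace"
  assumes X: "hilbert_space X"
    and F: "\<And>t. t \<in> {0..2 * pi} \<Longrightarrow> F t \<in> bounded_ops X X"
    and mono: "\<And>s t x. \<lbrakk>s \<in> {0..2 * pi}; t \<in> {0..2 * pi}; s \<le> t; x \<in> carrier X\<rbrakk>
      \<Longrightarrow> \<langle>F t x \<ominus>\<^bsub>X\<^esub> F s x, x\<rangle>\<^bsub>X\<^esub> \<in> \<real>\<^sub>\<ge>\<^sub>0"
    and F0: "\<And>x. x \<in> carrier X \<Longrightarrow> F 0 x = \<zero>\<^bsub>X\<^esub>"
    and lcont: "strongly_left_continuous X F"
  obtains K :: "'a dilation_vec ipspace" and E v where "hilbert_space K" "resolution_of_identity K E"
    "\<And>x. x \<in> carrier X \<Longrightarrow> v x \<in> carrier K"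
    "\<And>t x y. \<lbrakk>t \<in> {0..2 * pi}; x \<in> carrier X; y \<in> carrier X\<rbrakk> \<Longrightarrow> \<langle>E t (v x), v y\<rangle>\<^bsub>K\<^esub> = \<langle>F t x, y\<rangle>\<^bsub>X\<^esub>"
proof -
  interpret X: hilbert_space X by fact
  define T where "T = {0..2 * pi}"
  have T: "0 \<in> T" "2 * pi \<in> T" and min_T: "\<And>s t. \<lbrakk>s \<in> T; t \<in> T\<rbrakk> \<Longrightarrow> min s t \<in> T"
    by (auto simp: T_def min_def)
  note F = F[folded T_def] and mono = mono[folded T_def]
  \<comment> \<open>Monotonicity starting from F 0 = 0 gives positivity, and then polarisation gives
    symmetry of every F t.\<close>
  have F_pos: "\<langle>F t x, x\<rangle>\<^bsub>X\<^esub> \<in> \<real>\<^sub>\<ge>\<^sub>0" if "t \<in> T" "x \<in> carrier X" for t x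
    using mono[of 0 t x] F0 T that bounded_opsD(1)[OF F[OF that(1)]]
    by (simp add: T_def X.sprod_minus_left)
  have F_herm: "\<langle>F t x, y\<rangle>\<^bsub>X\<^esub> = cnj \<langle>F t y, x\<rangle>\<^bsub>X\<^esub>" if "t \<in> T" "x \<in> carrier X" "y \<in> carrier X" for t x y
    using that F_pos nonneg_Reals_subset_Reals by (intro X.real_form_imp_hermitian F) auto
  define k where "k s t = F (min s t)" for s t
  interpret P: positive_kernel X T k
  proof
    show "k s t \<in> bounded_ops X X" if "s \<in> T" "t \<in> T" for s t
      using that unfolding k_def by (intro F min_T)
    show "\<langle>k s t x, y\<rangle>\<^bsub>X\<^esub> = cnj \<langle>k t s y, x\<rangle>\<^bsub>X\<^esub>" if "s \<in> T" "t \<in> T" "x \<in> carrier X" "y \<in> carrier X" for s t x y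
      using F_herm[of "min s t" x y] that min_T by (simp add: k_def min.commute)
    show "(\<Sum>s\<in>A. \<Sum>t\<in>A. \<langle>k s t (f s), f t\<rangle>\<^bsub>X\<^esub>) \<in> \<real>\<^sub>\<ge>\<^sub>0"
      if "finite A" "A \<subseteq> T" "\<And>t. t \<in> A \<Longrightarrow> f t \<in> carrier X" for A f
    proof -
      \<comment> \<open>Base level 0, where F vanishes.\<close>
      have "(\<Sum>s\<in>A. \<Sum>t\<in>A. \<langle>F (min s t) (f s), f t\<rangle>\<^bsub>X\<^esub> - \<langle>F 0 (f s), f t\<rangle>\<^bsub>X\<^esub>) \<in> \<real>\<^sub>\<ge>\<^sub>0"
        using that unfolding T_def
        by (intro resolution_kernel_positive[OF X F[unfolded T_def] mono[unfolded T_def]]) auto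
      moreover have "\<langle>F 0 (f s), f t\<rangle>\<^bsub>X\<^esub> = 0" if "s \<in> A" "t \<in> A" for s t
        using that \<open>\<And>t. t \<in> A \<Longrightarrow> f t \<in> carrier X\<close> by (simp add: F0)
      ultimately show ?thesis
        by (simp add: k_def)
    qed
  qed
  interpret Kpre: semi_inner_product_space P.K
    by (rule P.kernel_space_semi_inner_product_space)
  define K where "K = completion P.K"
  interpret K: hilbert_space K
    unfolding K_def by (rule Kpre.completion_hilbert_space)
  define v where "v s x = completion_embed P.K (P.single s x)" for s x
  have v: "v s x \<in> carrier K" if "s \<in> T" "x \<in> carrier X" for s x
    unfolding v_def K_def using that by (intro Kpre.completion_embed_carrier P.single_carrier)
  have sprod_v: "\<langle>v s x, v t y\<rangle>\<^bsub>K\<^esub> = \<langle>F (min s t) x, y\<rangle>\<^bsub>X\<^esub>"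
    if "s \<in> T" "t \<in> T" "x \<in> carrier X" "y \<in> carrier X" for s t x y
    using that by (simp add: v_def K_def Kpre.completion_embed_sprod P.single_carrier P.sprod_single k_def)
  define V where "V t = {v s x | s x. s \<in> T \<and> s \<le> t \<and> x \<in> carrier X}" for t
  \<comment> \<open>The double complement is the closed span of \<open>V t\<close>.\<close>
  define M where "M t = perp K (perp K (V t))" for t
  have V: "V t \<subseteq> carrier K" for t
    using v by (auto simp: V_def)
  have M: "closed_subspace K (M t)" for t
    unfolding M_def by (intro K.closed_subspace_perp K.perp_subset)
  have M_mono: "M s \<subseteq> M t" if "s \<le> t" for s t
    unfolding M_def using that by (intro K.perp_antimono) (force simp: V_def)
  have V_M: "V t \<subseteq> M t" for t
    unfolding M_def by (rule K.perp_perp_superset[OF V])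
  have "V (2 * pi) = {v s x | s x. s \<in> T \<and> x \<in> carrier X}"
    by (auto simp: V_def T_def)
  then have total: "perp K (V (2 * pi)) \<subseteq> {\<zero>\<^bsub>K\<^esub>}"
    using P.kernel_dilation_total by (simp add: K_def v_def)
  \<comment> \<open>Defined for every real t and without a domain; both restrictions are added in
    \<open>E\<close>.\<close>
  define e where "e t x = orth_proj K (M t) x" for t x
  have e [simp]: "e t x \<in> carrier K" "e t x \<in> M t" if "x \<in> carrier K" for t x
    using that M unfolding e_def by (auto intro: K.orth_proj_carrier K.orth_proj_mem)
  have e_adj: "\<langle>e t x, y\<rangle>\<^bsub>K\<^esub> = \<langle>x, e t y\<rangle>\<^bsub>K\<^esub>" if "x \<in> carrier K" "y \<in> carrier K" for t x y
    unfolding e_def using M that by (rule K.orth_proj_self_adjoint)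
  have e_ge: "e t (e s x) = e s x" if "x \<in> carrier K" "s \<le> t" for s t x
    using e(2)[OF that(1), of s] M_mono[OF that(2)] unfolding e_def by (intro K.orth_proj_id M) auto
  \<comment> \<open>The adjoint form of \<open>e_ge\<close>.\<close>
  have e_le: "e s (e t x) = e s x" if "x \<in> carrier K" "s \<le> t" for s t x
    using that by (intro K.vec_eqI) (auto simp: e_adj e_ge)
  have e_min: "e s (e t x) = e (min s t) x" if "x \<in> carrier K" for s t x
    using e_ge[OF that, of t s] e_le[OF that, of s t] by (cases "s \<le> t") (auto simp: min_def)
  have e_norm: "hnorm K (e t x) \<le> hnorm K x" if "x \<in> carrier K" for t x
    unfolding e_def using M that by (rule K.hnorm_orth_proj_le)
  have e_ops: "(\<lambda>x\<in>carrier K. e t x) \<in> projection_ops K" for t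
    unfolding e_def by (rule K.orth_proj_projection_ops[OF M])
  have e_lin: "e t (x \<oplus>\<^bsub>K\<^esub> y) = e t x \<oplus>\<^bsub>K\<^esub> e t y" "e t (a \<odot>\<^bsub>K\<^esub> x) = a \<odot>\<^bsub>K\<^esub> e t x"
    if "x \<in> carrier K" "y \<in> carrier K" for t x y a
    using that by (intro K.vec_eqI; simp add: e_adj K.sprod_linear)+
  have e_minus: "e t (x \<ominus>\<^bsub>K\<^esub> y) = e t x \<ominus>\<^bsub>K\<^esub> e t y" if "x \<in> carrier K" "y \<in> carrier K" for t x y
    using that by (intro K.vec_eqI) (simp_all add: e_adj K.sprod_linear)
  have e_v: "e t (v s x) = v (min s t) x" if "s \<in> T" "t \<in> T" "x \<in> carrier X" for s t x
  proof (cases "s \<le> t")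
    case True
    then have "v s x \<in> M t"
      using V_M that by (force simp: V_def)
    with True show ?thesis
      unfolding e_def by (simp add: K.orth_proj_id[OF M] min_def)
  next
    case False
    \<comment> \<open>For r \<le> t < s the kernel gives F r in the scalar products of
      \<open>v r y\<close> with both \<open>v t x\<close> and \<open>v s x\<close>. Hence
      \<open>v t x\<close>, which lies in \<open>M t\<close>, is the projection of
      \<open>v s x\<close>.\<close>
    have "v t x \<ominus>\<^bsub>K\<^esub> v s x \<in> perp K (V t)"
    proof -
      have "\<langle>v r y, v t x \<ominus>\<^bsub>K\<^esub> v s x\<rangle>\<^bsub>K\<^esub> = 0" if "r \<in> T" "r \<le> t" "y \<in> carrier X" for r y
        using that \<open>s \<in> T\<close> \<open>t \<in> T\<close> \<open>x \<in> carrier X\<close> False v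
        by (simp add: K.sprod_minus_right sprod_v min_def)
      then show ?thesis
        using that v by (auto simp: perp_def V_def)
    qed
    then have "\<langle>v t x \<ominus>\<^bsub>K\<^esub> v s x, m\<rangle>\<^bsub>K\<^esub> = 0" "m \<in> carrier K" if "m \<in> M t" for m
      using that by (auto simp: M_def perp_def)
    then have "\<langle>v t x, m\<rangle>\<^bsub>K\<^esub> = \<langle>v s x, m\<rangle>\<^bsub>K\<^esub>" if "m \<in> M t" for m
      using that v \<open>s \<in> T\<close> \<open>t \<in> T\<close> \<open>x \<in> carrier X\<close> by (simp add: K.sprod_minus_left)
    moreover have "v t x \<in> M t"
      using V_M that by (force simp: V_def)
    ultimately have "e t (v s x) = v t x"
      unfolding e_def using that v by (intro K.orth_proj_eqI M) auto
    with False show ?thesis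
      by (simp add: min_def)
  qed
  define E where "E = (\<lambda>t\<in>T. \<lambda>x\<in>carrier K. e t x)"
  have E: "E t x = e t x" if "t \<in> T" "x \<in> carrier K" for t x
    using that by (simp add: E_def)
  have cont: "((\<lambda>s. hdist K (e s x) (e t x)) \<longlongrightarrow> 0) (at_left t)"
    if t: "t \<in> {0<..2 * pi}" and x: "x \<in> carrier K" for t x
  proof -
    have ev_T: "\<forall>\<^sub>F s in at_left t. s \<in> T \<and> s < t"
      using t by (intro eventually_at_leftI[of 0]) (auto simp: T_def)
    have tT: "t \<in> T"
      using t by (auto simp: T_def)
    \<comment> \<open>The vectors for which left-continuity at t holds form a closed subspace
      because projections are contractions, so it remains to treat the generators.\<close>
    let ?C = "{x \<in> carrier K. ((\<lambda>s. hdist K (e s x) (e t x)) \<longlongrightarrow> 0) (at_left t)}"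
    have "closed_subspace K ?C"
      unfolding closed_subspace_def
    proof (intro conjI allI impI ballI)
      show "\<zero>\<^bsub>K\<^esub> \<in> ?C"
      proof -
        have "e s \<zero>\<^bsub>K\<^esub> = \<zero>\<^bsub>K\<^esub>" for s
          by (intro K.vec_eqI) (auto simp: e_adj)
        then show ?thesis by simp
      qed
    next
      fix x y assume xy: "x \<in> ?C" "y \<in> ?C"
      have lim: "((\<lambda>s. hdist K (e s x) (e t x) + hdist K (e s y) (e t y)) \<longlongrightarrow> 0) (at_left t)"
        using xy by (intro tendsto_add_zero) auto
      have "0 \<le> hdist K (e s (x \<oplus>\<^bsub>K\<^esub> y)) (e t (x \<oplus>\<^bsub>K\<^esub> y))"
        "hdist K (e s (x \<oplus>\<^bsub>K\<^esub> y)) (e t (x \<oplus>\<^bsub>K\<^esub> y)) \<le> hdist K (e s x) (e t x) + hdist K (e s y) (e t y)" for s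
        using xy by (auto simp: e_lin(1) K.hdist_add)
      then have "((\<lambda>s. hdist K (e s (x \<oplus>\<^bsub>K\<^esub> y)) (e t (x \<oplus>\<^bsub>K\<^esub> y))) \<longlongrightarrow> 0) (at_left t)"
        by (intro tendsto_zero_le[OF lim] always_eventually allI)
      then show "x \<oplus>\<^bsub>K\<^esub> y \<in> ?C"
        using xy by simp
    next
      fix a x assume x: "x \<in> ?C"
      have "((\<lambda>s. cmod a * hdist K (e s x) (e t x)) \<longlongrightarrow> 0) (at_left t)"
        using x tendsto_mult_right_zero by blast
      then show "a \<odot>\<^bsub>K\<^esub> x \<in> ?C"
        using x by (simp add: e_lin(2)[of x x] K.hdist_smult)
    next
      fix u x assume u: "range u \<subseteq> ?C" and x: "x \<in> carrier K" and lim: "hlim K u x"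
      have uC: "u n \<in> ?C" for n
        using u by auto
      have "((\<lambda>s. hdist K (e s x) (e t x)) \<longlongrightarrow> 0) (at_left t)"
      proof (rule tendstoI)
        fix \<epsilon> :: real assume "\<epsilon> > 0"
        then have "\<forall>\<^sub>F n in sequentially. hdist K (u n) x < \<epsilon> / 3"
          using lim unfolding hlim_def by (intro order_tendstoD(2)[of _ 0]) auto
        then obtain n where n: "hdist K (u n) x < \<epsilon> / 3"
          by (meson eventually_sequentially order_refl)
        have un: "u n \<in> carrier K" using uC by auto
        have "\<forall>\<^sub>F s in at_left t. hdist K (e s (u n)) (e t (u n)) < \<epsilon> / 3"
          using uC[of n] \<open>\<epsilon> > 0\<close> by (intro order_tendstoD(2)[of _ 0]) auto
        then show "\<forall>\<^sub>F s in at_left t. dist (hdist K (e s x) (e t x)) 0 < \<epsilon>"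
        proof eventually_elim
          case (elim s)
          have close: "hdist K (e r (u n)) (e r x) < \<epsilon> / 3" for r
            using e_norm[of "u n \<ominus>\<^bsub>K\<^esub> x" r] n un x by (simp add: hdist_def e_minus)
          have "hdist K (e s x) (e t x) \<le> hdist K (e s x) (e s (u n)) + hdist K (e s (u n)) (e t x)"
            using un x by (intro K.hdist_triangle) auto
          also have "hdist K (e s (u n)) (e t x) \<le> hdist K (e s (u n)) (e t (u n)) + hdist K (e t (u n)) (e t x)"
            using un x by (intro K.hdist_triangle) auto
          also have "hdist K (e s x) (e s (u n)) = hdist K (e s (u n)) (e s x)"
            using un x by (intro K.hdist_commute) auto
          finally show ?case
            using elim close[of s] close[of t] x by simp
        qed
      qed
      then show "x \<in> ?C"
        using x by simp
    qed auto
    moreover have "V (2 * pi) \<subseteq> ?C"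
    proof
      fix z assume "z \<in> V (2 * pi)"
      then obtain r y where z: "z = v r y" and r: "r \<in> T" and y: "y \<in> carrier X"
        by (auto simp: V_def)
      have "((\<lambda>s. hdist K (e s (v r y)) (e t (v r y))) \<longlongrightarrow> 0) (at_left t)"
      proof (cases "r < t")
        case True
        \<comment> \<open>For s between r and t the generator is fixed by both projections.\<close>
        have "\<forall>\<^sub>F s in at_left t. r < s"
          using True by (intro eventually_at_leftI[of r]) auto
        with ev_T have "\<forall>\<^sub>F s in at_left t. hdist K (e s (v r y)) (e t (v r y)) = 0"
        proof eventually_elim
          case (elim s)
          then have "e s (v r y) = v r y" "e t (v r y) = v r y"
            using r y True tT by (auto simp: e_v min_def)
          then show ?case
            using r y v by simp
        qed
        then show ?thesis
          by (rule tendsto_eventually)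
      next
        case False
        \<comment> \<open>The squared distance of \<open>v s y\<close> and \<open>v t y\<close> is
          the form of F t - F s at y, which Cauchy-Schwarz bounds by \<open>?g s\<close>; hence the
          square root. This is where left-continuity of F enters.\<close>
        let ?g = "\<lambda>s. hdist X (F s y) (F t y) * hnorm X y"
        have "((\<lambda>s. hdist X (F s y) (F t y)) \<longlongrightarrow> 0) (at_left t)"
          using lcont t y by (auto simp: strongly_left_continuous_def)
        then have "((\<lambda>s. sqrt (?g s)) \<longlongrightarrow> sqrt 0) (at_left t)"
          by (intro tendsto_real_sqrt tendsto_mult_left_zero)
        then have lim: "((\<lambda>s. sqrt (?g s)) \<longlongrightarrow> 0) (at_left t)"
          by simp
        show ?thesis
        proof (rule tendsto_zero_le[OF lim])
          show "\<forall>\<^sub>F s in at_left t. 0 \<le> hdist K (e s (v r y)) (e t (v r y))"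
            using r y v by (intro always_eventually) auto
          show "\<forall>\<^sub>F s in at_left t. hdist K (e s (v r y)) (e t (v r y)) \<le> sqrt (?g s)"
            using ev_T
          proof eventually_elim
            case (elim s)
            have ev: "e s (v r y) = v s y" "e t (v r y) = v t y"
              using elim r y False tT by (auto simp: e_v min_def)
            have Fy: "F s y \<in> carrier X" "F t y \<in> carrier X"
              using elim tT y bounded_opsD(1)[OF F] by auto
            have "(hdist K (v s y) (v t y))\<^sup>2 = Re \<langle>F t y \<ominus>\<^bsub>X\<^esub> F s y, y\<rangle>\<^bsub>X\<^esub>"
              using elim tT y v Fy by (simp add: K.hdist_power2 K.hnorm_power2 sprod_v min_def X.sprod_minus_left)
            also have "\<dots> \<le> hnorm X (F t y \<ominus>\<^bsub>X\<^esub> F s y) * hnorm X y"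
              using Fy y X.Cauchy_Schwarz[of "F t y \<ominus>\<^bsub>X\<^esub> F s y" y] complex_Re_le_cmod order_trans by blast
            also have "\<dots> = ?g s"
              using Fy X.hdist_commute[of "F t y" "F s y"] by (simp add: hdist_def)
            finally show ?case
              unfolding ev by (rule real_le_rsqrt)
          qed
        qed
      qed
      then show "z \<in> ?C"
        using z r y v by simp
    qed
    ultimately have "?C = carrier K"
      using total by (rule K.closed_subspace_eq_carrier)
    then show ?thesis
      using x by blast
  qed
  have "resolution_of_identity K E"
    unfolding resolution_of_identity_def
  proof (intro conjI ballI)
    show "E \<in> {0..2 * pi} \<rightarrow>\<^sub>E projection_ops K"
      using e_ops by (auto simp: E_def T_def)
    show "E s (E t x) = E (min s t) x" if "s \<in> {0..2 * pi}" "t \<in> {0..2 * pi}" "x \<in> carrier K" for s t x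
      using that min_T[of s t] by (simp add: E T_def e_min del: min_less_iff_conj)
    show "E 0 x = \<zero>\<^bsub>K\<^esub>" if "x \<in> carrier K" for x
    proof -
      have "e 0 x = \<zero>\<^bsub>K\<^esub>"
      proof (rule K.total_eqI[OF total V])
        fix a assume "a \<in> V (2 * pi)"
        then obtain r y where a: "a = v r y" "r \<in> T" "y \<in> carrier X"
          by (auto simp: V_def)
        \<comment> \<open>The projection \<open>e 0\<close> sends \<open>v r y\<close> to
          \<open>v 0 y\<close>, which is zero because F 0 = 0.\<close>
        have "\<langle>v 0 y, v 0 y\<rangle>\<^bsub>K\<^esub> = 0"
          using a T F0 by (simp add: sprod_v)
        then have "v 0 y = \<zero>\<^bsub>K\<^esub>"
          using v a T by (intro K.sprod_definite) auto
        then show "\<langle>e 0 x, a\<rangle>\<^bsub>K\<^esub> = \<langle>\<zero>\<^bsub>K\<^esub>, a\<rangle>\<^bsub>K\<^esub>"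
          using a that T v by (auto simp: e_adj e_v min_def T_def)
      qed (use that in auto)
      then show ?thesis
        using that T by (simp add: E)
    qed
    show "E (2 * pi) x = x" if "x \<in> carrier K" for x
    proof -
      have "e (2 * pi) x = x"
      proof (rule K.total_eqI[OF total V])
        fix a assume "a \<in> V (2 * pi)"
        then obtain r y where a: "a = v r y" "r \<in> T" "y \<in> carrier X"
          by (auto simp: V_def)
        then show "\<langle>e (2 * pi) x, a\<rangle>\<^bsub>K\<^esub> = \<langle>x, a\<rangle>\<^bsub>K\<^esub>"
          using that T v by (auto simp: e_adj e_v min_def T_def)
      qed (use that in auto)
      then show ?thesis
        using that T by (simp add: E)
    qed
    show "strongly_left_continuous K E"
      unfolding strongly_left_continuous_def
    proof (intro ballI)
      fix t x assume t: "t \<in> {0<..2 * pi}" and x: "x \<in> carrier K"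
      have "\<forall>\<^sub>F s in at_left t. s \<in> T"
        using t by (intro eventually_at_leftI[of 0]) (auto simp: T_def)
      then have "\<forall>\<^sub>F s in at_left t. hdist K (e s x) (e t x) = hdist K (E s x) (E t x)"
      proof eventually_elim
        case (elim s)
        then show ?case using t x by (simp add: E T_def)
      qed
      then show "((\<lambda>s. hdist K (E s x) (E t x)) \<longlongrightarrow> 0) (at_left t)"
        using cont[OF t x] by (rule Lim_transform_eventually[rotated])
    qed
  qed
  \<comment> \<open>Here \<open>E t\<close> takes v (2 pi) x to v t x.\<close>
  moreover have "\<langle>E t (v (2 * pi) x), v (2 * pi) y\<rangle>\<^bsub>K\<^esub> = \<langle>F t x, y\<rangle>\<^bsub>X\<^esub>"
    if "t \<in> {0..2 * pi}" "x \<in> carrier X" "y \<in> carrier X" for t x y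
    using that T v by (auto simp: E e_v sprod_v T_def min_def)
  ultimately show ?thesis
    using that[of K E "v (2 * pi)"] K.hilbert_space_axioms v T by blast
qed

section \<open>Integrals with respect to a resolution of the identity\<close>

lemma cmod_cis_diff_le: "cmod (cis a - cis b) \<le> \<bar>a - b\<bar>"
proof -
  have "(cmod (cis a - cis b))\<^sup>2 = (cos a - cos b)\<^sup>2 + (sin a - sin b)\<^sup>2"
    by (simp add: cmod_power2)
  also have "\<dots> = ((sin a)\<^sup>2 + (cos a)\<^sup>2) + ((sin b)\<^sup>2 + (cos b)\<^sup>2) - 2 * (cos a * cos b + sin a * sin b)"
    by (simp add: power2_eq_square algebra_simps)
  also have "\<dots> = 2 - 2 * cos (a - b)"
    by (simp add: cos_diff)
  \<comment> \<open>The chord has length 2 |sin ((a - b) / 2)|, which is at most the arc.\<close>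
  also have "\<dots> = (2 * sin ((a - b) / 2))\<^sup>2"
  proof -
    have "a - b = 2 * ((a - b) / 2)"
      by simp
    then have "cos (a - b) = 1 - 2 * (sin ((a - b) / 2))\<^sup>2"
      using cos_double_sin by metis
    then show ?thesis
      by (simp add: power_mult_distrib)
  qed
  also have "\<dots> \<le> (a - b)\<^sup>2"
    using abs_sin_x_le_abs_x[of "(a - b) / 2"] by (subst abs_le_square_iff[symmetric]) (simp add: abs_mult)
  finally show ?thesis
    by (simp add: abs_le_square_iff[symmetric])
qed

lemma tagged_partition_mono:
  assumes "tagged_partition \<delta> m p \<tau>" "i \<le> j" "j \<le> m"
  shows "p i \<le> p j"
  using assms(2,3)
proof (induction rule: dec_induct)
  case (step k)
  then have "p k < p (Suc k)"
    using assms(1) by (simp add: tagged_partition_def)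
  with step show ?case by simp
qed simp

lemma tagged_partition_range:
  assumes "tagged_partition \<delta> m p \<tau>" "i \<le> m"
  shows "p i \<in> {0..2 * pi}"
  using tagged_partition_mono[OF assms(1), of 0 i] tagged_partition_mono[OF assms(1), of i m] assms
  by (simp add: tagged_partition_def)

text \<open>The index N gives N + 1 cells, so that even N = 0 is a partition. The same function also
  supplies the tags, as left end points.\<close>

definition uniform_partition :: "nat \<Rightarrow> nat \<Rightarrow> real" where
  "uniform_partition N i = 2 * pi * real i / real (Suc N)"

lemma tagged_uniform_partition:
  assumes "2 * pi / real (Suc N) < \<delta>"
  shows "tagged_partition \<delta> (Suc N) (uniform_partition N) (uniform_partition N)"
proof -
  have "uniform_partition N (Suc i) - uniform_partition N i = 2 * pi / real (Suc N)" for i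
    unfolding uniform_partition_def by (simp add: divide_simps) (simp add: algebra_simps)
  moreover have "0 < 2 * pi / real (Suc N)"
    by simp
  ultimately have "uniform_partition N i < uniform_partition N (Suc i)"
    "uniform_partition N (Suc i) - uniform_partition N i < \<delta>" for i
    using assms by (metis diff_gt_0_iff_gt, metis)
  then show ?thesis
    using less_imp_le by (auto simp: tagged_partition_def) (auto simp: uniform_partition_def)
qed

text \<open>A tagged partition needs cells strictly shorter than its parameter; 8 is a round number
  above 2 pi.\<close>

lemma uniform_mesh_less: "2 * pi / real (Suc N) < 8 / real (Suc N)"
  using pi_less_4 by (intro divide_strict_right_mono) auto

lemmas tagged_uniform_partition_8 = tagged_uniform_partition[OF uniform_mesh_less]

lemma uniform_mesh_tendsto: "(\<lambda>N. 8 / real (Suc N)) \<longlonglongrightarrow> 0"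
  using tendsto_mult_right_zero[OF LIMSEQ_inverse_real_of_nat, of 8] by (simp add: inverse_eq_divide)

text \<open>The integral is a limit over all fine partitions. A single sequence of partitions makes
  the limit lemmas for scalar products applicable.\<close>

lemma has_strong_integral_hlim:
  assumes X: "semi_inner_product_space X" and int: "has_strong_integral X f F T" and x: "x \<in> carrier X"
    and carr: "T x \<in> carrier X" "\<And>t. t \<in> {0..2 * pi} \<Longrightarrow> F t x \<in> carrier X"
  shows "hlim X (\<lambda>N. rs_sum X f F (Suc N) (uniform_partition N) (uniform_partition N) x) (T x)"
  unfolding hlim_def
proof (rule LIMSEQ_I)
  interpret semi_inner_product_space X by fact
  let ?R = "\<lambda>N. rs_sum X f F (Suc N) (uniform_partition N) (uniform_partition N) x"
  fix e :: real assume "e > 0"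
  then obtain \<delta> where \<delta>: "\<delta> > 0"
    "\<And>m p \<tau>. tagged_partition \<delta> m p \<tau> \<Longrightarrow> hdist X (rs_sum X f F m p \<tau> x) (T x) < e"
    using int x unfolding has_strong_integral_def by meson
  then have "\<forall>\<^sub>F N in sequentially. 8 / real (Suc N) < \<delta>"
    using order_tendstoD(2)[OF uniform_mesh_tendsto] by blast
  then obtain N0 where N0: "\<And>N. N \<ge> N0 \<Longrightarrow> 8 / real (Suc N) < \<delta>"
    by (auto simp: eventually_sequentially)
  have "norm (hdist X (?R N) (T x) - 0) < e" if "N \<ge> N0" for N
  proof -
    have "uniform_partition N i \<in> {0..2 * pi}" if "i \<le> Suc N" for i
      using tagged_partition_range[OF tagged_uniform_partition_8] that .
    then have "F (uniform_partition N (Suc i)) x \<ominus>\<^bsub>X\<^esub> F (uniform_partition N i) x \<in> carrier X" if "i < Suc N" for i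
      using that carr by (intro minus_carrier) auto
    then have "?R N \<in> carrier X"
      unfolding rs_sum_def by (intro M.finsum_closed) auto
    then have "0 \<le> hdist X (?R N) (T x)"
      using carr by simp
    moreover have "hdist X (?R N) (T x) < e"
      using uniform_mesh_less[of N] N0[OF that] by (intro \<delta> tagged_uniform_partition) linarith
    ultimately show ?thesis
      by simp
  qed
  then show "\<exists>N0. \<forall>N\<ge>N0. norm (hdist X (?R N) (T x) - 0) < e"
    by blast
qed

context semi_inner_product_space
begin

lemma
  assumes "\<And>i. i \<le> m \<Longrightarrow> F (p i) x \<in> carrier X"
  shows rs_sum_carrier: "rs_sum X f F m p \<tau> x \<in> carrier X"
    and sprod_rs_sum_left: "y \<in> carrier X \<Longrightarrow>
      \<langle>rs_sum X f F m p \<tau> x, y\<rangle> = (\<Sum>i<m. f (\<tau> i) * (\<langle>F (p (Suc i)) x, y\<rangle> - \<langle>F (p i) x, y\<rangle>))"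
    and sprod_rs_sum_right: "y \<in> carrier X \<Longrightarrow>
      \<langle>y, rs_sum X f F m p \<tau> x\<rangle> = (\<Sum>i<m. cnj (f (\<tau> i)) * (\<langle>y, F (p (Suc i)) x\<rangle> - \<langle>y, F (p i) x\<rangle>))"
proof -
  have carr: "F (p (Suc i)) x \<in> carrier X" "F (p i) x \<in> carrier X" if "i < m" for i
    using assms that by auto
  show "rs_sum X f F m p \<tau> x \<in> carrier X"
    unfolding rs_sum_def using carr by (intro M.finsum_closed) auto
  assume y: "y \<in> carrier X"
  show "\<langle>rs_sum X f F m p \<tau> x, y\<rangle> = (\<Sum>i<m. f (\<tau> i) * (\<langle>F (p (Suc i)) x, y\<rangle> - \<langle>F (p i) x, y\<rangle>))"
    unfolding rs_sum_def using carr y by (subst sprod_finsum_left) (auto simp: sprod_linear)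
  show "\<langle>y, rs_sum X f F m p \<tau> x\<rangle> = (\<Sum>i<m. cnj (f (\<tau> i)) * (\<langle>y, F (p (Suc i)) x\<rangle> - \<langle>y, F (p i) x\<rangle>))"
    unfolding rs_sum_def using carr y by (subst sprod_finsum_right) (auto simp: sprod_linear)
qed

end

text \<open>The mass that the measure with distribution function \<open>e\<close> gives to \<open>[a, b) \<inter> [c, d)\<close>.\<close>

definition overlap :: "(real \<Rightarrow> 'b::ab_group_add) \<Rightarrow> real \<Rightarrow> real \<Rightarrow> real \<Rightarrow> real \<Rightarrow> 'b" where
  "overlap e a b c d = e (min b d) - e (min b c) - (e (min a d) - e (min a c))"

lemma overlap_commute: "overlap e a b c d = overlap e c d a b"
  by (simp add: overlap_def min.commute algebra_simps)

lemma overlap_disjoint: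
  assumes "a \<le> b" "c \<le> d" "b \<le> c \<or> d \<le> a"
  shows "overlap e a b c d = 0"
  using assms(3)
proof
  assume "b \<le> c"
  then have "min b d = b" "min b c = b" "min a d = a" "min a c = a"
    using assms by auto
  then show ?thesis by (simp add: overlap_def)
next
  assume "d \<le> a"
  then have "min b d = d" "min b c = c" "min a d = d" "min a c = c"
    using assms by auto
  then show ?thesis by (simp add: overlap_def)
qed

lemma overlap_same: "a \<le> b \<Longrightarrow> overlap e a b a b = e b - e a"
  by (auto simp: overlap_def min_def)

lemma overlap_nonneg:
  fixes e :: "real \<Rightarrow> real"
  assumes "a \<in> I" "b \<in> I" "c \<in> I" "d \<in> I" "a \<le> b" "c \<le> d"
    and mono: "\<And>s t. \<lbrakk>s \<in> I; t \<in> I; s \<le> t\<rbrakk> \<Longrightarrow> e s \<le> e t"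
  shows "0 \<le> overlap e a b c d"
  using assms mono[of a b] mono[of c d] mono[of a d] mono[of c b] mono[of a c] mono[of b d]
  by (auto simp: overlap_def min_def)

lemma overlap_of_real: "overlap (\<lambda>t. of_real (r t)) a b c d = of_real (overlap r a b c d)"
  by (simp add: overlap_def)

text \<open>The cells of q tile [0, 2 pi), so for a \<le> b their intersections with [a, b) carry
  its whole mass; the sums telescope.\<close>

lemma sum_overlap:
  assumes q: "tagged_partition \<delta> n q \<sigma>" and e: "e 0 = 0" and ab: "a \<in> {0..2 * pi}" "b \<in> {0..2 * pi}"
  shows "(\<Sum>j<n. overlap e a b (q j) (q (Suc j))) = e b - e a"
proof -
  have "(\<Sum>j<n. overlap e a b (q j) (q (Suc j))) =
      (\<Sum>j<n. e (min b (q (Suc j))) - e (min b (q j))) - (\<Sum>j<n. e (min a (q (Suc j))) - e (min a (q j)))"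
    by (simp add: overlap_def sum_subtractf)
  also have "\<dots> = (e (min b (q n)) - e (min b (q 0))) - (e (min a (q n)) - e (min a (q 0)))"
    by (subst (1 2) sum_lessThan_telescope) simp
  also have "\<dots> = e b - e a"
    using q ab e by (auto simp: tagged_partition_def min_def)
  finally show ?thesis .
qed

text \<open>Distinct cells of one partition are disjoint. This is what makes the integral
  multiplicative in the integrand.\<close>

lemma sum_overlap_diagonal:
  fixes c :: "nat \<Rightarrow> nat \<Rightarrow> complex"
  assumes p: "tagged_partition \<delta> m p \<tau>"
  shows "(\<Sum>i<m. \<Sum>j<m. c i j * overlap e (p i) (p (Suc i)) (p j) (p (Suc j)))
    = (\<Sum>i<m. c i i * (e (p (Suc i)) - e (p i)))"
proof (rule sum.cong[OF refl])
  fix i assume i: "i \<in> {..<m}"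
  have "overlap e (p i) (p (Suc i)) (p j) (p (Suc j)) = (if j = i then e (p (Suc i)) - e (p i) else 0)"
    if j: "j < m" for j
  proof -
    have step: "p k \<le> p (Suc k)" if "k < m" for k
      using tagged_partition_mono[OF p, of k "Suc k"] that by simp
    have "p (Suc i) \<le> p j \<or> p (Suc j) \<le> p i" if "j \<noteq> i"
      using tagged_partition_mono[OF p, of "Suc i" j] tagged_partition_mono[OF p, of "Suc j" i] that i j
      by (cases "i < j") auto
    then show ?thesis
      using i j step by (auto simp: overlap_same overlap_disjoint)
  qed
  then have "(\<Sum>j<m. c i j * overlap e (p i) (p (Suc i)) (p j) (p (Suc j)))
      = (\<Sum>j<m. if j = i then c i j * (e (p (Suc i)) - e (p i)) else 0)"
    by (intro sum.cong) auto
  also have "\<dots> = c i i * (e (p (Suc i)) - e (p i))"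
    using i by (simp add: sum.delta)
  finally show "(\<Sum>j<m. c i j * overlap e (p i) (p (Suc i)) (p j) (p (Suc j))) = c i i * (e (p (Suc i)) - e (p i))" .
qed

locale spectral_resolution = hilbert_space K for K :: "'k ipspace" +
  fixes E :: "real \<Rightarrow> 'k \<Rightarrow> 'k"
  assumes resolution: "resolution_of_identity K E"
begin

section \<open>Calculus of a resolution of the identity\<close>

lemma E_bounded_ops: "t \<in> {0..2 * pi} \<Longrightarrow> E t \<in> bounded_ops K K"
  using resolution by (auto simp: resolution_of_identity_def projection_ops_def)

lemma E_carrier [simp, intro]: "\<lbrakk>t \<in> {0..2 * pi}; x \<in> carrier K\<rbrakk> \<Longrightarrow> E t x \<in> carrier K"
  by (rule bounded_opsD(1)[OF E_bounded_ops])

lemma E_self_adjoint: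
  "\<lbrakk>t \<in> {0..2 * pi}; x \<in> carrier K; y \<in> carrier K\<rbrakk> \<Longrightarrow> \<langle>E t x, y\<rangle>\<^bsub>K\<^esub> = \<langle>x, E t y\<rangle>\<^bsub>K\<^esub>"
  using resolution by (auto simp: resolution_of_identity_def projection_ops_def PiE_def Pi_def)

lemma E_E: "\<lbrakk>s \<in> {0..2 * pi}; t \<in> {0..2 * pi}; x \<in> carrier K\<rbrakk> \<Longrightarrow> E s (E t x) = E (min s t) x"
  using resolution unfolding resolution_of_identity_def by blast

lemma E_0: "x \<in> carrier K \<Longrightarrow> E 0 x = \<zero>\<^bsub>K\<^esub>"
  and E_2pi: "x \<in> carrier K \<Longrightarrow> E (2 * pi) x = x"
  using resolution unfolding resolution_of_identity_def by blast+

lemma sprod_E_E: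
  "\<lbrakk>s \<in> {0..2 * pi}; t \<in> {0..2 * pi}; x \<in> carrier K; y \<in> carrier K\<rbrakk> \<Longrightarrow> \<langle>E s x, E t y\<rangle>\<^bsub>K\<^esub> = \<langle>E (min s t) x, y\<rangle>\<^bsub>K\<^esub>"
  using E_self_adjoint[of t "E s x" y] E_E[of t s x] by (simp add: min.commute)

lemma sprod_E_self: "\<lbrakk>t \<in> {0..2 * pi}; x \<in> carrier K\<rbrakk> \<Longrightarrow> \<langle>E t x, x\<rangle>\<^bsub>K\<^esub> = of_real ((hnorm K (E t x))\<^sup>2)"
  using sprod_E_E[of t t x x] sprod_self[of "E t x"] by simp

lemma hnorm_E_diff:
  assumes "s \<in> {0..2 * pi}" "t \<in> {0..2 * pi}" "s \<le> t" "x \<in> carrier K"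
  shows "(hdist K (E s x) (E t x))\<^sup>2 = (hnorm K (E t x))\<^sup>2 - (hnorm K (E s x))\<^sup>2"
  using assms sprod_E_self[of s x] by (simp add: hdist_power2 sprod_E_E min_def)

lemma hnorm_E_mono:
  "\<lbrakk>s \<in> {0..2 * pi}; t \<in> {0..2 * pi}; s \<le> t; x \<in> carrier K\<rbrakk> \<Longrightarrow> (hnorm K (E s x))\<^sup>2 \<le> (hnorm K (E t x))\<^sup>2"
  using hnorm_E_diff[of s t x] zero_le_power2[of "hdist K (E s x) (E t x)"] by linarith

lemma rs_sum_E_carrier:
  "\<lbrakk>tagged_partition \<delta> m p \<tau>; x \<in> carrier K\<rbrakk> \<Longrightarrow> rs_sum K f E m p \<tau> x \<in> carrier K"
  using tagged_partition_range by (intro rs_sum_carrier) auto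

text \<open>The projections of two cells multiply to the projection of their intersection, which
  \<open>overlap\<close> records even for unrelated partitions. The additional \<open>E t\<close>
  truncates the distribution function at t, hence \<open>min t s\<close>.\<close>

lemma sprod_E_rs_sum:
  assumes p: "tagged_partition \<delta> m p \<tau>" and q: "tagged_partition \<delta>' n q \<sigma>"
    and t: "t \<in> {0..2 * pi}" and x: "x \<in> carrier K" and y: "y \<in> carrier K"
  shows "\<langle>E t (rs_sum K f E m p \<tau> x), rs_sum K g E n q \<sigma> y\<rangle>\<^bsub>K\<^esub> =
    (\<Sum>i<m. \<Sum>j<n. f (\<tau> i) * cnj (g (\<sigma> j)) *
      overlap (\<lambda>s. \<langle>E (min t s) x, y\<rangle>\<^bsub>K\<^esub>) (p i) (p (Suc i)) (q j) (q (Suc j)))"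
proof -
  let ?A = "rs_sum K f E m p \<tau> x" and ?B = "rs_sum K g E n q \<sigma> y"
  let ?e = "\<lambda>s. \<langle>E (min t s) x, y\<rangle>\<^bsub>K\<^esub>"
  have pI: "p i \<in> {0..2 * pi}" if "i \<le> m" for i
    using tagged_partition_range[OF p that] .
  have qI: "q j \<in> {0..2 * pi}" if "j \<le> n" for j
    using tagged_partition_range[OF q that] .
  have A: "?A \<in> carrier K" and B: "?B \<in> carrier K"
    using p q x y by (auto intro: rs_sum_E_carrier)
  have inner: "\<langle>E s x, E t ?B\<rangle>\<^bsub>K\<^esub> = (\<Sum>j<n. cnj (g (\<sigma> j)) * (?e (min s (q (Suc j))) - ?e (min s (q j))))"
    if s: "s \<in> {0..2 * pi}" for s
  proof -
    have "\<langle>E s x, E t ?B\<rangle>\<^bsub>K\<^esub> = \<langle>E (min t s) x, ?B\<rangle>\<^bsub>K\<^esub>"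
      using E_self_adjoint[of t "E s x" ?B] s t x B by (simp add: E_E)
    also have "\<dots> = (\<Sum>j<n. cnj (g (\<sigma> j)) *
        (\<langle>E (min t s) x, E (q (Suc j)) y\<rangle>\<^bsub>K\<^esub> - \<langle>E (min t s) x, E (q j) y\<rangle>\<^bsub>K\<^esub>))"
      using s t x y qI by (intro sprod_rs_sum_right) auto
    also have "\<dots> = (\<Sum>j<n. cnj (g (\<sigma> j)) * (?e (min s (q (Suc j))) - ?e (min s (q j))))"
    proof (rule sum.cong[OF refl])
      fix j assume "j \<in> {..<n}"
      then have "q j \<in> {0..2 * pi}" "q (Suc j) \<in> {0..2 * pi}" "min t s \<in> {0..2 * pi}"
        using qI[of j] qI[of "Suc j"] s t by (auto simp: min_def)
      then show "cnj (g (\<sigma> j)) * (\<langle>E (min t s) x, E (q (Suc j)) y\<rangle>\<^bsub>K\<^esub> - \<langle>E (min t s) x, E (q j) y\<rangle>\<^bsub>K\<^esub>)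
          = cnj (g (\<sigma> j)) * (?e (min s (q (Suc j))) - ?e (min s (q j)))"
        using x y by (simp add: sprod_E_E min.assoc)
    qed
    finally show ?thesis .
  qed
  have "\<langle>E t ?A, ?B\<rangle>\<^bsub>K\<^esub> = \<langle>?A, E t ?B\<rangle>\<^bsub>K\<^esub>"
    using A B t by (simp add: E_self_adjoint)
  also have "\<dots> = (\<Sum>i<m. f (\<tau> i) * (\<langle>E (p (Suc i)) x, E t ?B\<rangle>\<^bsub>K\<^esub> - \<langle>E (p i) x, E t ?B\<rangle>\<^bsub>K\<^esub>))"
    using t x B pI by (intro sprod_rs_sum_left) auto
  also have "\<dots> = (\<Sum>i<m. \<Sum>j<n. f (\<tau> i) * cnj (g (\<sigma> j)) * overlap ?e (p i) (p (Suc i)) (q j) (q (Suc j)))"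
  proof (rule sum.cong[OF refl])
    fix i assume "i \<in> {..<m}"
    then have pi: "p i \<in> {0..2 * pi}" "p (Suc i) \<in> {0..2 * pi}"
      using pI[of i] pI[of "Suc i"] by auto
    show "f (\<tau> i) * (\<langle>E (p (Suc i)) x, E t ?B\<rangle>\<^bsub>K\<^esub> - \<langle>E (p i) x, E t ?B\<rangle>\<^bsub>K\<^esub>) =
        (\<Sum>j<n. f (\<tau> i) * cnj (g (\<sigma> j)) * overlap ?e (p i) (p (Suc i)) (q j) (q (Suc j)))"
      unfolding inner[OF pi(1)] inner[OF pi(2)]
      by (simp only: sum_subtractf[symmetric] sum_distrib_left overlap_def) (simp add: algebra_simps)
  qed
  finally show ?thesis .
qed

lemma sprod_E_rs_sum_same:
  assumes p: "tagged_partition \<delta> m p \<tau>" and t: "t \<in> {0..2 * pi}" and x: "x \<in> carrier K" and y: "y \<in> carrier K"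
  shows "\<langle>E t (rs_sum K f E m p \<tau> x), rs_sum K g E m p \<tau> y\<rangle>\<^bsub>K\<^esub> =
    (\<Sum>i<m. f (\<tau> i) * cnj (g (\<tau> i)) * (\<langle>E (min t (p (Suc i))) x, y\<rangle>\<^bsub>K\<^esub> - \<langle>E (min t (p i)) x, y\<rangle>\<^bsub>K\<^esub>))"
  unfolding sprod_E_rs_sum[OF p p t x y] by (rule sum_overlap_diagonal[OF p])

text \<open>For t = 2 pi and equal vectors the weights are masses of the real non-decreasing
  function with value \<open>(hnorm K (E s x))\<^sup>2\<close> at s, so that sums can be estimated
  termwise.\<close>

lemma sprod_rs_sum_rs_sum:
  assumes p: "tagged_partition \<delta> m p \<tau>" and q: "tagged_partition \<delta>' n q \<sigma>" and x: "x \<in> carrier K"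
  shows "Re \<langle>rs_sum K f E m p \<tau> x, rs_sum K g E n q \<sigma> x\<rangle>\<^bsub>K\<^esub> =
    (\<Sum>i<m. \<Sum>j<n. Re (f (\<tau> i) * cnj (g (\<sigma> j))) *
      overlap (\<lambda>s. (hnorm K (E s x))\<^sup>2) (p i) (p (Suc i)) (q j) (q (Suc j)))"
proof -
  have eq: "overlap (\<lambda>s. \<langle>E (min (2 * pi) s) x, x\<rangle>\<^bsub>K\<^esub>) (p i) (p (Suc i)) (q j) (q (Suc j)) =
      of_real (overlap (\<lambda>s. (hnorm K (E s x))\<^sup>2) (p i) (p (Suc i)) (q j) (q (Suc j)))"
    if "i < m" "j < n" for i j
  proof -
    have "\<langle>E (min (2 * pi) (min s r)) x, x\<rangle>\<^bsub>K\<^esub> = of_real ((hnorm K (E (min s r) x))\<^sup>2)"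
      if "s \<in> {0..2 * pi}" "r \<in> {0..2 * pi}" for s r
    proof -
      have "min s r \<in> {0..2 * pi}" "min (2 * pi) (min s r) = min s r"
        using that by (auto simp: min_def)
      then show ?thesis
        using x sprod_E_self by simp
    qed
    then show ?thesis
      using tagged_partition_range[OF p] tagged_partition_range[OF q] that
      by (simp add: overlap_def del: of_real_power)
  qed
  have "\<langle>rs_sum K f E m p \<tau> x, rs_sum K g E n q \<sigma> x\<rangle>\<^bsub>K\<^esub> =
     (\<Sum>i<m. \<Sum>j<n. f (\<tau> i) * cnj (g (\<sigma> j)) *
      overlap (\<lambda>s. \<langle>E (min (2 * pi) s) x, x\<rangle>\<^bsub>K\<^esub>) (p i) (p (Suc i)) (q j) (q (Suc j)))"
    using sprod_E_rs_sum[OF p q, of "2 * pi" x x f g] x rs_sum_E_carrier[OF p x] by (simp add: E_2pi)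
  also have "\<dots> = (\<Sum>i<m. \<Sum>j<n. f (\<tau> i) * cnj (g (\<sigma> j)) *
      of_real (overlap (\<lambda>s. (hnorm K (E s x))\<^sup>2) (p i) (p (Suc i)) (q j) (q (Suc j))))"
    by (intro sum.cong refl) (simp add: eq)
  finally show ?thesis
    by (simp add: Re_sum)
qed

text \<open>
  Two Riemann--Stieltjes sums are compared without a common refinement: \<open>overlap\<close> plays the role
  of the mass of the intersection of the \<open>i\<close>-th and the \<open>j\<close>-th interval.
\<close>

lemma hdist_rs_sum_le:
  assumes p: "tagged_partition \<delta> m p \<tau>" and q: "tagged_partition \<delta>' n q \<sigma>" and x: "x \<in> carrier K"
    and L: "L \<ge> 0" and lip: "\<And>s t. \<lbrakk>s \<in> {0..2 * pi}; t \<in> {0..2 * pi}\<rbrakk> \<Longrightarrow> cmod (f s - f t) \<le> L * \<bar>s - t\<bar>"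
    and \<delta>: "\<delta> \<ge> 0" "\<delta>' \<ge> 0"
  shows "hdist K (rs_sum K f E m p \<tau> x) (rs_sum K f E n q \<sigma> x) \<le> L * (\<delta> + \<delta>') * hnorm K x"
proof -
  let ?A = "rs_sum K f E m p \<tau> x" and ?B = "rs_sum K f E n q \<sigma> x"
  define r where "r s = (hnorm K (E s x))\<^sup>2" for s
  define Q where "Q i j = overlap r (p i) (p (Suc i)) (q j) (q (Suc j))" for i j
  have r0: "r 0 = 0" and r2pi: "r (2 * pi) = (hnorm K x)\<^sup>2"
    using x by (simp_all add: r_def E_0 E_2pi)
  have r_mono: "r s \<le> r t" if "s \<in> {0..2 * pi}" "t \<in> {0..2 * pi}" "s \<le> t" for s t
    unfolding r_def using that x by (rule hnorm_E_mono)
  have A: "?A \<in> carrier K" and B: "?B \<in> carrier K"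
    using p q x by (auto intro: rs_sum_E_carrier)
  have pI: "p i \<in> {0..2 * pi}" "p (Suc i) \<in> {0..2 * pi}" "p i \<le> p (Suc i)" if "i < m" for i
    using that tagged_partition_range[OF p] tagged_partition_mono[OF p, of i "Suc i"] by auto
  have qI: "q j \<in> {0..2 * pi}" "q (Suc j) \<in> {0..2 * pi}" "q j \<le> q (Suc j)" if "j < n" for j
    using that tagged_partition_range[OF q] tagged_partition_mono[OF q, of j "Suc j"] by auto
  have self: "Re \<langle>rs_sum K f E m p \<tau> x, rs_sum K f E m p \<tau> x\<rangle>\<^bsub>K\<^esub> =
      (\<Sum>i<m. (cmod (f (\<tau> i)))\<^sup>2 * (r (p (Suc i)) - r (p i)))"
    if p: "tagged_partition \<delta> m p \<tau>" for \<delta> m p \<tau>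
  proof -
    have "of_real (\<Sum>i<m. \<Sum>j<m. Re (f (\<tau> i) * cnj (f (\<tau> j))) * overlap r (p i) (p (Suc i)) (p j) (p (Suc j))) =
        (\<Sum>i<m. \<Sum>j<m. of_real (Re (f (\<tau> i) * cnj (f (\<tau> j)))) *
          overlap (\<lambda>s. complex_of_real (r s)) (p i) (p (Suc i)) (p j) (p (Suc j)))"
      by (simp add: overlap_of_real)
    also have "\<dots> = (\<Sum>i<m. of_real (Re (f (\<tau> i) * cnj (f (\<tau> i)))) * (of_real (r (p (Suc i))) - of_real (r (p i))))"
      by (rule sum_overlap_diagonal[OF p])
    also have "\<dots> = of_real (\<Sum>i<m. (cmod (f (\<tau> i)))\<^sup>2 * (r (p (Suc i)) - r (p i)))"
    proof -
      have "Re (z * cnj z) = (cmod z)\<^sup>2" for z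
        unfolding cmod_power2 by (simp add: power2_eq_square)
      then show ?thesis
        by (simp only: of_real_sum of_real_mult of_real_diff)
    qed
    finally show ?thesis
      unfolding sprod_rs_sum_rs_sum[OF p p x] r_def[symmetric] of_real_eq_iff .
  qed
  \<comment> \<open>Q is a coupling of the two partitions: its row and column sums are the masses of
    their cells.\<close>
  have sumQ: "(\<Sum>j<n. Q i j) = r (p (Suc i)) - r (p i)" if "i < m" for i
    unfolding Q_def using pI[OF that] r0 by (intro sum_overlap[OF q])
  have sumQ': "(\<Sum>i<m. Q i j) = r (q (Suc j)) - r (q j)" if "j < n" for j
    unfolding Q_def overlap_commute[of r _ _ "q j"] using qI[OF that] r0 by (intro sum_overlap[OF p])
  \<comment> \<open>Both norms are spread over the coupling, so that the three terms of the squared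
    distance combine into one double sum.\<close>
  have AA: "(hnorm K ?A)\<^sup>2 = (\<Sum>i<m. \<Sum>j<n. (cmod (f (\<tau> i)))\<^sup>2 * Q i j)"
    using A by (simp add: hnorm_power2 self[OF p] sumQ flip: sum_distrib_left)
  have BB: "(hnorm K ?B)\<^sup>2 = (\<Sum>i<m. \<Sum>j<n. (cmod (f (\<sigma> j)))\<^sup>2 * Q i j)"
    using B by (subst sum.swap) (simp add: hnorm_power2 self[OF q] sumQ' flip: sum_distrib_left)
  have AB: "Re \<langle>?A, ?B\<rangle>\<^bsub>K\<^esub> = (\<Sum>i<m. \<Sum>j<n. Re (f (\<tau> i) * cnj (f (\<sigma> j))) * Q i j)"
    unfolding Q_def r_def[abs_def] by (rule sprod_rs_sum_rs_sum[OF p q x])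
  have "(hdist K ?A ?B)\<^sup>2 = (\<Sum>i<m. \<Sum>j<n. (cmod (f (\<tau> i) - f (\<sigma> j)))\<^sup>2 * Q i j)"
  proof -
    have "(cmod (f (\<tau> i) - f (\<sigma> j)))\<^sup>2 * Q i j = (cmod (f (\<tau> i)))\<^sup>2 * Q i j
        - 2 * (Re (f (\<tau> i) * cnj (f (\<sigma> j))) * Q i j) + (cmod (f (\<sigma> j)))\<^sup>2 * Q i j" for i j
      unfolding cmod_power2 by (simp add: power2_eq_square algebra_simps)
    then show ?thesis
      using A B by (simp add: hdist_power2 AA BB AB sum.distrib sum_subtractf sum_distrib_left)
  qed
  also have "\<dots> \<le> (\<Sum>i<m. \<Sum>j<n. (L * (\<delta> + \<delta>'))\<^sup>2 * Q i j)"
  proof (intro sum_mono)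
    fix i j assume "i \<in> {..<m}" "j \<in> {..<n}"
    then have i: "i < m" and j: "j < n" by auto
    have Q_nonneg: "0 \<le> Q i j"
      unfolding Q_def using pI[OF i] qI[OF j] r_mono by (intro overlap_nonneg[where I="{0..2 * pi}"]) auto
    have tags: "\<tau> i \<in> {p i..p (Suc i)}" "p (Suc i) - p i < \<delta>" "\<sigma> j \<in> {q j..q (Suc j)}" "q (Suc j) - q j < \<delta>'"
      using p q i j by (auto simp: tagged_partition_def)
    show "(cmod (f (\<tau> i) - f (\<sigma> j)))\<^sup>2 * Q i j \<le> (L * (\<delta> + \<delta>'))\<^sup>2 * Q i j"
    proof (cases "p (Suc i) \<le> q j \<or> q (Suc j) \<le> p i")
      case True
      then have "Q i j = 0"
        unfolding Q_def using pI[OF i] qI[OF j] by (intro overlap_disjoint) auto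
      then show ?thesis by simp
    next
      case False
      \<comment> \<open>Cells that meet have tags no further apart than the sum of the
        meshes.\<close>
      then have "\<bar>\<tau> i - \<sigma> j\<bar> \<le> \<delta> + \<delta>'"
        using tags by auto
      moreover have "\<tau> i \<in> {0..2 * pi}" "\<sigma> j \<in> {0..2 * pi}"
        using tags pI[OF i] qI[OF j] by auto
      ultimately have "cmod (f (\<tau> i) - f (\<sigma> j)) \<le> L * (\<delta> + \<delta>')"
        using lip[of "\<tau> i" "\<sigma> j"] mult_left_mono[OF _ L] by (meson order_trans)
      then show ?thesis
        using Q_nonneg by (intro mult_right_mono power_mono) auto
    qed
  qed
  also have "\<dots> = (L * (\<delta> + \<delta>'))\<^sup>2 * (\<Sum>i<m. r (p (Suc i)) - r (p i))"
    by (simp add: sumQ flip: sum_distrib_left)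
  also have "(\<Sum>i<m. r (p (Suc i)) - r (p i)) = (hnorm K x)\<^sup>2"
    using p r0 r2pi by (subst sum_lessThan_telescope) (simp add: tagged_partition_def)
  finally have "(hdist K ?A ?B)\<^sup>2 \<le> (L * (\<delta> + \<delta>') * hnorm K x)\<^sup>2"
    by (simp add: power_mult_distrib)
  moreover have "0 \<le> L * (\<delta> + \<delta>') * hnorm K x"
    using L \<delta> x by simp
  ultimately show ?thesis
    by (rule power2_le_imp_le)
qed

text \<open>Exponents are arbitrary integers because the adjoint of the n-th power has exponent
  -n.\<close>

definition approx :: "int \<Rightarrow> nat \<Rightarrow> 'k \<Rightarrow> 'k" where
  "approx n N = rs_sum K (\<lambda>t. cis (of_int n * t)) E (Suc N) (uniform_partition N) (uniform_partition N)"

text \<open>The n-th power of the unitary operator with resolution E, obtained directly as the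
  integral of \<open>cis (n * t)\<close>; \<open>spectral_power 1\<close> is that operator itself.
  The limit is strong, hence taken at each vector.\<close>

definition spectral_power :: "int \<Rightarrow> 'k \<Rightarrow> 'k" where
  "spectral_power n = (\<lambda>x\<in>carrier K. THE w. w \<in> carrier K \<and> hlim K (\<lambda>N. approx n N x) w)"

lemma approx_carrier [simp, intro]: "x \<in> carrier K \<Longrightarrow> approx n N x \<in> carrier K"
  unfolding approx_def by (rule rs_sum_E_carrier[OF tagged_uniform_partition_8])

lemma trig_lipschitz: "cmod (cis (of_int n * s) - cis (of_int n * t)) \<le> \<bar>of_int n\<bar> * \<bar>s - t\<bar>"
  using cmod_cis_diff_le[of "of_int n * s" "of_int n * t"] by (simp add: abs_mult flip: right_diff_distrib)

lemma hdist_approx_le: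
  assumes p: "tagged_partition \<delta> m p \<tau>" and x: "x \<in> carrier K" and \<delta>: "\<delta> \<ge> 0"
  shows "hdist K (rs_sum K (\<lambda>t. cis (of_int n * t)) E m p \<tau> x) (approx n N x)
    \<le> \<bar>of_int n\<bar> * (\<delta> + 8 / real (Suc N)) * hnorm K x"
  unfolding approx_def
proof (rule hdist_rs_sum_le[OF p tagged_uniform_partition_8 x _ trig_lipschitz \<delta>])
  show "0 \<le> 8 / real (Suc N)" by simp
qed simp

lemma approx_Cauchy:
  assumes x: "x \<in> carrier K"
  shows "hCauchy K (\<lambda>N. approx n N x)"
  unfolding hCauchy_def
proof (intro allI impI)
  fix e :: real assume e: "e > 0"
  define C where "C = \<bar>of_int n\<bar> * hnorm K x"
  have "C \<ge> 0"
    using x by (simp add: C_def)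
  have "(\<lambda>N. C * (8 / real (Suc N))) \<longlonglongrightarrow> 0"
    by (rule tendsto_mult_right_zero[OF uniform_mesh_tendsto])
  then have "\<forall>\<^sub>F N in sequentially. C * (8 / real (Suc N)) < e / 2"
    using e by (intro order_tendstoD(2)[of _ 0]) auto
  then obtain N0 where N0: "\<And>N. N \<ge> N0 \<Longrightarrow> C * (8 / real (Suc N)) < e / 2"
    by (auto simp: eventually_sequentially)
  have "hdist K (approx n M x) (approx n N x) < e" if "M \<ge> N0" "N \<ge> N0" for M N
  proof -
    have "hdist K (approx n M x) (approx n N x) \<le> \<bar>of_int n\<bar> * (8 / real (Suc M) + 8 / real (Suc N)) * hnorm K x"
      using hdist_approx_le[OF tagged_uniform_partition_8 x, of M n N] by (simp add: approx_def)
    also have "\<dots> = C * (8 / real (Suc M)) + C * (8 / real (Suc N))"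
      by (simp add: C_def algebra_simps)
    also have "\<dots> < e"
      using N0[OF that(1)] N0[OF that(2)] by linarith
    finally show ?thesis .
  qed
  then show "\<exists>N0. \<forall>M\<ge>N0. \<forall>N\<ge>N0. hdist K (approx n M x) (approx n N x) < e"
    by blast
qed

lemma
  assumes x: "x \<in> carrier K"
  shows spectral_power_carrier [simp, intro]: "spectral_power n x \<in> carrier K"
    and approx_hlim: "hlim K (\<lambda>N. approx n N x) (spectral_power n x)"
proof -
  have range: "range (\<lambda>N. approx n N x) \<subseteq> carrier K"
    using x by auto
  obtain w where w: "w \<in> carrier K" "hlim K (\<lambda>N. approx n N x) w"
    using complete[OF range approx_Cauchy[OF x]] by blast
  have "(THE w. w \<in> carrier K \<and> hlim K (\<lambda>N. approx n N x) w) = w"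
    using w hlim_unique[OF range] by (intro the_equality) auto
  then have "spectral_power n x = w"
    using x by (simp add: spectral_power_def)
  with w show "spectral_power n x \<in> carrier K" "hlim K (\<lambda>N. approx n N x) (spectral_power n x)"
    by simp_all
qed

text \<open>The limit was defined along uniform partitions. An arbitrary fine partition is compared
  with the N-th uniform one, and letting N grow removes the uniform mesh from the bound.\<close>

lemma spectral_power_has_integral: "has_strong_integral K (\<lambda>t. cis (of_int n * t)) E (spectral_power n)"
  unfolding has_strong_integral_def
proof (intro ballI allI impI)
  fix x and \<epsilon> :: real assume x: "x \<in> carrier K" and \<epsilon>: "\<epsilon> > 0"
  define C where "C = \<bar>of_int n\<bar> * hnorm K x"
  have C: "C \<ge> 0"
    using x by (simp add: C_def)
  \<comment> \<open>C may be zero, so the divisor is C + 1, which also makes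
    \<open>C * \<delta> < \<epsilon>\<close> strict.\<close>
  define \<delta> where "\<delta> = \<epsilon> / (C + 1)"
  have \<delta>: "\<delta> > 0" "C * \<delta> < \<epsilon>"
    using C \<epsilon> by (auto simp: \<delta>_def field_simps)
  have "hdist K (rs_sum K (\<lambda>t. cis (of_int n * t)) E m p \<tau> x) (spectral_power n x) < \<epsilon>"
    if p: "tagged_partition \<delta> m p \<tau>" for m p \<tau>
  proof -
    let ?R = "rs_sum K (\<lambda>t. cis (of_int n * t)) E m p \<tau> x"
    have R: "?R \<in> carrier K"
      by (rule rs_sum_E_carrier[OF p x])
    have "hdist K ?R (spectral_power n x) \<le>
        C * \<delta> + C * (8 / real (Suc N)) + hdist K (approx n N x) (spectral_power n x)" for N
      using hdist_triangle[OF R approx_carrier[OF x, of n N] spectral_power_carrier[OF x, of n]]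
        hdist_approx_le[OF p x, of n N] \<delta>(1)
      by (simp add: C_def algebra_simps)
    moreover have "(\<lambda>N. C * \<delta> + C * (8 / real (Suc N)) + hdist K (approx n N x) (spectral_power n x))
        \<longlonglongrightarrow> C * \<delta> + C * 0 + 0"
      using approx_hlim[OF x] unfolding hlim_def by (intro tendsto_intros uniform_mesh_tendsto)
    ultimately have "hdist K ?R (spectral_power n x) \<le> C * \<delta> + C * 0 + 0"
      by (intro LIMSEQ_le_const) auto
    then show ?thesis
      using \<delta>(2) by simp
  qed
  with \<delta>(1) show "\<exists>\<delta>>0. \<forall>m p \<tau>. tagged_partition \<delta> m p \<tau> \<longrightarrow>
      hdist K (rs_sum K (\<lambda>t. cis (of_int n * t)) E m p \<tau> x) (spectral_power n x) < \<epsilon>"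
    by blast
qed

text \<open>An extension U is known only through its integral; uniqueness of limits along uniform
  partitions identifies it with a power.\<close>

lemma has_strong_integral_eq_spectral_power:
  assumes "has_strong_integral K (\<lambda>t. cis (of_int n * t)) E U" "x \<in> carrier K" "U x \<in> carrier K"
  shows "U x = spectral_power n x"
proof (rule hlim_unique)
  show "hlim K (\<lambda>N. approx n N x) (U x)"
    using has_strong_integral_hlim[OF _ assms(1,2,3)] assms(2) semi_inner_product_space_axioms
    unfolding approx_def by auto
  show "hlim K (\<lambda>N. approx n N x) (spectral_power n x)"
    by (rule approx_hlim[OF assms(2)])
qed (use assms in auto)

lemma sprod_approx_left:
  assumes "x \<in> carrier K" "y \<in> carrier K"
  shows "\<langle>approx n N x, y\<rangle>\<^bsub>K\<^esub> = (\<Sum>i<Suc N. cis (of_int n * uniform_partition N i) *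
    (\<langle>E (uniform_partition N (Suc i)) x, y\<rangle>\<^bsub>K\<^esub> - \<langle>E (uniform_partition N i) x, y\<rangle>\<^bsub>K\<^esub>))"
  unfolding approx_def using assms tagged_partition_range[OF tagged_uniform_partition_8]
  by (intro sprod_rs_sum_left) auto

lemma sprod_spectral_power_left:
  "\<lbrakk>x \<in> carrier K; y \<in> carrier K\<rbrakk> \<Longrightarrow> (\<lambda>N. \<langle>approx n N x, y\<rangle>\<^bsub>K\<^esub>) \<longlonglongrightarrow> \<langle>spectral_power n x, y\<rangle>\<^bsub>K\<^esub>"
  by (intro hlim_sprod_left approx_hlim) auto

text \<open>On a common partition the two exponentials at one tag multiply to exponent m - n, and
  the limit is taken in both factors at once. The left side involves only the distribution function
  of x and y, truncated at t; the uniqueness argument rests on this.\<close>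

lemma sprod_E_spectral_power:
  assumes t: "t \<in> {0..2 * pi}" and x: "x \<in> carrier K" and y: "y \<in> carrier K"
  shows "(\<lambda>N. \<Sum>i<Suc N. cis (of_int (m - n) * uniform_partition N i) *
      (\<langle>E (min t (uniform_partition N (Suc i))) x, y\<rangle>\<^bsub>K\<^esub> - \<langle>E (min t (uniform_partition N i)) x, y\<rangle>\<^bsub>K\<^esub>))
    \<longlonglongrightarrow> \<langle>E t (spectral_power m x), spectral_power n y\<rangle>\<^bsub>K\<^esub>"
proof -
  have "hlim K (\<lambda>N. E t (approx m N x)) (E t (spectral_power m x))"
    by (rule hlim_bounded_op[OF semi_inner_product_space_axioms semi_inner_product_space_axioms
          E_bounded_ops[OF t] _ spectral_power_carrier[OF x] approx_hlim[OF x]]) (use x in auto)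
  then have "(\<lambda>N. \<langle>E t (approx m N x), approx n N y\<rangle>\<^bsub>K\<^esub>) \<longlonglongrightarrow> \<langle>E t (spectral_power m x), spectral_power n y\<rangle>\<^bsub>K\<^esub>"
    using t x y by (intro hlim_sprod approx_hlim) auto
  moreover have "\<langle>E t (approx m N x), approx n N y\<rangle>\<^bsub>K\<^esub> =
      (\<Sum>i<Suc N. cis (of_int (m - n) * uniform_partition N i) *
      (\<langle>E (min t (uniform_partition N (Suc i))) x, y\<rangle>\<^bsub>K\<^esub> - \<langle>E (min t (uniform_partition N i)) x, y\<rangle>\<^bsub>K\<^esub>))" for N
    unfolding approx_def sprod_E_rs_sum_same[OF tagged_uniform_partition_8 t x y]
    by (simp add: cis_cnj cis_mult algebra_simps)
  ultimately show ?thesis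
    by simp
qed

text \<open>At t = 2 pi the truncation disappears. The isometry, adjoint and composition laws of the
  powers all follow from this identity and the case of exponent 0.\<close>

lemma sprod_spectral_power:
  assumes x: "x \<in> carrier K" and y: "y \<in> carrier K"
  shows "\<langle>spectral_power m x, spectral_power n y\<rangle>\<^bsub>K\<^esub> = \<langle>spectral_power (m - n) x, y\<rangle>\<^bsub>K\<^esub>"
proof (rule LIMSEQ_unique)
  show "(\<lambda>N. \<langle>approx (m - n) N x, y\<rangle>\<^bsub>K\<^esub>) \<longlonglongrightarrow> \<langle>spectral_power (m - n) x, y\<rangle>\<^bsub>K\<^esub>"
    using x y by (rule sprod_spectral_power_left)
  have "min (2 * pi) (uniform_partition N i) = uniform_partition N i" if "i \<le> Suc N" for N i
    using tagged_partition_range[OF tagged_uniform_partition_8 that] by (simp add: min_def)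
  then have "\<langle>approx (m - n) N x, y\<rangle>\<^bsub>K\<^esub> = (\<Sum>i<Suc N. cis (of_int (m - n) * uniform_partition N i) *
      (\<langle>E (min (2 * pi) (uniform_partition N (Suc i))) x, y\<rangle>\<^bsub>K\<^esub> - \<langle>E (min (2 * pi) (uniform_partition N i)) x, y\<rangle>\<^bsub>K\<^esub>))" for N
    unfolding sprod_approx_left[OF x y] by (intro sum.cong) auto
  then show "(\<lambda>N. \<langle>approx (m - n) N x, y\<rangle>\<^bsub>K\<^esub>) \<longlonglongrightarrow> \<langle>spectral_power m x, spectral_power n y\<rangle>\<^bsub>K\<^esub>"
    using sprod_E_spectral_power[of "2 * pi" x y m n] x y by (simp add: E_2pi)
qed

lemma spectral_power_0: "x \<in> carrier K \<Longrightarrow> spectral_power 0 x = x"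
proof (rule vec_eqI)
  fix y assume x: "x \<in> carrier K" and y: "y \<in> carrier K"
  \<comment> \<open>All weights are 1, so the sum telescopes from \<open>E 0\<close>, which is zero,
    to \<open>E (2 * pi)\<close>, the identity.\<close>
  have "\<langle>approx 0 N x, y\<rangle>\<^bsub>K\<^esub> = \<langle>x, y\<rangle>\<^bsub>K\<^esub>" for N
  proof -
    have "\<langle>approx 0 N x, y\<rangle>\<^bsub>K\<^esub> = (\<Sum>i<Suc N. \<langle>E (uniform_partition N (Suc i)) x, y\<rangle>\<^bsub>K\<^esub> - \<langle>E (uniform_partition N i) x, y\<rangle>\<^bsub>K\<^esub>)"
      unfolding sprod_approx_left[OF x y] by simp
    also have "\<dots> = \<langle>E (uniform_partition N (Suc N)) x, y\<rangle>\<^bsub>K\<^esub> - \<langle>E (uniform_partition N 0) x, y\<rangle>\<^bsub>K\<^esub>"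
      by (rule sum_lessThan_telescope)
    finally show ?thesis
      using x y by (simp add: uniform_partition_def E_0 E_2pi)
  qed
  then show "\<langle>spectral_power 0 x, y\<rangle>\<^bsub>K\<^esub> = \<langle>x, y\<rangle>\<^bsub>K\<^esub>"
    using sprod_spectral_power_left[OF x y, of 0] LIMSEQ_unique[OF _ tendsto_const] by simp
qed auto

lemma spectral_power_adjoint:
  assumes "x \<in> carrier K" "y \<in> carrier K"
  shows "\<langle>spectral_power n x, y\<rangle>\<^bsub>K\<^esub> = \<langle>x, spectral_power (- n) y\<rangle>\<^bsub>K\<^esub>"
  using sprod_spectral_power[of x y 0 "- n"] assms by (simp add: spectral_power_0)

lemma spectral_power_compose:
  assumes x: "x \<in> carrier K"
  shows "spectral_power m (spectral_power n x) = spectral_power (m + n) x"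
proof (rule vec_eqI)
  fix y assume y: "y \<in> carrier K"
  show "\<langle>spectral_power m (spectral_power n x), y\<rangle>\<^bsub>K\<^esub> = \<langle>spectral_power (m + n) x, y\<rangle>\<^bsub>K\<^esub>"
    using x y by (simp add: spectral_power_adjoint[of "spectral_power n x"] sprod_spectral_power add.commute)
qed (use x in auto)

lemma spectral_power_isometry: "spectral_power n \<in> isometries K K"
proof -
  have sprod: "\<langle>spectral_power n x, spectral_power n y\<rangle>\<^bsub>K\<^esub> = \<langle>x, y\<rangle>\<^bsub>K\<^esub>"
    if "x \<in> carrier K" "y \<in> carrier K" for x y
    using that by (simp add: sprod_spectral_power spectral_power_0)
  have "spectral_power n (x \<oplus>\<^bsub>K\<^esub> y) = spectral_power n x \<oplus>\<^bsub>K\<^esub> spectral_power n y"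
    if "x \<in> carrier K" "y \<in> carrier K" for x y
    using that by (intro vec_eqI) (auto simp: spectral_power_adjoint sprod_linear)
  moreover have "spectral_power n (a \<odot>\<^bsub>K\<^esub> x) = a \<odot>\<^bsub>K\<^esub> spectral_power n x" if "x \<in> carrier K" for x a
    using that by (intro vec_eqI) (auto simp: spectral_power_adjoint sprod_linear)
  moreover have "\<exists>C. \<forall>x\<in>carrier K. hnorm K (spectral_power n x) \<le> C * hnorm K x"
    using sprod by (intro exI[of _ 1]) (simp add: hnorm_def)
  moreover have "spectral_power n \<in> carrier K \<rightarrow>\<^sub>E carrier K"
    by (auto simp: PiE_def) (simp add: spectral_power_def)
  ultimately show ?thesis
    using sprod by (simp add: isometries_def bounded_ops_def)
qed

lemma spectral_power_unitary: "spectral_power n \<in> unitary_ops K"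
proof -
  have "carrier K \<subseteq> spectral_power n ` carrier K"
  proof
    fix x assume x: "x \<in> carrier K"
    then have "x = spectral_power n (spectral_power (- n) x)"
      by (simp add: spectral_power_compose spectral_power_0)
    with x show "x \<in> spectral_power n ` carrier K"
      by blast
  qed
  then show ?thesis
    using spectral_power_isometry[of n] by (auto simp: unitary_ops_def)
qed

end

section \<open>Compressions\<close>

lemma isometriesD:
  assumes "J \<in> isometries X Y"
  shows "J \<in> bounded_ops X Y"
    and "\<lbrakk>x \<in> carrier X; y \<in> carrier X\<rbrakk> \<Longrightarrow> \<langle>J x, J y\<rangle>\<^bsub>Y\<^esub> = \<langle>x, y\<rangle>\<^bsub>X\<^esub>"
  using assms by (auto simp: isometries_def)

lemma isometry_hdist:
  assumes X: "semi_inner_product_space X" and Y: "semi_inner_product_space Y" and J: "J \<in> isometries X Y"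
    and x: "x \<in> carrier X" and y: "y \<in> carrier X"
  shows "hdist Y (J x) (J y) = hdist X x y"
proof -
  interpret X: semi_inner_product_space X by fact
  interpret Y: semi_inner_product_space Y by fact
  have "J x \<ominus>\<^bsub>Y\<^esub> J y = J (x \<ominus>\<^bsub>X\<^esub> y)"
    using bounded_ops_minus[OF X Y isometriesD(1)[OF J] x y] by simp
  then show ?thesis
    using x y isometriesD(2)[OF J, of "x \<ominus>\<^bsub>X\<^esub> y" "x \<ominus>\<^bsub>X\<^esub> y"] by (simp add: hdist_def hnorm_def)
qed

text \<open>The preimages of a convergent sequence in the range are Cauchy because distances are
  preserved, so completeness of X provides a preimage of the limit.\<close>

lemma closed_subspace_range_isometry:
  assumes X: "hilbert_space X" and Y: "hilbert_space Y" and J: "J \<in> isometries X Y"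
  shows "closed_subspace Y (J ` carrier X)"
proof -
  interpret X: hilbert_space X by fact
  interpret Y: hilbert_space Y by fact
  have sip: "semi_inner_product_space X" "semi_inner_product_space Y" by unfold_locales
  note J_ops = isometriesD(1)[OF J] and J_dist = isometry_hdist[OF sip J]
  note JD = bounded_opsD[OF J_ops]
  show ?thesis
    unfolding closed_subspace_def
  proof (intro conjI allI impI ballI)
    show "J ` carrier X \<subseteq> carrier Y"
      using JD(1) by blast
    show "\<zero>\<^bsub>Y\<^esub> \<in> J ` carrier X"
      using bounded_ops_zero[OF sip J_ops] by (metis X.M.zero_closed image_eqI)
  next
    fix u w assume "u \<in> J ` carrier X" "w \<in> J ` carrier X"
    then show "u \<oplus>\<^bsub>Y\<^esub> w \<in> J ` carrier X"
      using JD(2)[symmetric] by (auto intro!: imageI)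
  next
    fix a u assume "u \<in> J ` carrier X"
    then show "a \<odot>\<^bsub>Y\<^esub> u \<in> J ` carrier X"
      using JD(3)[symmetric] by (auto intro!: imageI)
  next
    fix s w assume s: "range s \<subseteq> J ` carrier X" and w: "w \<in> carrier Y" and lim: "hlim Y s w"
    have "\<forall>n. \<exists>x\<in>carrier X. s n = J x"
      using s by auto
    then obtain u where u: "\<And>n. u n \<in> carrier X" "\<And>n. s n = J (u n)"
      by metis
    have s_carrier: "range s \<subseteq> carrier Y"
      using u JD(1) by auto
    have "hCauchy X u"
      using Y.hlim_imp_hCauchy[OF s_carrier w lim] u J_dist by (simp add: hCauchy_def)
    then obtain x where x: "x \<in> carrier X" "hlim X u x"
      using X.complete[of u] u(1) by blast
    have "hlim Y s (J x)"
      using x u J_dist by (simp add: hlim_def)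
    then have "w = J x"
      using Y.hlim_unique[OF s_carrier w _ lim] JD(1) x by blast
    then show "w \<in> J ` carrier X"
      using x by blast
  qed
qed

text \<open>For an isometry, \<open>J\<close> after its adjoint is the orthogonal projection onto
  the range, so undoing \<open>J\<close> leaves the adjoint alone. In this form the compression
  inherits the scalar-product rules of adjoints.\<close>

lemma compression_eq_adjoint:
  assumes X: "hilbert_space X" and Y: "hilbert_space Y" and J: "J \<in> isometries X Y" and T: "T \<in> bounded_ops Y Y"
  shows "compression X Y J T = (\<lambda>x\<in>carrier X. adjoint_op X Y J (T (J x)))"
  unfolding compression_def
proof (rule restrict_ext)
  fix x assume x: "x \<in> carrier X"
  interpret X: hilbert_space X by fact
  interpret Y: hilbert_space Y by fact
  have sip: "semi_inner_product_space X" "semi_inner_product_space Y" by unfold_locales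
  note J_ops = isometriesD(1)[OF J] and J_dist = isometry_hdist[OF sip J]
  let ?y = "T (J x)"
  have y: "?y \<in> carrier Y"
    using x by (intro bounded_opsD(1)[OF T] bounded_opsD(1)[OF J_ops])
  have adj: "adjoint_op X Y J ?y \<in> carrier X"
    by (rule adjoint_op_carrier[OF X Y J_ops y])
  have "orth_proj Y (J ` carrier X) ?y = J (adjoint_op X Y J ?y)"
  proof (rule Y.orth_proj_eqI[OF closed_subspace_range_isometry[OF X Y J] y])
    fix m assume "m \<in> J ` carrier X"
    then show "\<langle>J (adjoint_op X Y J ?y), m\<rangle>\<^bsub>Y\<^esub> = \<langle>?y, m\<rangle>\<^bsub>Y\<^esub>"
      using adj y isometriesD(2)[OF J] by (auto simp: sprod_adjoint_op_left[OF X Y J_ops])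
  qed (use adj in blast)
  moreover have "inj_on J (carrier X)"
  proof (rule inj_onI)
    fix u w assume "u \<in> carrier X" "w \<in> carrier X" "J u = J w"
    then show "u = w"
      using J_dist[of u w] bounded_opsD(1)[OF J_ops, of w] by (intro X.hdist_eq_0) auto
  qed
  ultimately show "the_inv_into (carrier X) J (orth_proj Y (J ` carrier X) ?y) = adjoint_op X Y J ?y"
    using adj by (simp add: the_inv_into_f_f)
qed

lemma compression_bounded_ops:
  assumes X: "hilbert_space X" and Y: "hilbert_space Y" and J: "J \<in> isometries X Y" and T: "T \<in> bounded_ops Y Y"
  shows "compression X Y J T \<in> bounded_ops X X"
proof -
  interpret X: hilbert_space X by fact
  interpret Y: hilbert_space Y by fact
  have sip: "semi_inner_product_space X" "semi_inner_product_space Y" by unfold_locales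
  note J_ops = isometriesD(1)[OF J]
  have TJ: "(\<lambda>x\<in>carrier X. T (J x)) \<in> bounded_ops X Y"
    by (rule bounded_ops_compose[OF sip(1) J_ops T sip(2)])
  have "(\<lambda>x\<in>carrier X. adjoint_op X Y J ((\<lambda>x\<in>carrier X. T (J x)) x)) \<in> bounded_ops X X"
    by (rule bounded_ops_compose[OF sip(1) TJ adjoint_op_bounded_ops[OF X Y J_ops] sip(2)])
  moreover have "(\<lambda>x\<in>carrier X. adjoint_op X Y J ((\<lambda>x\<in>carrier X. T (J x)) x)) = (\<lambda>x\<in>carrier X. adjoint_op X Y J (T (J x)))"
    by (rule restrict_ext) simp
  ultimately show ?thesis
    by (simp add: compression_eq_adjoint[OF assms])
qed

lemma sprod_compression:
  assumes X: "hilbert_space X" and Y: "hilbert_space Y" and J: "J \<in> isometries X Y" and T: "T \<in> bounded_ops Y Y"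
    and x: "x \<in> carrier X" and y: "y \<in> carrier X"
  shows "\<langle>compression X Y J T x, y\<rangle>\<^bsub>X\<^esub> = \<langle>T (J x), J y\<rangle>\<^bsub>Y\<^esub>"
proof -
  note J_ops = isometriesD(1)[OF J]
  have "T (J x) \<in> carrier Y"
    using x by (intro bounded_opsD(1)[OF T] bounded_opsD(1)[OF J_ops])
  then show ?thesis
    using x y by (simp add: compression_eq_adjoint[OF X Y J T] sprod_adjoint_op_left[OF X Y J_ops])
qed


section \<open>The space of the moment problem\<close>

locale moment_problem = X: hilbert_space \<H> for \<H> :: "'a ipspace" +
  fixes d :: nat and S :: "nat \<Rightarrow> 'a \<Rightarrow> 'a"
  assumes d_pos: "d \<ge> 1"
    and S_bounded: "\<And>n. n \<le> d \<Longrightarrow> S n \<in> bounded_ops \<H> \<H>"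
    and S_positive: "\<And>h. (\<And>k. k \<le> d \<Longrightarrow> h k \<in> carrier \<H>) \<Longrightarrow>
      (\<Sum>k\<le>d. \<Sum>l\<le>d. \<langle>ext_moment \<H> S (int l - int k) (h l), h k\<rangle>\<^bsub>\<H>\<^esub>) \<in> \<real>\<^sub>\<ge>\<^sub>0"
begin

lemma ext_moment_bounded: "\<bar>k\<bar> \<le> int d \<Longrightarrow> ext_moment \<H> S k \<in> bounded_ops \<H> \<H>"
  using adjoint_op_bounded_ops[OF X.hilbert_space_axioms X.hilbert_space_axioms S_bounded] S_bounded
  by (auto simp: ext_moment_def)

lemma ext_moment_diff_bounded:
  "\<lbrakk>j \<le> d; k \<le> d\<rbrakk> \<Longrightarrow> ext_moment \<H> S (int j - int k) \<in> bounded_ops \<H> \<H>"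
  by (intro ext_moment_bounded) auto

text \<open>The convention that a negative index means an adjoint says nothing at index 0. There
  symmetry comes from positivity, tested on families concentrated at index 0, followed by
  polarisation.\<close>

lemma S_0_hermitian:
  assumes "x \<in> carrier \<H>" "y \<in> carrier \<H>"
  shows "\<langle>S 0 x, y\<rangle>\<^bsub>\<H>\<^esub> = cnj \<langle>S 0 y, x\<rangle>\<^bsub>\<H>\<^esub>"
proof (rule X.real_form_imp_hermitian[OF _ _ assms])
  show "S 0 \<in> bounded_ops \<H> \<H>"
    by (rule S_bounded) simp
  fix x assume x: "x \<in> carrier \<H>"
  have "(\<Sum>k\<le>d. \<Sum>l\<le>d. \<langle>ext_moment \<H> S (int l - int k) (if l = 0 then x else \<zero>\<^bsub>\<H>\<^esub>), if k = 0 then x else \<zero>\<^bsub>\<H>\<^esub>\<rangle>\<^bsub>\<H>\<^esub>) \<in> \<real>\<^sub>\<ge>\<^sub>0"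
    using x by (intro S_positive) auto
  also have "(\<Sum>k\<le>d. \<Sum>l\<le>d. \<langle>ext_moment \<H> S (int l - int k) (if l = 0 then x else \<zero>\<^bsub>\<H>\<^esub>), if k = 0 then x else \<zero>\<^bsub>\<H>\<^esub>\<rangle>\<^bsub>\<H>\<^esub>)
     = (\<Sum>k\<le>d. \<Sum>l\<le>d. if l = 0 then (if k = 0 then \<langle>S 0 x, x\<rangle>\<^bsub>\<H>\<^esub> else 0) else 0)"
  proof (intro sum.cong refl)
    fix k l assume "k \<in> {..d}" "l \<in> {..d}"
    then have B: "ext_moment \<H> S (int l - int k) \<in> bounded_ops \<H> \<H>"
      by (intro ext_moment_diff_bounded) auto
    show "\<langle>ext_moment \<H> S (int l - int k) (if l = 0 then x else \<zero>\<^bsub>\<H>\<^esub>), if k = 0 then x else \<zero>\<^bsub>\<H>\<^esub>\<rangle>\<^bsub>\<H>\<^esub> =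
      (if l = 0 then (if k = 0 then \<langle>S 0 x, x\<rangle>\<^bsub>\<H>\<^esub> else 0) else 0)"
      using x bounded_opsD(1)[OF B] bounded_ops_zero[OF X.semi_inner_product_space_axioms X.semi_inner_product_space_axioms B]
      by (cases "k = 0"; cases "l = 0") (simp_all, simp add: ext_moment_def)
  qed
  also have "\<dots> = \<langle>S 0 x, x\<rangle>\<^bsub>\<H>\<^esub>"
    by (simp add: sum.delta)
  finally show "\<langle>S 0 x, x\<rangle>\<^bsub>\<H>\<^esub> \<in> \<real>"
    using nonneg_Reals_subset_Reals by blast
qed

lemma ext_moment_hermitian:
  assumes k: "\<bar>k\<bar> \<le> int d" and x: "x \<in> carrier \<H>" and y: "y \<in> carrier \<H>"
  shows "\<langle>ext_moment \<H> S k x, y\<rangle>\<^bsub>\<H>\<^esub> = cnj \<langle>ext_moment \<H> S (- k) y, x\<rangle>\<^bsub>\<H>\<^esub>"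
proof -
  have pos: "\<langle>ext_moment \<H> S k x, y\<rangle>\<^bsub>\<H>\<^esub> = cnj \<langle>ext_moment \<H> S (- k) y, x\<rangle>\<^bsub>\<H>\<^esub>"
    if k: "0 < k" "k \<le> int d" and x: "x \<in> carrier \<H>" and y: "y \<in> carrier \<H>" for k x y
  proof -
    have B: "S (nat k) \<in> bounded_ops \<H> \<H>"
      using k by (intro S_bounded) simp
    have "\<langle>S (nat k) x, y\<rangle>\<^bsub>\<H>\<^esub> = cnj \<langle>y, S (nat k) x\<rangle>\<^bsub>\<H>\<^esub>"
      using y bounded_opsD(1)[OF B x] by (rule X.sprod_commute)
    then show ?thesis
      using k sprod_adjoint_op_left[OF X.hilbert_space_axioms X.hilbert_space_axioms B y x]
      by (simp add: ext_moment_def)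
  qed
  consider "k > 0" | "k = 0" | "k < 0" by linarith
  then show ?thesis
  proof cases
    case 1
    then show ?thesis using k x y by (intro pos) auto
  next
    case 2
    then show ?thesis using S_0_hermitian[OF x y] by (simp add: ext_moment_def)
  next
    case 3
    then show ?thesis using pos[of "- k" y x] k x y by simp
  qed
qed

abbreviation "FS \<equiv> formal_sums \<H> d S"
abbreviation "NQ \<equiv> null_quotient FS"
abbreviation "H \<equiv> moment_space \<H> d S"
abbreviation "mvec \<equiv> moment_vec \<H> d S"
abbreviation "A \<equiv> shift_op \<H> d S"
abbreviation "I \<equiv> moment_embed \<H> d S"

section \<open>Formal sums and their completion\<close>

lemma formal_sums_ops:
  "carrier FS = {..d} \<rightarrow>\<^sub>E carrier \<H>"
  "\<zero>\<^bsub>FS\<^esub> = (\<lambda>j\<in>{..d}. \<zero>\<^bsub>\<H>\<^esub>)"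
  "h \<oplus>\<^bsub>FS\<^esub> g = (\<lambda>j\<in>{..d}. h j \<oplus>\<^bsub>\<H>\<^esub> g j)"
  "a \<odot>\<^bsub>FS\<^esub> h = (\<lambda>j\<in>{..d}. a \<odot>\<^bsub>\<H>\<^esub> h j)"
  "\<langle>h, g\<rangle>\<^bsub>FS\<^esub> = (\<Sum>j\<le>d. \<Sum>k\<le>d. \<langle>ext_moment \<H> S (int j - int k) (h j), g k\<rangle>\<^bsub>\<H>\<^esub>)"
  by (simp_all add: formal_sums_def)

lemma formal_sums_mem: "\<lbrakk>h \<in> carrier FS; j \<le> d\<rbrakk> \<Longrightarrow> h j \<in> carrier \<H>"
  by (auto simp: formal_sums_ops)

lemma formal_sums_eqI:
  "\<lbrakk>h \<in> carrier FS; g \<in> carrier FS; \<And>j. j \<le> d \<Longrightarrow> h j = g j\<rbrakk> \<Longrightarrow> h = g"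
  unfolding formal_sums_ops by (rule PiE_ext) auto

lemma formal_sums_semi_inner_product_space: "semi_inner_product_space FS"
proof (rule semi_inner_product_spaceI)
  note mem = formal_sums_mem
  show zero: "\<zero>\<^bsub>FS\<^esub> \<in> carrier FS"
    by (auto simp: formal_sums_ops)
  show add: "h \<oplus>\<^bsub>FS\<^esub> g \<in> carrier FS" if "h \<in> carrier FS" "g \<in> carrier FS" for h g
    using mem[OF that(1)] mem[OF that(2)] by (auto simp: formal_sums_ops)
  show smult: "a \<odot>\<^bsub>FS\<^esub> h \<in> carrier FS" if "h \<in> carrier FS" for a h
    using mem[OF that(1)] by (auto simp: formal_sums_ops)
  show "h \<oplus>\<^bsub>FS\<^esub> g \<oplus>\<^bsub>FS\<^esub> f = h \<oplus>\<^bsub>FS\<^esub> (g \<oplus>\<^bsub>FS\<^esub> f)"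
    if "h \<in> carrier FS" "g \<in> carrier FS" "f \<in> carrier FS" for h g f
    by (rule formal_sums_eqI[OF add[OF add] add[OF _ add]])
      (use that mem in \<open>simp_all add: formal_sums_ops(3) X.M.a_assoc\<close>)
  show "h \<oplus>\<^bsub>FS\<^esub> g = g \<oplus>\<^bsub>FS\<^esub> h" if "h \<in> carrier FS" "g \<in> carrier FS" for h g
    by (rule formal_sums_eqI[OF add add]) (use that mem in \<open>simp_all add: formal_sums_ops(3) X.M.a_comm\<close>)
  show "\<zero>\<^bsub>FS\<^esub> \<oplus>\<^bsub>FS\<^esub> h = h" if "h \<in> carrier FS" for h
    by (rule formal_sums_eqI[OF add[OF zero]]) (use that mem in \<open>simp_all add: formal_sums_ops(2,3)\<close>)
  show "(- 1) \<odot>\<^bsub>FS\<^esub> h \<oplus>\<^bsub>FS\<^esub> h = \<zero>\<^bsub>FS\<^esub>" if "h \<in> carrier FS" for h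
    by (rule formal_sums_eqI[OF add[OF smult] zero])
      (use that mem in \<open>simp_all add: formal_sums_ops(2,3,4) X.neg_add_eq_zero\<close>)
  show "(a + b) \<odot>\<^bsub>FS\<^esub> h = a \<odot>\<^bsub>FS\<^esub> h \<oplus>\<^bsub>FS\<^esub> b \<odot>\<^bsub>FS\<^esub> h" if "h \<in> carrier FS" for a b h
    by (rule formal_sums_eqI[OF smult add[OF smult smult]])
      (use that mem in \<open>simp_all add: formal_sums_ops(2,3,4) X.smult_distrib\<close>)
  show "a \<odot>\<^bsub>FS\<^esub> (h \<oplus>\<^bsub>FS\<^esub> g) = a \<odot>\<^bsub>FS\<^esub> h \<oplus>\<^bsub>FS\<^esub> a \<odot>\<^bsub>FS\<^esub> g"
    if "h \<in> carrier FS" "g \<in> carrier FS" for a h g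
    by (rule formal_sums_eqI[OF smult[OF add] add[OF smult smult]])
      (use that mem in \<open>simp_all add: formal_sums_ops(2,3,4) X.smult_distrib\<close>)
  show "(a * b) \<odot>\<^bsub>FS\<^esub> h = a \<odot>\<^bsub>FS\<^esub> (b \<odot>\<^bsub>FS\<^esub> h)" if "h \<in> carrier FS" for a b h
    by (rule formal_sums_eqI[OF smult smult[OF smult]])
      (use that mem in \<open>simp_all add: formal_sums_ops(2,3,4) X.smult_distrib\<close>)
  show "1 \<odot>\<^bsub>FS\<^esub> h = h" if "h \<in> carrier FS" for h
    by (rule formal_sums_eqI[OF smult]) (use that mem in \<open>simp_all add: formal_sums_ops(4)\<close>)
  show "\<langle>h \<oplus>\<^bsub>FS\<^esub> g, f\<rangle>\<^bsub>FS\<^esub> = \<langle>h, f\<rangle>\<^bsub>FS\<^esub> + \<langle>g, f\<rangle>\<^bsub>FS\<^esub>"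
    if "h \<in> carrier FS" "g \<in> carrier FS" "f \<in> carrier FS" for h g f
  proof -
    have "\<langle>ext_moment \<H> S (int j - int k) (h j \<oplus>\<^bsub>\<H>\<^esub> g j), f k\<rangle>\<^bsub>\<H>\<^esub> =
        \<langle>ext_moment \<H> S (int j - int k) (h j), f k\<rangle>\<^bsub>\<H>\<^esub> + \<langle>ext_moment \<H> S (int j - int k) (g j), f k\<rangle>\<^bsub>\<H>\<^esub>"
      if jk: "j \<le> d" "k \<le> d" for j k
      using that mem[OF \<open>h \<in> _\<close> jk(1)] mem[OF \<open>g \<in> _\<close> jk(1)] mem[OF \<open>f \<in> _\<close> jk(2)]
        bounded_opsD[OF ext_moment_diff_bounded[OF jk]]
      by (simp add: X.sprod_add_left)
    then show ?thesis
      by (simp add: formal_sums_ops(3,5) flip: sum.distrib)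
  qed
  show "\<langle>a \<odot>\<^bsub>FS\<^esub> h, f\<rangle>\<^bsub>FS\<^esub> = a * \<langle>h, f\<rangle>\<^bsub>FS\<^esub>" if "h \<in> carrier FS" "f \<in> carrier FS" for a h f
  proof -
    have "\<langle>ext_moment \<H> S (int j - int k) (a \<odot>\<^bsub>\<H>\<^esub> h j), f k\<rangle>\<^bsub>\<H>\<^esub> =
        a * \<langle>ext_moment \<H> S (int j - int k) (h j), f k\<rangle>\<^bsub>\<H>\<^esub>"
      if jk: "j \<le> d" "k \<le> d" for j k
      using that mem[OF \<open>h \<in> _\<close> jk(1)] mem[OF \<open>f \<in> _\<close> jk(2)] bounded_opsD[OF ext_moment_diff_bounded[OF jk]]
      by (simp add: X.sprod_smult_left)
    then show ?thesis
      by (simp add: formal_sums_ops(4,5) sum_distrib_left)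
  qed
  show "\<langle>g, h\<rangle>\<^bsub>FS\<^esub> = cnj \<langle>h, g\<rangle>\<^bsub>FS\<^esub>" if "h \<in> carrier FS" "g \<in> carrier FS" for h g
  proof -
    have "\<langle>g, h\<rangle>\<^bsub>FS\<^esub> = (\<Sum>j\<le>d. \<Sum>k\<le>d. cnj \<langle>ext_moment \<H> S (int k - int j) (h k), g j\<rangle>\<^bsub>\<H>\<^esub>)"
      unfolding formal_sums_ops
    proof (intro sum.cong refl)
      fix j k assume "j \<in> {..d}" "k \<in> {..d}"
      then have "\<bar>int j - int k\<bar> \<le> int d" "g j \<in> carrier \<H>" "h k \<in> carrier \<H>"
        using mem that by auto
      then show "\<langle>ext_moment \<H> S (int j - int k) (g j), h k\<rangle>\<^bsub>\<H>\<^esub> = cnj \<langle>ext_moment \<H> S (int k - int j) (h k), g j\<rangle>\<^bsub>\<H>\<^esub>"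
        using ext_moment_hermitian[of "int j - int k" "g j" "h k"] by simp
    qed
    also have "\<dots> = cnj \<langle>h, g\<rangle>\<^bsub>FS\<^esub>"
      by (subst sum.swap) (simp add: formal_sums_ops(5))
    finally show ?thesis .
  qed
  \<comment> \<open>The positivity hypothesis has its two summations in the opposite order.\<close>
  show "\<langle>h, h\<rangle>\<^bsub>FS\<^esub> \<in> \<real>\<^sub>\<ge>\<^sub>0" if "h \<in> carrier FS" for h
    using S_positive[of h] mem[OF that] unfolding formal_sums_ops by (subst sum.swap) auto
qed

sublocale FS: semi_inner_product_space FS
  by (rule formal_sums_semi_inner_product_space)

sublocale NQ: semi_inner_product_space NQ
  by (rule FS.null_quotient_semi_inner_product_space)

sublocale H: hilbert_space H
  unfolding moment_space_def by (rule NQ.completion_hilbert_space)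

definition embed :: "(nat \<Rightarrow> 'a) \<Rightarrow> 'a moment_vec" where
  "embed f = completion_embed NQ (null_class FS f)"

lemma embed_carrier [simp, intro]: "f \<in> carrier FS \<Longrightarrow> embed f \<in> carrier H"
  unfolding embed_def moment_space_def by (intro NQ.completion_embed_carrier FS.null_class_carrier)

lemma embed_add: "\<lbrakk>f \<in> carrier FS; g \<in> carrier FS\<rbrakk> \<Longrightarrow> embed (f \<oplus>\<^bsub>FS\<^esub> g) = embed f \<oplus>\<^bsub>H\<^esub> embed g"
  by (simp add: embed_def moment_space_def FS.null_class_carrier
      flip: FS.null_class_add NQ.completion_embed_add)

lemma embed_smult: "f \<in> carrier FS \<Longrightarrow> embed (a \<odot>\<^bsub>FS\<^esub> f) = a \<odot>\<^bsub>H\<^esub> embed f"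
  by (simp add: embed_def moment_space_def FS.null_class_carrier
      flip: FS.null_class_smult NQ.completion_embed_smult)

lemma embed_zero: "embed \<zero>\<^bsub>FS\<^esub> = \<zero>\<^bsub>H\<^esub>"
  by (simp add: embed_def moment_space_def FS.null_class_zero NQ.completion_embed_zero)

lemma embed_sprod: "\<lbrakk>f \<in> carrier FS; g \<in> carrier FS\<rbrakk> \<Longrightarrow> \<langle>embed f, embed g\<rangle>\<^bsub>H\<^esub> = \<langle>f, g\<rangle>\<^bsub>FS\<^esub>"
  by (simp add: embed_def moment_space_def FS.null_class_carrier FS.null_class_sprod NQ.completion_embed_sprod)

lemma embed_total:
  assumes "z \<in> carrier H" "\<And>f. f \<in> carrier FS \<Longrightarrow> \<langle>embed f, z\<rangle>\<^bsub>H\<^esub> = 0"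
  shows "z = \<zero>\<^bsub>H\<^esub>"
  using assms unfolding moment_space_def
  by (intro NQ.completion_total) (auto simp: FS.null_quotient_carrier embed_def)

lemma vec_eq_embed: "mvec h j = embed (formal_term \<H> d h j)"
  by (simp add: moment_vec_def embed_def)

lemma formal_term_carrier [simp, intro]: "h \<in> carrier \<H> \<Longrightarrow> formal_term \<H> d h j \<in> carrier FS"
  by (auto simp: formal_sums_ops formal_term_def)

lemma vec_carrier [simp, intro]: "h \<in> carrier \<H> \<Longrightarrow> mvec h j \<in> carrier H"
  by (auto simp: vec_eq_embed)

lemma sprod_vec:
  assumes h: "h \<in> carrier \<H>" and g: "g \<in> carrier \<H>" and j: "j \<le> d" and k: "k \<le> d"
  shows "\<langle>mvec h j, mvec g k\<rangle>\<^bsub>H\<^esub> = \<langle>ext_moment \<H> S (int j - int k) h, g\<rangle>\<^bsub>\<H>\<^esub>"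
proof -
  have "\<langle>mvec h j, mvec g k\<rangle>\<^bsub>H\<^esub> = (\<Sum>j'\<le>d. \<Sum>k'\<le>d.
      \<langle>ext_moment \<H> S (int j' - int k') (formal_term \<H> d h j j'), formal_term \<H> d g k k'\<rangle>\<^bsub>\<H>\<^esub>)"
    using h g by (simp add: vec_eq_embed embed_sprod formal_sums_ops(5))
  also have "\<dots> = (\<Sum>j'\<le>d. \<Sum>k'\<le>d. if k' = k then (if j' = j then \<langle>ext_moment \<H> S (int j - int k) h, g\<rangle>\<^bsub>\<H>\<^esub> else 0) else 0)"
  proof (intro sum.cong refl)
    fix j' k' assume "j' \<in> {..d}" "k' \<in> {..d}"
    then have jk': "j' \<le> d" "k' \<le> d" by auto
    show "\<langle>ext_moment \<H> S (int j' - int k') (formal_term \<H> d h j j'), formal_term \<H> d g k k'\<rangle>\<^bsub>\<H>\<^esub> =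
      (if k' = k then (if j' = j then \<langle>ext_moment \<H> S (int j - int k) h, g\<rangle>\<^bsub>\<H>\<^esub> else 0) else 0)"
      using h g jk' bounded_opsD(1)[OF ext_moment_diff_bounded[OF jk']]
        bounded_ops_zero[OF X.semi_inner_product_space_axioms X.semi_inner_product_space_axioms ext_moment_diff_bounded[OF jk']]
      by (cases "k' = k"; cases "j' = j"; simp add: formal_term_def)
  qed
  also have "\<dots> = \<langle>ext_moment \<H> S (int j - int k) h, g\<rangle>\<^bsub>\<H>\<^esub>"
    using j k by (simp add: sum.delta)
  finally show ?thesis .
qed

definition vecs :: "'a moment_vec set" where
  "vecs = {mvec h j | h j. h \<in> carrier \<H> \<and> j \<le> d}"

lemma vecs_subset: "vecs \<subseteq> carrier H"
  by (auto simp: vecs_def)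

text \<open>Orthogonality to all generators spreads to formal sums by adding one coefficient at a
  time, and the classes of formal sums are dense.\<close>

lemma vecs_total: "perp H vecs \<subseteq> {\<zero>\<^bsub>H\<^esub>}"
proof
  fix z assume "z \<in> perp H vecs"
  then have z: "z \<in> carrier H" and orth: "\<And>h j. \<lbrakk>h \<in> carrier \<H>; j \<le> d\<rbrakk> \<Longrightarrow> \<langle>mvec h j, z\<rangle>\<^bsub>H\<^esub> = 0"
    by (auto simp: perp_def vecs_def)
  have "\<langle>embed f, z\<rangle>\<^bsub>H\<^esub> = 0" if f: "f \<in> carrier FS" for f
  proof -
    \<comment> \<open>Keeps the coefficients below n, so that \<open>trunc 0\<close> is zero and
      \<open>trunc (Suc d)\<close> is f.\<close>
    define trunc where "trunc n = (\<lambda>j\<in>{..d}. if j < n then f j else \<zero>\<^bsub>\<H>\<^esub>)" for n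
    have trunc: "trunc n \<in> carrier FS" for n
      using formal_sums_mem[OF f] by (auto simp: formal_sums_ops(1) trunc_def)
    have "\<langle>embed (trunc n), z\<rangle>\<^bsub>H\<^esub> = 0" if "n \<le> Suc d" for n
      using that
    proof (induction n)
      case 0
      have "trunc 0 = \<zero>\<^bsub>FS\<^esub>"
        by (simp add: trunc_def formal_sums_ops(2))
      then show ?case
        using z by (simp add: embed_zero)
    next
      case (Suc n)
      have fn: "f n \<in> carrier \<H>"
        using Suc.prems formal_sums_mem[OF f] by simp
      have "trunc (Suc n) = trunc n \<oplus>\<^bsub>FS\<^esub> formal_term \<H> d (f n) n"
      proof (rule formal_sums_eqI)
        fix j assume "j \<le> d"
        then show "trunc (Suc n) j = (trunc n \<oplus>\<^bsub>FS\<^esub> formal_term \<H> d (f n) n) j"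
          using formal_sums_mem[OF f] fn by (auto simp: formal_sums_ops(3) formal_term_def trunc_def less_Suc_eq)
      qed (use trunc fn in auto)
      then have "embed (trunc (Suc n)) = embed (trunc n) \<oplus>\<^bsub>H\<^esub> mvec (f n) n"
        using trunc fn by (simp add: embed_add vec_eq_embed)
      then show ?case
        using Suc trunc fn z orth[OF fn, of n] by (simp add: H.sprod_add_left)
    qed
    moreover have "trunc (Suc d) = f"
      by (rule formal_sums_eqI[OF trunc f]) (simp add: trunc_def)
    ultimately show ?thesis
      by (metis order_refl)
  qed
  then show "z \<in> {\<zero>\<^bsub>H\<^esub>}"
    using embed_total[OF z] by simp
qed

lemma vec_zero: "mvec \<zero>\<^bsub>\<H>\<^esub> j = \<zero>\<^bsub>H\<^esub>"
proof -
  have "formal_term \<H> d \<zero>\<^bsub>\<H>\<^esub> j = \<zero>\<^bsub>FS\<^esub>"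
    by (auto simp: formal_term_def formal_sums_ops(2))
  then show ?thesis
    by (simp add: vec_eq_embed embed_zero)
qed

text \<open>The squared norm of \<open>mvec x 0\<close> is the form of \<open>S 0\<close> at x,
  whence the square root of a bound of \<open>S 0\<close>.\<close>

lemma moment_embed_bounded: "I \<in> bounded_ops \<H> H"
proof -
  have add: "mvec (x \<oplus>\<^bsub>\<H>\<^esub> y) 0 = mvec x 0 \<oplus>\<^bsub>H\<^esub> mvec y 0" if "x \<in> carrier \<H>" "y \<in> carrier \<H>" for x y
  proof -
    have "formal_term \<H> d (x \<oplus>\<^bsub>\<H>\<^esub> y) 0 = formal_term \<H> d x 0 \<oplus>\<^bsub>FS\<^esub> formal_term \<H> d y 0"
      by (rule formal_sums_eqI[OF formal_term_carrier FS.M.a_closed[OF formal_term_carrier formal_term_carrier]])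
        (use that in \<open>auto simp: formal_sums_ops(3) formal_term_def\<close>)
    then show ?thesis
      using that by (simp add: vec_eq_embed embed_add)
  qed
  have smult: "mvec (a \<odot>\<^bsub>\<H>\<^esub> x) 0 = a \<odot>\<^bsub>H\<^esub> mvec x 0" if "x \<in> carrier \<H>" for x a
  proof -
    have "formal_term \<H> d (a \<odot>\<^bsub>\<H>\<^esub> x) 0 = a \<odot>\<^bsub>FS\<^esub> formal_term \<H> d x 0"
      by (rule formal_sums_eqI[OF formal_term_carrier FS.smult_carrier[OF formal_term_carrier]])
        (use that in \<open>auto simp: formal_sums_ops(4) formal_term_def\<close>)
    then show ?thesis
      using that by (simp add: vec_eq_embed embed_smult)
  qed
  have S0: "S 0 \<in> bounded_ops \<H> \<H>"
    by (rule S_bounded) simp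
  obtain C where C: "C > 0" "\<And>x. x \<in> carrier \<H> \<Longrightarrow> hnorm \<H> (S 0 x) \<le> C * hnorm \<H> x"
    using bounded_ops_bound[OF X.semi_inner_product_space_axioms S0] by blast
  have "hnorm H (mvec x 0) \<le> sqrt C * hnorm \<H> x" if x: "x \<in> carrier \<H>" for x
  proof -
    have S0x: "S 0 x \<in> carrier \<H>"
      using bounded_opsD(1)[OF S0 x] .
    have "(hnorm H (mvec x 0))\<^sup>2 = Re \<langle>S 0 x, x\<rangle>\<^bsub>\<H>\<^esub>"
      using x by (simp add: H.hnorm_power2 sprod_vec ext_moment_def)
    also have "\<dots> \<le> hnorm \<H> (S 0 x) * hnorm \<H> x"
      using X.Cauchy_Schwarz[OF S0x x] complex_Re_le_cmod order_trans by blast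
    also have "\<dots> \<le> (C * hnorm \<H> x) * hnorm \<H> x"
      using x C by (intro mult_right_mono) auto
    also have "\<dots> = (sqrt C * hnorm \<H> x)\<^sup>2"
      using C(1) by (simp add: power_mult_distrib power2_eq_square[of "hnorm \<H> x"])
    finally have "(hnorm H (mvec x 0))\<^sup>2 \<le> (sqrt C * hnorm \<H> x)\<^sup>2" .
    moreover have "0 \<le> sqrt C * hnorm \<H> x"
      using x C(1) by simp
    ultimately show ?thesis
      by (rule power2_le_imp_le)
  qed
  then show ?thesis
    using add smult by (auto simp: bounded_ops_def moment_embed_def)
qed

lemma moment_embed_eq [simp]: "h \<in> carrier \<H> \<Longrightarrow> I h = mvec h 0"
  by (simp add: moment_embed_def)

text \<open>Isolates one generator in the sums that define the graph; f is the identity for the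
  argument and \<open>Suc\<close> for its image.\<close>

lemma sprod_finsum_single:
  assumes "j < d" "h \<in> carrier \<H>" "z \<in> carrier H"
  shows "\<langle>\<Oplus>\<^bsub>H\<^esub>i\<in>{..<d}. mvec (if i = j then h else \<zero>\<^bsub>\<H>\<^esub>) (f i), z\<rangle>\<^bsub>H\<^esub> = \<langle>mvec h (f j), z\<rangle>\<^bsub>H\<^esub>"
proof -
  have "\<langle>\<Oplus>\<^bsub>H\<^esub>i\<in>{..<d}. mvec (if i = j then h else \<zero>\<^bsub>\<H>\<^esub>) (f i), z\<rangle>\<^bsub>H\<^esub>
      = (\<Sum>i<d. \<langle>mvec (if i = j then h else \<zero>\<^bsub>\<H>\<^esub>) (f i), z\<rangle>\<^bsub>H\<^esub>)"
    using assms by (intro H.sprod_finsum_left) auto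
  also have "\<dots> = (\<Sum>i<d. if i = j then \<langle>mvec h (f j), z\<rangle>\<^bsub>H\<^esub> else 0)"
    using assms(3) by (intro sum.cong refl) (auto simp: vec_zero)
  also have "\<dots> = \<langle>mvec h (f j), z\<rangle>\<^bsub>H\<^esub>"
    using assms by simp
  finally show ?thesis .
qed

text \<open>A family with a single nonzero coefficient at j puts the pair into the graph before
  closure, and constant sequences carry it into the closure.\<close>

lemma shift_op_vec:
  assumes j: "j < d" and h: "h \<in> carrier \<H>"
  shows "(mvec h j, mvec h (Suc j)) \<in> A"
proof -
  let ?h = "\<lambda>i. if i = j then h else \<zero>\<^bsub>\<H>\<^esub>"
  have "(\<Oplus>\<^bsub>H\<^esub>i\<in>{..<d}. mvec (?h i) i) = mvec h j"
    using sprod_finsum_single[OF j h, of _ "\<lambda>i. i"] h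
    by (intro H.vec_eqI H.M.finsum_closed) auto
  moreover have "(\<Oplus>\<^bsub>H\<^esub>i\<in>{..<d}. mvec (?h i) (Suc i)) = mvec h (Suc j)"
    using sprod_finsum_single[OF j h, of _ Suc] h
    by (intro H.vec_eqI H.M.finsum_closed) auto
  moreover have "\<forall>i<d. ?h i \<in> carrier \<H>"
    using h by auto
  ultimately have mem: "(mvec h j, mvec h (Suc j)) \<in> shift_op0 \<H> d S"
    unfolding shift_op0_def by (intro CollectI exI[of _ ?h]) simp
  show ?thesis
    unfolding shift_op_def graph_closure_def
    using mem h H.hlim_const[of "mvec h j"] H.hlim_const[of "mvec h (Suc j)"]
    by (intro CollectI case_prodI conjI exI[of _ "\<lambda>_. mvec h j"] exI[of _ "\<lambda>_. mvec h (Suc j)"] allI) auto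
qed

text \<open>Linearity carries the relation from the generators to the domain before closure, and
  continuity of both sides carries it to the closure.\<close>

lemma shift_op_extensionI:
  assumes K: "hilbert_space K" and J: "J \<in> isometries H K" and U: "U \<in> bounded_ops K K"
    and UJ: "\<And>h j. \<lbrakk>h \<in> carrier \<H>; j < d\<rbrakk> \<Longrightarrow> U (J (mvec h j)) = J (mvec h (Suc j))"
    and xy: "(x, y) \<in> A"
  shows "U (J x) = J y"
proof -
  interpret K: hilbert_space K by fact
  have sip: "semi_inner_product_space H" "semi_inner_product_space K" by unfold_locales
  note J_ops = isometriesD(1)[OF J]
  have UJ_ops: "(\<lambda>x\<in>carrier H. U (J x)) \<in> bounded_ops H K"
    by (rule bounded_ops_compose[OF sip(1) J_ops U sip(2)])
  have A0: "u \<in> carrier H" "w \<in> carrier H" "U (J u) = J w" if "(u, w) \<in> shift_op0 \<H> d S" for u w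
  proof -
    from that obtain h where h: "\<forall>j<d. h j \<in> carrier \<H>"
      and uw: "u = (\<Oplus>\<^bsub>H\<^esub>j\<in>{..<d}. mvec (h j) j)" "w = (\<Oplus>\<^bsub>H\<^esub>j\<in>{..<d}. mvec (h j) (Suc j))"
      unfolding shift_op0_def by blast
    have mem: "mvec (h j) i \<in> carrier H" if "j < d" for i j
      using h that by auto
    show u: "u \<in> carrier H" and w: "w \<in> carrier H"
      unfolding uw using mem by (auto intro!: H.M.finsum_closed)
    show "U (J u) = J w"
    proof (rule K.vec_eqI)
      fix z assume z: "z \<in> carrier K"
      have "\<langle>U (J u), z\<rangle>\<^bsub>K\<^esub> = \<langle>(\<lambda>x\<in>carrier H. U (J x)) u, z\<rangle>\<^bsub>K\<^esub>"
        using u by simp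
      also have "\<dots> = (\<Sum>j<d. \<langle>(\<lambda>x\<in>carrier H. U (J x)) (mvec (h j) j), z\<rangle>\<^bsub>K\<^esub>)"
        unfolding uw using mem z by (intro sprod_bounded_op_finsum[OF sip UJ_ops]) auto
      also have "\<dots> = (\<Sum>j<d. \<langle>J (mvec (h j) (Suc j)), z\<rangle>\<^bsub>K\<^esub>)"
        using mem UJ h by (intro sum.cong refl) auto
      also have "\<dots> = \<langle>J w, z\<rangle>\<^bsub>K\<^esub>"
        unfolding uw using mem z by (intro sprod_bounded_op_finsum[OF sip J_ops, symmetric]) auto
      finally show "\<langle>U (J u), z\<rangle>\<^bsub>K\<^esub> = \<langle>J w, z\<rangle>\<^bsub>K\<^esub>" .
    qed (intro bounded_opsD(1)[OF U] bounded_opsD(1)[OF J_ops] u w)+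
  qed
  obtain u w where x: "x \<in> carrier H" and y: "y \<in> carrier H" and uw: "\<And>n. (u n, w n) \<in> shift_op0 \<H> d S"
    and lim: "hlim H u x" "hlim H w y"
    using xy by (auto simp: shift_op_def graph_closure_def)
  have carr: "range u \<subseteq> carrier H" "range w \<subseteq> carrier H"
    using A0[OF uw] by auto
  have eq: "(\<lambda>x\<in>carrier H. U (J x)) (u n) = J (w n)" for n
    using A0[OF uw[of n]] by simp
  have "hlim K (\<lambda>n. (\<lambda>x\<in>carrier H. U (J x)) (u n)) ((\<lambda>x\<in>carrier H. U (J x)) x)"
    by (rule hlim_bounded_op[OF sip UJ_ops carr(1) x lim(1)])
  then have "hlim K (\<lambda>n. J (w n)) (U (J x))"
    unfolding eq using x by simp
  moreover have "hlim K (\<lambda>n. J (w n)) (J y)"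
    by (rule hlim_bounded_op[OF sip J_ops carr(2) y lim(2)])
  moreover have "range (\<lambda>n. J (w n)) \<subseteq> carrier K"
    using bounded_opsD(1)[OF J_ops] carr(2) by auto
  ultimately show ?thesis
    using K.hlim_unique bounded_opsD(1)[OF J_ops] bounded_opsD(1)[OF U] x y by blast
qed

end

section \<open>Spectral functions and solutions\<close>

text \<open>The data behind one spectral function, packaged as a locale so that two independent
  dilations, possibly over different types, can be in scope at once.\<close>

locale unitary_dilation = moment_problem \<H> d S + K: spectral_resolution K Et
  for \<H> :: "'a ipspace" and d :: nat and S :: "nat \<Rightarrow> 'a \<Rightarrow> 'a"
    and K :: "'k ipspace" and Et :: "real \<Rightarrow> 'k \<Rightarrow> 'k" +
  fixes J :: "'a moment_vec \<Rightarrow> 'k" and U :: "'k \<Rightarrow> 'k"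
  assumes J: "J \<in> isometries (moment_space \<H> d S) K"
    and U: "U \<in> unitary_ops K"
    and extension: "\<And>x y. (x, y) \<in> shift_op \<H> d S \<Longrightarrow> U (J x) = J y"
    and U_integral: "has_strong_integral K cis Et U"
begin

definition spectral_fun :: "real \<Rightarrow> 'a moment_vec \<Rightarrow> 'a moment_vec" where
  "spectral_fun = (\<lambda>t\<in>{0..2 * pi}. compression H K J (Et t))"

section \<open>From a dilation to a solution of the moment problem\<close>

lemma J_bounded: "J \<in> bounded_ops H K"
  by (rule isometriesD(1)[OF J])

lemma J_carrier [simp, intro]: "x \<in> carrier H \<Longrightarrow> J x \<in> carrier K"
  by (rule bounded_opsD(1)[OF J_bounded])

lemma sprod_J: "\<lbrakk>x \<in> carrier H; y \<in> carrier H\<rbrakk> \<Longrightarrow> \<langle>J x, J y\<rangle>\<^bsub>K\<^esub> = \<langle>x, y\<rangle>\<^bsub>H\<^esub>"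
  by (rule isometriesD(2)[OF J])

lemma U_eq: "x \<in> carrier K \<Longrightarrow> U x = K.spectral_power 1 x"
proof (rule K.has_strong_integral_eq_spectral_power)
  show "has_strong_integral K (\<lambda>t. cis (of_int 1 * t)) Et U"
    using U_integral by simp
  show "U x \<in> carrier K" if "x \<in> carrier K"
    using U that by (auto simp: unitary_ops_def isometries_def bounded_ops_def)
qed

text \<open>Since U extends A, each application raises the index by one; the induction ends at d
  because A shifts only generators with index below d.\<close>

lemma spectral_power_J_mvec:
  assumes h: "h \<in> carrier \<H>" and n: "n \<le> d"
  shows "K.spectral_power (int n) (J (mvec h 0)) = J (mvec h n)"
  using n
proof (induction n)
  case 0
  then show ?case
    using h by (simp add: K.spectral_power_0)
next
  case (Suc n)
  have "K.spectral_power (int (Suc n)) (J (mvec h 0)) = K.spectral_power 1 (K.spectral_power (int n) (J (mvec h 0)))"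
    using h by (simp add: K.spectral_power_compose)
  also have "\<dots> = U (J (mvec h n))"
    using Suc h by (simp add: U_eq)
  also have "\<dots> = J (mvec h (Suc n))"
    using Suc.prems h by (intro extension shift_op_vec) auto
  finally show ?case .
qed

lemma spectral_fun_bounded: "t \<in> {0..2 * pi} \<Longrightarrow> spectral_fun t \<in> bounded_ops H H"
  using compression_bounded_ops[OF H.hilbert_space_axioms K.hilbert_space_axioms J K.E_bounded_ops]
  by (simp add: spectral_fun_def)

lemma sprod_spectral_fun:
  "\<lbrakk>t \<in> {0..2 * pi}; x \<in> carrier H; y \<in> carrier H\<rbrakk> \<Longrightarrow> \<langle>spectral_fun t x, y\<rangle>\<^bsub>H\<^esub> = \<langle>Et t (J x), J y\<rangle>\<^bsub>K\<^esub>"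
  using sprod_compression[OF H.hilbert_space_axioms K.hilbert_space_axioms J K.E_bounded_ops]
  by (simp add: spectral_fun_def)

lemma spectral_fun_self_adjoint:
  "\<lbrakk>t \<in> {0..2 * pi}; x \<in> carrier H; y \<in> carrier H\<rbrakk> \<Longrightarrow> \<langle>spectral_fun t x, y\<rangle>\<^bsub>H\<^esub> = \<langle>x, spectral_fun t y\<rangle>\<^bsub>H\<^esub>"
  using H.sprod_commute[of "spectral_fun t y" x] K.sprod_commute[of "Et t (J y)" "J x"]
  by (simp add: sprod_spectral_fun K.E_self_adjoint bounded_opsD(1)[OF spectral_fun_bounded])

abbreviation "F \<equiv> generated_solution \<H> d S spectral_fun"

lemma sol_eq:
  "\<lbrakk>t \<in> {0..2 * pi}; h \<in> carrier \<H>\<rbrakk> \<Longrightarrow> F t h = adjoint_op \<H> H I (spectral_fun t (mvec h 0))"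
  by (simp add: generated_solution_def)

lemma sol_bounded:
  assumes t: "t \<in> {0..2 * pi}"
  shows "F t \<in> bounded_ops \<H> \<H>"
proof -
  have "(\<lambda>h\<in>carrier \<H>. spectral_fun t (I h)) \<in> bounded_ops \<H> H"
    by (rule bounded_ops_compose[OF X.semi_inner_product_space_axioms moment_embed_bounded
          spectral_fun_bounded[OF t] H.semi_inner_product_space_axioms])
  then have "(\<lambda>h\<in>carrier \<H>. adjoint_op \<H> H I ((\<lambda>h\<in>carrier \<H>. spectral_fun t (I h)) h)) \<in> bounded_ops \<H> \<H>"
    by (rule bounded_ops_compose[OF X.semi_inner_product_space_axioms _
          adjoint_op_bounded_ops[OF X.hilbert_space_axioms H.hilbert_space_axioms moment_embed_bounded]
          H.semi_inner_product_space_axioms])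
  moreover have "F t = (\<lambda>h\<in>carrier \<H>. adjoint_op \<H> H I ((\<lambda>h\<in>carrier \<H>. spectral_fun t (I h)) h))"
    using t unfolding generated_solution_def by (auto simp: restrict_def)
  ultimately show ?thesis
    by simp
qed

lemma sprod_sol:
  assumes "t \<in> {0..2 * pi}" "h \<in> carrier \<H>" "g \<in> carrier \<H>"
  shows "\<langle>F t h, g\<rangle>\<^bsub>\<H>\<^esub> = \<langle>Et t (J (mvec h 0)), J (mvec g 0)\<rangle>\<^bsub>K\<^esub>"
  using assms sprod_adjoint_op_left[OF X.hilbert_space_axioms H.hilbert_space_axioms moment_embed_bounded]
  by (simp add: sol_eq sprod_spectral_fun bounded_opsD(1)[OF spectral_fun_bounded])

text \<open>The approximating sums mention F but neither K nor J nor U. Two dilations that generate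
  the same F therefore produce the same limits.\<close>

lemma sprod_spectral_fun_mvec:
  assumes t: "t \<in> {0..2 * pi}" and h: "h \<in> carrier \<H>" and g: "g \<in> carrier \<H>" and j: "j \<le> d" and k: "k \<le> d"
  shows "(\<lambda>N. \<Sum>i<Suc N. cis (of_int (int j - int k) * uniform_partition N i) *
      (\<langle>F (min t (uniform_partition N (Suc i))) h, g\<rangle>\<^bsub>\<H>\<^esub> - \<langle>F (min t (uniform_partition N i)) h, g\<rangle>\<^bsub>\<H>\<^esub>))
    \<longlonglongrightarrow> \<langle>spectral_fun t (mvec h j), mvec g k\<rangle>\<^bsub>H\<^esub>"
proof -
  have "\<langle>F (min t (uniform_partition N i)) h, g\<rangle>\<^bsub>\<H>\<^esub> =
      \<langle>Et (min t (uniform_partition N i)) (J (mvec h 0)), J (mvec g 0)\<rangle>\<^bsub>K\<^esub>" if "i \<le> Suc N" for N i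
  proof (rule sprod_sol[OF _ h g])
    show "min t (uniform_partition N i) \<in> {0..2 * pi}"
      using t tagged_partition_range[OF tagged_uniform_partition_8 that] by (auto simp: min_def)
  qed
  then have "(\<Sum>i<Suc N. cis (of_int (int j - int k) * uniform_partition N i) *
      (\<langle>F (min t (uniform_partition N (Suc i))) h, g\<rangle>\<^bsub>\<H>\<^esub> - \<langle>F (min t (uniform_partition N i)) h, g\<rangle>\<^bsub>\<H>\<^esub>)) =
      (\<Sum>i<Suc N. cis (of_int (int j - int k) * uniform_partition N i) *
      (\<langle>Et (min t (uniform_partition N (Suc i))) (J (mvec h 0)), J (mvec g 0)\<rangle>\<^bsub>K\<^esub> -
       \<langle>Et (min t (uniform_partition N i)) (J (mvec h 0)), J (mvec g 0)\<rangle>\<^bsub>K\<^esub>))" for N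
    by (intro sum.cong) auto
  then show ?thesis
    using K.sprod_E_spectral_power[OF t, of "J (mvec h 0)" "J (mvec g 0)" "int j" "int k"] h g j k t
    by (simp add: spectral_power_J_mvec sprod_spectral_fun)
qed

lemma sol_moment_solution: "F \<in> moment_solutions \<H> d S"
proof -
  \<comment> \<open>B is the adjoint of \<open>J\<close> after \<open>I\<close>, so F t h is the
    image under B of \<open>Et t\<close> applied to a fixed vector. Vanishing at 0, left-continuity
    and the integrals are transported from Et to F by this one bounded operator.\<close>
  define B where "B = (\<lambda>u\<in>carrier K. adjoint_op \<H> H I (adjoint_op H K J u))"
  have B: "B \<in> bounded_ops K \<H>"
    unfolding B_def
    by (rule bounded_ops_compose[OF K.semi_inner_product_space_axioms
          adjoint_op_bounded_ops[OF H.hilbert_space_axioms K.hilbert_space_axioms J_bounded]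
          adjoint_op_bounded_ops[OF X.hilbert_space_axioms H.hilbert_space_axioms moment_embed_bounded]
          H.semi_inner_product_space_axioms])
  note B_carrier = bounded_opsD(1)[OF B]
  have sprod_B: "\<langle>B u, h\<rangle>\<^bsub>\<H>\<^esub> = \<langle>u, J (mvec h 0)\<rangle>\<^bsub>K\<^esub>" if "u \<in> carrier K" "h \<in> carrier \<H>" for u h
    using that adjoint_op_carrier[OF H.hilbert_space_axioms K.hilbert_space_axioms J_bounded]
      sprod_adjoint_op_left[OF X.hilbert_space_axioms H.hilbert_space_axioms moment_embed_bounded]
      sprod_adjoint_op_left[OF H.hilbert_space_axioms K.hilbert_space_axioms J_bounded]
    by (simp add: B_def)
  have sol_B: "F t h = B (Et t (J (mvec h 0)))" if "t \<in> {0..2 * pi}" "h \<in> carrier \<H>" for t h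
    using that bounded_opsD(1)[OF sol_bounded] B_carrier
    by (intro X.vec_eqI) (auto simp: sprod_sol sprod_B)
  obtain C where C: "C > 0" "\<And>u. u \<in> carrier K \<Longrightarrow> hnorm \<H> (B u) \<le> C * hnorm K u"
    using bounded_ops_bound[OF K.semi_inner_product_space_axioms B] by blast
  have hdist_B: "hdist \<H> (B u) (B w) \<le> C * hdist K u w" if "u \<in> carrier K" "w \<in> carrier K" for u w
    using C(2)[of "u \<ominus>\<^bsub>K\<^esub> w"] that
      bounded_ops_minus[OF K.semi_inner_product_space_axioms X.semi_inner_product_space_axioms B that]
    by (simp add: hdist_def)
  have "F \<in> operator_functions \<H>"
    unfolding operator_functions_def using sol_bounded by (auto simp: PiE_def) (simp add: generated_solution_def)
  moreover have "\<langle>F t h \<ominus>\<^bsub>\<H>\<^esub> F s h, h\<rangle>\<^bsub>\<H>\<^esub> \<in> \<real>\<^sub>\<ge>\<^sub>0"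
    if "s \<in> {0..2 * pi}" "t \<in> {0..2 * pi}" "s \<le> t" "h \<in> carrier \<H>" for s t h
  proof -
    have "\<langle>F t h \<ominus>\<^bsub>\<H>\<^esub> F s h, h\<rangle>\<^bsub>\<H>\<^esub> =
        of_real ((hnorm K (Et t (J (mvec h 0))))\<^sup>2 - (hnorm K (Et s (J (mvec h 0))))\<^sup>2)"
      using that bounded_opsD(1)[OF sol_bounded]
      by (simp add: X.sprod_minus_left sprod_sol K.sprod_E_self)
    moreover have "(hnorm K (Et s (J (mvec h 0))))\<^sup>2 \<le> (hnorm K (Et t (J (mvec h 0))))\<^sup>2"
      using that by (intro K.hnorm_E_mono) auto
    ultimately show ?thesis
      by (simp only: nonneg_Reals_of_real_iff)
  qed
  moreover have "F 0 h = \<zero>\<^bsub>\<H>\<^esub>" if "h \<in> carrier \<H>" for h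
    using that bounded_ops_zero[OF K.semi_inner_product_space_axioms X.semi_inner_product_space_axioms B]
    by (simp add: sol_B K.E_0)
  moreover have "strongly_left_continuous \<H> F"
    unfolding strongly_left_continuous_def
  proof (intro ballI)
    fix t h assume t: "t \<in> {0<..2 * pi}" and h: "h \<in> carrier \<H>"
    have v: "J (mvec h 0) \<in> carrier K"
      using h by auto
    have tI: "t \<in> {0..2 * pi}"
      using t by auto
    have "((\<lambda>s. hdist K (Et s (J (mvec h 0))) (Et t (J (mvec h 0)))) \<longlongrightarrow> 0) (at_left t)"
      using K.resolution t v unfolding resolution_of_identity_def strongly_left_continuous_def by blast
    then have lim: "((\<lambda>s. C * hdist K (Et s (J (mvec h 0))) (Et t (J (mvec h 0)))) \<longlongrightarrow> 0) (at_left t)"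
      by (rule tendsto_mult_right_zero)
    have ev: "\<forall>\<^sub>F s in at_left t. s \<in> {0..2 * pi}"
      using t by (intro eventually_at_leftI[of 0]) auto
    show "((\<lambda>s. hdist \<H> (F s h) (F t h)) \<longlongrightarrow> 0) (at_left t)"
    proof (rule tendsto_zero_le[OF lim])
      show "\<forall>\<^sub>F s in at_left t. 0 \<le> hdist \<H> (F s h) (F t h)"
        using ev
      proof eventually_elim
        case (elim s)
        then show ?case
          by (intro X.hdist_nonneg bounded_opsD(1)[OF sol_bounded] tI h)
      qed
      show "\<forall>\<^sub>F s in at_left t. hdist \<H> (F s h) (F t h) \<le> C * hdist K (Et s (J (mvec h 0))) (Et t (J (mvec h 0)))"
        using ev
      proof eventually_elim
        case (elim s)
        then show ?case
          unfolding sol_B[OF elim h] sol_B[OF tI h] by (intro hdist_B K.E_carrier v tI)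
      qed
    qed
  qed
  moreover have "has_strong_integral \<H> (\<lambda>t. cis (real n * t)) F (S n)" if n: "n \<le> d" for n
    unfolding has_strong_integral_def
  proof (intro ballI allI impI)
    fix h and \<epsilon> :: real assume h: "h \<in> carrier \<H>" and \<epsilon>: "\<epsilon> > 0"
    let ?v = "J (mvec h 0)" and ?f = "\<lambda>t. cis (of_int (int n) * t)"
    have v: "?v \<in> carrier K"
      using h by auto
    \<comment> \<open>The tolerance \<open>\<epsilon> / C\<close> compensates for the bound of
      B.\<close>
    obtain \<delta> where \<delta>: "\<delta> > 0"
      "\<And>m p \<tau>. tagged_partition \<delta> m p \<tau> \<Longrightarrow> hdist K (rs_sum K ?f Et m p \<tau> ?v) (K.spectral_power (int n) ?v) < \<epsilon> / C"
      using K.spectral_power_has_integral[of "int n"] v \<epsilon> C(1) unfolding has_strong_integral_def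
      by (meson divide_pos_pos)
    \<comment> \<open>The n-th power carries \<open>J (mvec h 0)\<close> to
      \<open>J (mvec h n)\<close>, and the scalar product of \<open>mvec h n\<close> with
      \<open>mvec g 0\<close> is that of \<open>S n h\<close> with g.\<close>
    have Sn: "S n h = B (K.spectral_power (int n) ?v)"
    proof (rule X.vec_eqI)
      fix g assume g: "g \<in> carrier \<H>"
      have "\<langle>B (K.spectral_power (int n) ?v), g\<rangle>\<^bsub>\<H>\<^esub> = \<langle>mvec h n, mvec g 0\<rangle>\<^bsub>H\<^esub>"
        using h g n by (simp add: sprod_B spectral_power_J_mvec sprod_J)
      also have "\<dots> = \<langle>S n h, g\<rangle>\<^bsub>\<H>\<^esub>"
        using h g n by (simp add: sprod_vec ext_moment_def)
      finally show "\<langle>S n h, g\<rangle>\<^bsub>\<H>\<^esub> = \<langle>B (K.spectral_power (int n) ?v), g\<rangle>\<^bsub>\<H>\<^esub>" by simp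
    qed (use h v n bounded_opsD(1)[OF S_bounded] B_carrier in auto)
    have "hdist \<H> (rs_sum \<H> (\<lambda>t. cis (real n * t)) F m p \<tau> h) (S n h) < \<epsilon>"
      if p: "tagged_partition \<delta> m p \<tau>" for m p \<tau>
    proof -
      have pI: "p i \<in> {0..2 * pi}" if "i \<le> m" for i
        using tagged_partition_range[OF p that] .
      have R: "rs_sum K ?f Et m p \<tau> ?v \<in> carrier K"
        by (rule K.rs_sum_E_carrier[OF p v])
      have F: "F (p i) h \<in> carrier \<H>" if "i \<le> m" for i
        using bounded_opsD(1)[OF sol_bounded[OF pI[OF that]] h] .
      \<comment> \<open>B maps the sums of Et to the sums of F with the same partition and
        tags.\<close>
      have "rs_sum \<H> (\<lambda>t. cis (real n * t)) F m p \<tau> h = B (rs_sum K ?f Et m p \<tau> ?v)"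
      proof (rule X.vec_eqI)
        fix g assume g: "g \<in> carrier \<H>"
        have "\<langle>rs_sum \<H> (\<lambda>t. cis (real n * t)) F m p \<tau> h, g\<rangle>\<^bsub>\<H>\<^esub> =
            (\<Sum>i<m. cis (real n * \<tau> i) * (\<langle>F (p (Suc i)) h, g\<rangle>\<^bsub>\<H>\<^esub> - \<langle>F (p i) h, g\<rangle>\<^bsub>\<H>\<^esub>))"
          using F g by (intro X.sprod_rs_sum_left) auto
        also have "\<dots> = (\<Sum>i<m. ?f (\<tau> i) *
            (\<langle>Et (p (Suc i)) ?v, J (mvec g 0)\<rangle>\<^bsub>K\<^esub> - \<langle>Et (p i) ?v, J (mvec g 0)\<rangle>\<^bsub>K\<^esub>))"
        proof (intro sum.cong refl)
          fix i assume "i \<in> {..<m}"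
          then show "cis (real n * \<tau> i) * (\<langle>F (p (Suc i)) h, g\<rangle>\<^bsub>\<H>\<^esub> - \<langle>F (p i) h, g\<rangle>\<^bsub>\<H>\<^esub>) = ?f (\<tau> i) *
            (\<langle>Et (p (Suc i)) ?v, J (mvec g 0)\<rangle>\<^bsub>K\<^esub> - \<langle>Et (p i) ?v, J (mvec g 0)\<rangle>\<^bsub>K\<^esub>)"
            using pI[of i] pI[of "Suc i"] h g by (simp add: sprod_sol)
        qed
        also have "\<dots> = \<langle>rs_sum K ?f Et m p \<tau> ?v, J (mvec g 0)\<rangle>\<^bsub>K\<^esub>"
          using g v pI by (intro K.sprod_rs_sum_left[symmetric]) auto
        also have "\<dots> = \<langle>B (rs_sum K ?f Et m p \<tau> ?v), g\<rangle>\<^bsub>\<H>\<^esub>"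
          using R g by (simp add: sprod_B)
        finally show "\<langle>rs_sum \<H> (\<lambda>t. cis (real n * t)) F m p \<tau> h, g\<rangle>\<^bsub>\<H>\<^esub> = \<langle>B (rs_sum K ?f Et m p \<tau> ?v), g\<rangle>\<^bsub>\<H>\<^esub>" .
      next
        show "rs_sum \<H> (\<lambda>t. cis (real n * t)) F m p \<tau> h \<in> carrier \<H>"
          using F by (rule X.rs_sum_carrier)
      qed (rule B_carrier[OF R])
      then have "hdist \<H> (rs_sum \<H> (\<lambda>t. cis (real n * t)) F m p \<tau> h) (S n h) \<le>
          C * hdist K (rs_sum K ?f Et m p \<tau> ?v) (K.spectral_power (int n) ?v)"
        unfolding Sn using R v by (simp add: hdist_B)
      also have "\<dots> < \<epsilon>"
        using \<delta>(2)[OF p] C(1) by (simp add: field_simps)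
      finally show ?thesis .
    qed
    with \<delta>(1) show "\<exists>\<delta>>0. \<forall>m p \<tau>. tagged_partition \<delta> m p \<tau> \<longrightarrow>
        hdist \<H> (rs_sum \<H> (\<lambda>t. cis (real n * t)) F m p \<tau> h) (S n h) < \<epsilon>"
      by blast
  qed
  ultimately show ?thesis
    by (simp add: moment_solutions_def)
qed

end

context moment_problem
begin

section \<open>The correspondence between spectral functions and solutions\<close>

lemma spectral_functions_iff:
  "E \<in> spectral_functions TYPE('k) H A \<longleftrightarrow>
    (\<exists>(K :: 'k ipspace) J U Et. unitary_dilation \<H> d S K Et J U \<and> E = unitary_dilation.spectral_fun \<H> d S K Et J)"
proof
  assume "E \<in> spectral_functions TYPE('k) H A"
  then obtain K :: "'k ipspace" and J U Et where K: "hilbert_space K" "J \<in> isometries H K" "U \<in> unitary_ops K"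
      "\<forall>(x, y)\<in>A. U (J x) = J y" "resolution_of_identity K Et" "has_strong_integral K cis Et U"
    and E: "E = (\<lambda>t\<in>{0..2 * pi}. compression H K J (Et t))"
    unfolding spectral_functions_def by blast
  have dil: "unitary_dilation \<H> d S K Et J U"
    using K moment_problem_axioms
    by (intro unitary_dilation.intro spectral_resolution.intro spectral_resolution_axioms.intro
        unitary_dilation_axioms.intro) auto
  moreover have "E = unitary_dilation.spectral_fun \<H> d S K Et J"
    unfolding E unitary_dilation.spectral_fun_def[OF dil] ..
  ultimately show "\<exists>(K :: 'k ipspace) J U Et. unitary_dilation \<H> d S K Et J U \<and> E = unitary_dilation.spectral_fun \<H> d S K Et J"
    by blast
next
  assume "\<exists>(K :: 'k ipspace) J U Et. unitary_dilation \<H> d S K Et J U \<and> E = unitary_dilation.spectral_fun \<H> d S K Et J"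
  then obtain K :: "'k ipspace" and J U Et where dil: "unitary_dilation \<H> d S K Et J U"
    and E: "E = unitary_dilation.spectral_fun \<H> d S K Et J"
    by blast
  interpret unitary_dilation \<H> d S K Et J U by (rule dil)
  show "E \<in> spectral_functions TYPE('k) H A"
    unfolding spectral_functions_def E spectral_fun_def
    using K.hilbert_space_axioms J U extension U_integral K.resolution by blast
qed

lemma spectral_functions_generate:
  assumes "E \<in> spectral_functions TYPE('k) H A"
  shows "generated_solution \<H> d S E \<in> moment_solutions \<H> d S"
  using assms unitary_dilation.sol_moment_solution unfolding spectral_functions_iff by blast

text \<open>The two dilation spaces may have different types; this is what later confines all
  spectral functions to a single type.\<close>

lemma generated_solution_inj:
  assumes E: "E \<in> spectral_functions TYPE('k) H A" and E': "E' \<in> spectral_functions TYPE('l) H A"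
    and eq: "generated_solution \<H> d S E = generated_solution \<H> d S E'"
  shows "E = E'"
proof -
  obtain K :: "'k ipspace" and J U Et where D: "unitary_dilation \<H> d S K Et J U"
    and E_eq: "E = unitary_dilation.spectral_fun \<H> d S K Et J"
    using E unfolding spectral_functions_iff by blast
  obtain K' :: "'l ipspace" and J' U' Et' where D': "unitary_dilation \<H> d S K' Et' J' U'"
    and E'_eq: "E' = unitary_dilation.spectral_fun \<H> d S K' Et' J'"
    using E' unfolding spectral_functions_iff by blast
  interpret D: unitary_dilation \<H> d S K Et J U by (rule D)
  interpret D': unitary_dilation \<H> d S K' Et' J' U' by (rule D')
  have "E t x = E' t x" if t: "t \<in> {0..2 * pi}" and x: "x \<in> carrier H" for t x
  proof -
    have carr: "E t y \<in> carrier H" "E' t y \<in> carrier H" if "y \<in> carrier H" for y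
      using bounded_opsD(1)[OF D.spectral_fun_bounded[OF t] that] bounded_opsD(1)[OF D'.spectral_fun_bounded[OF t] that]
      by (simp_all add: E_eq E'_eq)
    \<comment> \<open>On generators both matrix entries are limits of the same sums.\<close>
    have vecs_eq: "E t b = E' t b" if "b \<in> vecs" for b
    proof (rule H.total_eqI[OF vecs_total vecs_subset])
      fix a assume "a \<in> vecs"
      then obtain g k where a: "a = mvec g k" "g \<in> carrier \<H>" "k \<le> d"
        by (auto simp: vecs_def)
      from that obtain h j where b: "b = mvec h j" "h \<in> carrier \<H>" "j \<le> d"
        by (auto simp: vecs_def)
      show "\<langle>E t b, a\<rangle>\<^bsub>H\<^esub> = \<langle>E' t b, a\<rangle>\<^bsub>H\<^esub>"
        using D.sprod_spectral_fun_mvec[OF t b(2) a(2) b(3) a(3)] D'.sprod_spectral_fun_mvec[OF t b(2) a(2) b(3) a(3)]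
        unfolding a(1) b(1) E_eq[symmetric] E'_eq[symmetric] eq by (rule LIMSEQ_unique)
    qed (use that vecs_subset carr in auto)
    \<comment> \<open>Self-adjointness moves both operators onto the test generator, where they
      already agree.\<close>
    show "E t x = E' t x"
    proof (rule H.total_eqI[OF vecs_total vecs_subset])
      fix a assume a: "a \<in> vecs"
      then have "a \<in> carrier H"
        using vecs_subset by blast
      then show "\<langle>E t x, a\<rangle>\<^bsub>H\<^esub> = \<langle>E' t x, a\<rangle>\<^bsub>H\<^esub>"
        using vecs_eq[OF a] D.spectral_fun_self_adjoint[OF t x, of a] D'.spectral_fun_self_adjoint[OF t x, of a]
        by (simp add: E_eq E'_eq)
    qed (use x carr in auto)
  qed
  \<comment> \<open>Equality of the functions also concerns the default values outside their
    domains.\<close>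
  moreover have "E t x = undefined" "E' t x = undefined" if "t \<in> {0..2 * pi}" "x \<notin> carrier H" for t x
    using that bounded_opsD(4)[OF D.spectral_fun_bounded] bounded_opsD(4)[OF D'.spectral_fun_bounded]
    by (auto simp: E_eq E'_eq extensional_def)
  moreover have "E t = undefined" "E' t = undefined" if "t \<notin> {0..2 * pi}" for t
    using that by (auto simp: E_eq E'_eq D.spectral_fun_def D'.spectral_fun_def)
  ultimately show ?thesis
    by (intro ext) metis
qed

lemma solution_has_spectral_function:
  assumes F: "F \<in> moment_solutions \<H> d S"
  shows "\<exists>E\<in>spectral_functions TYPE('a dilation_vec) H A. F = generated_solution \<H> d S E"
proof -
  have F_ops: "F \<in> {0..2 * pi} \<rightarrow>\<^sub>E bounded_ops \<H> \<H>"
    using F by (simp add: moment_solutions_def operator_functions_def)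
  then have F_bounded: "\<And>t. t \<in> {0..2 * pi} \<Longrightarrow> F t \<in> bounded_ops \<H> \<H>"
    by auto
  have F_mono: "\<langle>F t x \<ominus>\<^bsub>\<H>\<^esub> F s x, x\<rangle>\<^bsub>\<H>\<^esub> \<in> \<real>\<^sub>\<ge>\<^sub>0"
    if "s \<in> {0..2 * pi}" "t \<in> {0..2 * pi}" "s \<le> t" "x \<in> carrier \<H>" for s t x
    using F that unfolding moment_solutions_def by blast
  have F_0: "F 0 x = \<zero>\<^bsub>\<H>\<^esub>" if "x \<in> carrier \<H>" for x
    using F that unfolding moment_solutions_def by blast
  have F_lcont: "strongly_left_continuous \<H> F"
    using F unfolding moment_solutions_def by blast
  have F_integral: "has_strong_integral \<H> (\<lambda>t. cis (real n * t)) F (S n)" if "n \<le> d" for n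
    using F that by (simp add: moment_solutions_def)
  obtain K :: "'a dilation_vec ipspace" and Et v where K: "hilbert_space K" and res: "resolution_of_identity K Et"
    and v: "\<And>x. x \<in> carrier \<H> \<Longrightarrow> v x \<in> carrier K"
    and sprod_v: "\<And>t x y. \<lbrakk>t \<in> {0..2 * pi}; x \<in> carrier \<H>; y \<in> carrier \<H>\<rbrakk> \<Longrightarrow> \<langle>Et t (v x), v y\<rangle>\<^bsub>K\<^esub> = \<langle>F t x, y\<rangle>\<^bsub>\<H>\<^esub>"
    using naimark_dilation[of \<H> F] X.hilbert_space_axioms F_bounded F_mono F_0 F_lcont by blast
  interpret K: spectral_resolution K Et
    using K res by (intro spectral_resolution.intro spectral_resolution_axioms.intro)
  \<comment> \<open>Both sides are limits along uniform partitions: the sums for Et at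
    \<open>v h\<close> and \<open>v g\<close> are term by term those for F at h and g.\<close>
  have moment: "\<langle>K.spectral_power (int n) (v h), v g\<rangle>\<^bsub>K\<^esub> = \<langle>S n h, g\<rangle>\<^bsub>\<H>\<^esub>"
    if n: "n \<le> d" and h: "h \<in> carrier \<H>" and g: "g \<in> carrier \<H>" for n h g
  proof (rule LIMSEQ_unique)
    let ?R = "\<lambda>N. rs_sum \<H> (\<lambda>t. cis (real n * t)) F (Suc N) (uniform_partition N) (uniform_partition N) h"
    have upI: "uniform_partition N i \<in> {0..2 * pi}" if "i \<le> Suc N" for N i
      using tagged_partition_range[OF tagged_uniform_partition_8 that] .
    have Fh: "F (uniform_partition N i) h \<in> carrier \<H>" if "i \<le> Suc N" for N i
      using bounded_opsD(1)[OF F_bounded[OF upI[OF that]] h] .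
    have Sn: "S n h \<in> carrier \<H>"
      by (rule bounded_opsD(1)[OF S_bounded[OF n] h])
    have "\<langle>K.approx (int n) N (v h), v g\<rangle>\<^bsub>K\<^esub> = \<langle>?R N, g\<rangle>\<^bsub>\<H>\<^esub>" for N
    proof -
      have "\<langle>?R N, g\<rangle>\<^bsub>\<H>\<^esub> = (\<Sum>i<Suc N. cis (real n * uniform_partition N i) *
          (\<langle>F (uniform_partition N (Suc i)) h, g\<rangle>\<^bsub>\<H>\<^esub> - \<langle>F (uniform_partition N i) h, g\<rangle>\<^bsub>\<H>\<^esub>))"
        using Fh g by (rule X.sprod_rs_sum_left)
      also have "\<dots> = \<langle>K.approx (int n) N (v h), v g\<rangle>\<^bsub>K\<^esub>"
        unfolding K.sprod_approx_left[OF v[OF h] v[OF g]]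
        using upI h g by (intro sum.cong refl) (simp add: sprod_v)
      finally show ?thesis by simp
    qed
    then show "(\<lambda>N. \<langle>?R N, g\<rangle>\<^bsub>\<H>\<^esub>) \<longlonglongrightarrow> \<langle>K.spectral_power (int n) (v h), v g\<rangle>\<^bsub>K\<^esub>"
      using K.sprod_spectral_power_left[OF v[OF h] v[OF g], of "int n"] by simp
    have "hlim \<H> ?R (S n h)"
      using bounded_opsD(1)[OF F_bounded h]
      by (intro has_strong_integral_hlim[OF X.semi_inner_product_space_axioms F_integral[OF n] h Sn])
    moreover have "?R N \<in> carrier \<H>" for N
      using Fh by (rule X.rs_sum_carrier)
    ultimately show "(\<lambda>N. \<langle>?R N, g\<rangle>\<^bsub>\<H>\<^esub>) \<longlonglongrightarrow> \<langle>S n h, g\<rangle>\<^bsub>\<H>\<^esub>"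
      using g Sn by (intro X.hlim_sprod_left) auto
  qed
  define a where "a p = mvec (fst p) (snd p)" for p :: "'a \<times> nat"
  define b where "b p = K.spectral_power (int (snd p)) (v (fst p))" for p :: "'a \<times> nat"
  let ?P = "carrier \<H> \<times> {..d}"
  have ab: "\<langle>a p, a q\<rangle>\<^bsub>H\<^esub> = \<langle>b p, b q\<rangle>\<^bsub>K\<^esub>" if p: "p \<in> ?P" and q: "q \<in> ?P" for p q
  proof -
    obtain h j g k where pq: "p = (h, j)" "q = (g, k)" and h: "h \<in> carrier \<H>" and g: "g \<in> carrier \<H>"
      and jk: "j \<le> d" "k \<le> d"
      using p q by auto
    have "\<langle>K.spectral_power (int j - int k) (v h), v g\<rangle>\<^bsub>K\<^esub> = \<langle>ext_moment \<H> S (int j - int k) h, g\<rangle>\<^bsub>\<H>\<^esub>"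
    proof (cases "k \<le> j")
      case True
      then show ?thesis
        using moment[of "j - k" h g] jk h g by (simp add: ext_moment_def of_nat_diff nat_diff_distrib)
    next
      \<comment> \<open>A negative exponent is the adjoint of the positive one, just as
        \<open>ext_moment\<close> is at negative indices.\<close>
      case False
      then have kj: "int j - int k = - int (k - j)" "k - j \<le> d"
        using jk by auto
      have "\<langle>K.spectral_power (- int (k - j)) (v h), v g\<rangle>\<^bsub>K\<^esub> = \<langle>v h, K.spectral_power (int (k - j)) (v g)\<rangle>\<^bsub>K\<^esub>"
        using v h g by (simp add: K.spectral_power_adjoint)
      also have "\<dots> = cnj \<langle>S (k - j) g, h\<rangle>\<^bsub>\<H>\<^esub>"
        unfolding moment[OF kj(2) g h, symmetric] using v h g by (intro K.sprod_commute) auto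
      also have "\<dots> = \<langle>ext_moment \<H> S (- int (k - j)) h, g\<rangle>\<^bsub>\<H>\<^esub>"
        using ext_moment_hermitian[of "- int (k - j)" h g] kj(2) h g by (simp add: ext_moment_def[of _ _ "int (k - j)"])
      finally show ?thesis
        unfolding kj(1) .
    qed
    then show ?thesis
      using v h g jk by (simp add: a_def b_def pq sprod_vec K.sprod_spectral_power)
  qed
  have "a ` ?P = vecs"
    by (force simp: a_def vecs_def)
  then have total: "perp H (a ` ?P) \<subseteq> {\<zero>\<^bsub>H\<^esub>}"
    using vecs_total by simp
  have carr: "a p \<in> carrier H" "b p \<in> carrier K" if "p \<in> ?P" for p
    using that v by (auto simp: a_def b_def)
  obtain J where J: "J \<in> isometries H K" and Jab: "\<And>p. p \<in> ?P \<Longrightarrow> J (a p) = b p"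
    using isometric_extension[OF H.hilbert_space_axioms K.hilbert_space_axioms carr ab total] by blast
  have J_vec: "J (mvec h j) = K.spectral_power (int j) (v h)" if "h \<in> carrier \<H>" "j \<le> d" for h j
    using Jab[of "(h, j)"] that by (simp add: a_def b_def)
  have dil: "unitary_dilation \<H> d S K Et J (K.spectral_power 1)"
  proof (intro unitary_dilation.intro unitary_dilation_axioms.intro moment_problem_axioms K.spectral_resolution_axioms J)
    show "K.spectral_power 1 \<in> unitary_ops K"
      by (rule K.spectral_power_unitary)
    show "has_strong_integral K cis Et (K.spectral_power 1)"
      using K.spectral_power_has_integral[of 1] by simp
    show "K.spectral_power 1 (J x) = J y" if "(x, y) \<in> A" for x y
    proof (rule shift_op_extensionI[OF K.hilbert_space_axioms J _ _ that])
      show "K.spectral_power 1 \<in> bounded_ops K K"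
        using K.spectral_power_isometry by (rule isometriesD(1))
      show "K.spectral_power 1 (J (mvec h j)) = J (mvec h (Suc j))" if "h \<in> carrier \<H>" "j < d" for h j
        using that v by (simp add: J_vec K.spectral_power_compose)
    qed
  qed
  interpret D: unitary_dilation \<H> d S K Et J "K.spectral_power 1"
    by (rule dil)
  have "F = generated_solution \<H> d S D.spectral_fun"
  proof (rule PiE_ext[OF F_ops])
    show "generated_solution \<H> d S D.spectral_fun \<in> {0..2 * pi} \<rightarrow>\<^sub>E bounded_ops \<H> \<H>"
      using D.sol_moment_solution by (simp add: moment_solutions_def operator_functions_def)
    fix t assume t: "t \<in> {0..2 * pi}"
    note bounded = F_bounded[OF t] D.sol_bounded[OF t]
    show "F t = D.F t"
    proof (rule extensionalityI[OF bounded_opsD(4)[OF bounded(1)] bounded_opsD(4)[OF bounded(2)]])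
      fix h assume h: "h \<in> carrier \<H>"
      show "F t h = D.F t h"
      proof (rule X.vec_eqI[OF bounded_opsD(1)[OF bounded(1) h] bounded_opsD(1)[OF bounded(2) h]])
        fix g assume g: "g \<in> carrier \<H>"
        \<comment> \<open>The case of exponent 0: \<open>J (mvec h 0)\<close> is
          \<open>v h\<close>.\<close>
        show "\<langle>F t h, g\<rangle>\<^bsub>\<H>\<^esub> = \<langle>D.F t h, g\<rangle>\<^bsub>\<H>\<^esub>"
          using t h g v by (simp add: D.sprod_sol J_vec K.spectral_power_0 sprod_v)
      qed
    qed
  qed
  moreover have "D.spectral_fun \<in> spectral_functions TYPE('a dilation_vec) H A"
    unfolding spectral_functions_iff using dil by blast
  ultimately show ?thesis
    by blast
qed

text \<open>The solution generated by E is also generated by some E' over the fixed type, and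
  injectivity across types identifies E with E'.\<close>

lemma spectral_functions_subset_dilation:
  "spectral_functions TYPE('k) H A \<subseteq> spectral_functions TYPE('a dilation_vec) H A"
proof
  fix E assume E: "E \<in> spectral_functions TYPE('k) H A"
  obtain E' where E': "E' \<in> spectral_functions TYPE('a dilation_vec) H A"
    "generated_solution \<H> d S E = generated_solution \<H> d S E'"
    using solution_has_spectral_function[OF spectral_functions_generate[OF E]] by blast
  then show "E \<in> spectral_functions TYPE('a dilation_vec) H A"
    using generated_solution_inj[OF E E'] by simp
qed

end

text \<open>The type \<open>'k\<close> is arbitrary, so the inclusion says that dilation spaces of
  other types add no spectral functions. The bijection over \<open>'a dilation_vec\<close> is
  therefore one with all spectral functions.\<close>

theorem theorem1:
  fixes \<H> :: "'a ipspace" and d :: nat and S :: "nat \<Rightarrow> 'a \<Rightarrow> 'a"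
  assumes "hilbert_space \<H>"
    and "d \<ge> 1"
    and "\<And>n. n \<le> d \<Longrightarrow> S n \<in> bounded_ops \<H> \<H>"
    and "\<And>h. (\<And>k. k \<le> d \<Longrightarrow> h k \<in> carrier \<H>) \<Longrightarrow>
           (\<Sum>k\<le>d. \<Sum>l\<le>d. \<langle>ext_moment \<H> S (int l - int k) (h l), h k\<rangle>\<^bsub>\<H>\<^esub>) \<in> \<real>\<^sub>\<ge>\<^sub>0"
  shows
    "(\<forall>F \<in> moment_solutions \<H> d S.
        \<exists>E \<in> spectral_functions TYPE('a dilation_vec) (moment_space \<H> d S) (shift_op \<H> d S).
          F = generated_solution \<H> d S E) \<and>
     (\<forall>E \<in> spectral_functions TYPE('k) (moment_space \<H> d S) (shift_op \<H> d S).
        generated_solution \<H> d S E \<in> moment_solutions \<H> d S) \<and>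
     spectral_functions TYPE('k) (moment_space \<H> d S) (shift_op \<H> d S)
       \<subseteq> spectral_functions TYPE('a dilation_vec) (moment_space \<H> d S) (shift_op \<H> d S) \<and>
     bij_betw (generated_solution \<H> d S)
       (spectral_functions TYPE('a dilation_vec) (moment_space \<H> d S) (shift_op \<H> d S))
       (moment_solutions \<H> d S)"
proof -
  interpret moment_problem \<H> d S
    by (intro moment_problem.intro moment_problem_axioms.intro assms)
  have "bij_betw (generated_solution \<H> d S) (spectral_functions TYPE('a dilation_vec) H A) (moment_solutions \<H> d S)"
    unfolding bij_betw_def
  proof
    show "inj_on (generated_solution \<H> d S) (spectral_functions TYPE('a dilation_vec) H A)"
      using generated_solution_inj by (rule inj_onI)
    show "generated_solution \<H> d S ` spectral_functions TYPE('a dilation_vec) H A = moment_solutions \<H> d S"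
      using spectral_functions_generate solution_has_spectral_function by blast
  qed
  then show ?thesis
    using solution_has_spectral_function spectral_functions_generate spectral_functions_subset_dilation by blast
qed

end
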